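(* Let $t$ be a fixed positive integer. For each $n\ge 1$, let $Y_t(n)$ denote the random variable giving the number of hooks of length exactly $t$ in a partition $\lambda$ of $n$ chosen uniformly at random among the $p(n)$ partitions of $n$. Then: (1) The sequence $\{Y_t(n)\}$ is asymptotically normal, with mean $\mu_t(n)\sim \frac{\sqrt{6n}}{\pi}-\frac{t}{2}$ and variance $\sigma_t^2(n)\sim \frac{(\pi^2-6)\sqrt{6n}}{2\pi^3}$ as $n\to\infty$. (2) Let $$D_t(k;n):=\frac{\#\{\lambda\vdash n \text{ with at most } k \text{ hooks of length } t\}}{p(n)},$$ and let $k_{t,n}(x):=\mu_t(n)+\sigma_t(n)x$. Then for every real $x$, $$\lim_{n\to+\infty} D_t(k_{t,n}(x);n)=\frac{1}{\sqrt{2\pi}}\int_{-\infty}^{x}e^{-y^2/2}\,dy.$$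
   Context: A partition $\lambda=(\lambda_1,\dots,\lambda_m)$ of $n$ (written $\lambda\vdash n$) is a nonincreasing sequence of positive integers summing to $n$; $p(n)$ is the number of partitions of $n$. Its Young diagram is the left-justified array of boxes with row lengths $\lambda_1,\dots,\lambda_m$. The hook of the cell $(k,j)$ consists of that cell together with all cells to its right in the same row and all cells below it in the same column; its hook length is $h(k,j)=(\lambda_k-k)+(\lambda'_j-j)+1$, where $\lambda'_j$ is the number of parts of $\lambda$ that are at least $j$. The multiset of hook lengths of $\lambda$ is $\mathcal{H}(\lambda)$, and "the number of hooks of length $t$" is the multiplicity of $t$ in $\mathcal{H}(\lambda)$. Here $\mu_t(n)$ and $\sigma_t^2(n)$ denote the mean and variance of $Y_t(n)$, and $\sigma_t(n)>0$ its standard deviation. *)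

theory Defs
  imports
    "HOL-Probability.Probability"
    "HOL-Library.Multiset"
    "HOL-Library.Landau_Symbols"
begin

section \<open>Partitions, hooks and hook lengths\<close>

definition partitions :: "nat \<Rightarrow> nat list set" where
  "partitions n = {lam. sorted_wrt (\<ge>) lam \<and> (\<forall>p\<in>set lam. 0 < p) \<and> sum_list lam = n}"

text \<open>Rows and columns are numbered from 1, so the \<open>k\<close>-th part of \<open>lam\<close> is \<open>lam ! (k - 1)\<close>.\<close>

definition young_diagram :: "nat list \<Rightarrow> (nat \<times> nat) set" where
  "young_diagram lam = {(k, j). 1 \<le> k \<and> k \<le> length lam \<and> 1 \<le> j \<and> j \<le> lam ! (k - 1)}"

definition conjugate_part :: "nat list \<Rightarrow> nat \<Rightarrow> nat" where
  "conjugate_part lam j = length (filter (\<lambda>p. j \<le> p) lam)"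

definition hook :: "nat list \<Rightarrow> nat \<Rightarrow> nat \<Rightarrow> (nat \<times> nat) set" where
  "hook lam k j =
     {(k', j') \<in> young_diagram lam. (k' = k \<and> j \<le> j') \<or> (j' = j \<and> k \<le> k')}"

text \<open>Integer-valued, because \<open>\<lambda>\<^sub>k - k\<close> and \<open>\<lambda>'\<^sub>j - j\<close> may each be negative;
  \<open>hook_length_eq_card_hook\<close> below shows that it counts the cells of the hook.\<close>

definition hook_length :: "nat list \<Rightarrow> nat \<Rightarrow> nat \<Rightarrow> int" where
  "hook_length lam k j =
     (int (lam ! (k - 1)) - int k) + (int (conjugate_part lam j) - int j) + 1"

definition hook_lengths :: "nat list \<Rightarrow> int multiset" where
  "hook_lengths lam = {# hook_length lam k j. (k, j) \<in># mset_set (young_diagram lam) #}"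

definition num_hooks :: "nat \<Rightarrow> nat list \<Rightarrow> nat" where
  "num_hooks t lam = count (hook_lengths lam) (int t)"

lemma finite_young_diagram: "finite (young_diagram lam)"
proof (rule finite_subset)
  show "young_diagram lam \<subseteq> (\<Union>k\<in>{..length lam}. {k} \<times> {..lam ! (k - 1)})"
    by (auto simp: young_diagram_def)
qed auto

lemma finite_partitions: "finite (partitions n)"
proof (rule finite_subset)
  show "partitions n \<subseteq> {xs. set xs \<subseteq> {..n} \<and> length xs \<le> n}"
  proof
    fix xs assume xs: "xs \<in> partitions n"
    have "length xs \<le> sum_list xs" if "\<forall>p\<in>set xs. 0 < p" for xs :: "nat list"
      using that by (induction xs) auto
    with xs show "xs \<in> {xs. set xs \<subseteq> {..n} \<and> length xs \<le> n}"
      by (auto simp: partitions_def intro: member_le_sum_list)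
  qed
  show "finite {xs. set xs \<subseteq> {..n} \<and> length xs \<le> n}"
    by (rule finite_lists_length_le) simp
qed

lemma partitions_nonempty: "partitions n \<noteq> {}"
proof -
  have "(if n = 0 then [] else [n]) \<in> partitions n"
    by (auto simp: partitions_def)
  then show ?thesis by blast
qed

lemma hook_length_eq_card_hook:
  assumes lam: "lam \<in> partitions n" and kj: "(k, j) \<in> young_diagram lam"
  shows "hook_length lam k j = int (card (hook lam k j))"
proof -
  define S where "S = {i. i < length lam \<and> j \<le> lam ! i}"
  define c where "c = card S"
  have S_down: "i' \<in> S" if "i \<in> S" "i' \<le> i" for i i'
  proof (cases "i' = i")
    case False
    then have "lam ! i \<le> lam ! i'"
      using that lam sorted_wrt_nth_less[of "(\<ge>)" lam i' i]
      by (auto simp: partitions_def S_def)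
    with that show ?thesis by (auto simp: S_def)
  qed (use that in simp)
  have fin: "finite S" by (simp add: S_def)
  have S_eq: "S = {..<c}"
  proof (cases "S = {}")
    case False
    have "S = {..Max S}"
      using S_down[OF Max_in[OF fin False]] Max_ge[OF fin] by auto
    then have "c = Suc (Max S)" unfolding c_def by (metis card_atMost)
    with \<open>S = {..Max S}\<close> show ?thesis by (metis lessThan_Suc_atMost)
  qed (simp add: c_def)
  have conj: "conjugate_part lam j = c"
    by (simp add: conjugate_part_def c_def S_def length_filter_conv_card)
  have mem: "i < length lam \<and> j \<le> lam ! i \<longleftrightarrow> i < c" for i
    using S_eq by (auto simp: S_def)
  have k: "1 \<le> k" "k \<le> length lam" "1 \<le> j" "j \<le> lam ! (k - 1)"
    using kj by (auto simp: young_diagram_def)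
  have kc: "k \<le> c" using mem[of "k - 1"] k by auto
  have arm_leg: "hook lam k j = {k} \<times> {j..lam ! (k - 1)} \<union> {k<..c} \<times> {j}"
  proof -
    have "(k' \<le> length lam \<and> j \<le> lam ! (k' - 1)) \<longleftrightarrow> k' \<le> c" if "1 \<le> k'" for k'
      using mem[of "k' - 1"] that by (cases k') auto
    then show ?thesis
      using k kc by (fastforce simp: hook_def young_diagram_def)
  qed
  have "card (hook lam k j) = (lam ! (k - 1) + 1 - j) + (c - k)"
    unfolding arm_leg by (subst card_Un_disjoint) (auto simp: card_cartesian_product)
  then show ?thesis
    using k kc by (simp add: hook_length_def conj)
qed


section \<open>Random partitions\<close>

definition random_partition :: "nat \<Rightarrow> nat list pmf" where
  "random_partition n = pmf_of_set (partitions n)"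

definition hook_mean :: "nat \<Rightarrow> nat \<Rightarrow> real" where
  "hook_mean t n =
     measure_pmf.expectation (random_partition n) (\<lambda>lam. real (num_hooks t lam))"

definition hook_variance :: "nat \<Rightarrow> nat \<Rightarrow> real" where
  "hook_variance t n =
     measure_pmf.variance (random_partition n) (\<lambda>lam. real (num_hooks t lam))"

definition hook_sd :: "nat \<Rightarrow> nat \<Rightarrow> real" where
  "hook_sd t n = sqrt (hook_variance t n)"

text \<open>The variables \<open>X n\<close>, each on its own probability space \<open>M n\<close>, converge in distribution
  to the standard normal law after subtracting the mean and dividing by the standard deviation.
  Terms with zero variance contribute the constant 0 (as division by 0 gives 0); this is harmless
  as long as the variance is eventually positive.\<close>

definition asymptotically_normal ::
    "(nat \<Rightarrow> 'a measure) \<Rightarrow> (nat \<Rightarrow> 'a \<Rightarrow> real) \<Rightarrow> bool" where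
  "asymptotically_normal M X \<longleftrightarrow>
     weak_conv_m
       (\<lambda>n. distr (M n) borel
          (\<lambda>w. (X n w - prob_space.expectation (M n) (X n)) /
               sqrt (prob_space.variance (M n) (X n))))
       std_normal_distribution"

definition hook_distribution :: "nat \<Rightarrow> real \<Rightarrow> nat \<Rightarrow> real" where
  "hook_distribution t k n =
     real (card {lam \<in> partitions n. real (num_hooks t lam) \<le> k}) / real (card (partitions n))"

end

theory Submission
  imports Defs "HOL-Real_Asymp.Real_Asymp"
begin

text \<open>
  Reading partitions as Maya diagrams and splitting these along residue classes modulo \<open>t\<close>
  (the Littlewood decomposition), the hooks of length \<open>t\<close> become the hooks of length 1 of the
  \<open>t\<close> partitions in the quotient, which gives Han's formula
  \<open>\<Sum>\<^sub>\<lambda> z\<^bsup>|\<lambda>|\<^esup> T\<^bsup>Y(\<lambda>)\<^esup> = \<Prod>\<^sub>m (1 + (T - 1) z\<^bsup>tm\<^esup>)\<^sup>t / (1 - z\<^sup>m)\<close>.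
  The coefficient of \<open>z\<^sup>n\<close> is a Fourier integral over the circle of radius \<open>exp (-\<tau>)\<close> with
  \<open>\<tau> = \<pi> / sqrt (6 n)\<close>. For \<open>T = exp (w / n\<^bsup>1/4\<^esup>)\<close> and angle \<open>u / n\<^bsup>3/4\<^esup>\<close> the integrand,
  normalised by \<open>exp (-w sqrt (6 n) / (\<pi> n\<^bsup>1/4\<^esup>))\<close>, converges to a Gaussian in \<open>u\<close> and is dominated
  by a multiple of \<open>1 / (1 + u\<^sup>2)\<close> on the whole circle. Hence the moment generating function of
  \<open>(Y - sqrt (6 n) / \<pi>) / n\<^bsup>1/4\<^esup>\<close> converges to that of a centred normal law at every complex
  argument. Real arguments yield the first two moments, and imaginary arguments yield the limit law
  by Levy's continuity theorem.
\<close>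

section \<open>Maya diagrams\<close>

text \<open>Two cancellations shape the analysis. The sum over cores is removed by comparison with
  \<open>T = 1\<close>, and the moment generating function is a quotient of two integrals with the
  same prefactor, the one with \<open>w = 0\<close> giving p(n). With
  \<open>b = saddle_const\<close> the exponent tends to
  \<open>- u^2 / b + i w u / b^2 + w^2 / (4 b)\<close>. The last term is the variance
  \<open>1 / (2 b)\<close> that the count would have if the multiplicities of the parts were
  independent. The mixed term expresses that the size is fixed at n; integrating out
  \<open>u\<close> subtracts \<open>1 / (2 b^3)\<close> from the variance, and this produces the
  factor pi^2 - 6. The obstacle is domination far from the saddle: the marked factor may grow like
  the exponential of a multiple of \<open>min |u| r\<close>, and the partition factor has to beat it
  by a decay \<open>exp (- k (min |u| r)^2)\<close> on the whole circle. The mark \<open>w\<close>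
  varies with n throughout, because standardising by the true standard deviation yields arguments
  that merely converge.\<close>

definition maya :: "int set \<Rightarrow> bool" where
  "maya S \<longleftrightarrow> finite (S - {..<0}) \<and> finite ({..<0} - S)"

text \<open>The sum of \<open>g\<close> over \<open>S\<close>, regularised by subtracting the divergent sum over the vacuum \<open>{..<0}\<close>.\<close>

definition msum :: "(int \<Rightarrow> int) \<Rightarrow> int set \<Rightarrow> int" where
  "msum g S = sum g (S - {..<0}) - sum g ({..<0} - S)"

text \<open>Charge 0 singles out the diagrams of partitions, and there the energy is the size. On
  the residue classes of a diagram the charge can be any integer.\<close>

abbreviation charge :: "int set \<Rightarrow> int" where "charge \<equiv> msum (\<lambda>_. 1)"
abbreviation energy :: "int set \<Rightarrow> int" where "energy \<equiv> msum (\<lambda>x. x)"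

definition shift :: "int \<Rightarrow> int set \<Rightarrow> int set" where
  "shift c S = (\<lambda>x. x + c) ` S"

lemma mem_shift_iff: "x \<in> shift c S \<longleftrightarrow> x - c \<in> S"
  by (force simp: shift_def image_iff)

lemma shift_shift: "shift a (shift b S) = shift (b + a) S"
  by (simp add: set_eq_iff mem_shift_iff diff_diff_eq add.commute)

lemma shift_0 [simp]: "shift 0 S = S"
  by (simp add: shift_def)

lemma shift_eq_iff: "shift c S = shift c S' \<longleftrightarrow> S = S'"
  unfolding shift_def by (rule inj_image_eq_iff) (simp add: inj_def)

lemma finite_shift [simp]: "finite (shift c S) \<longleftrightarrow> finite S"
  unfolding shift_def by (rule finite_image_iff) (simp add: inj_on_def)

lemma sum_shift: "sum g (shift c S) = (\<Sum>x\<in>S. g (x + c))"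
  unfolding shift_def by (subst sum.reindex) (auto simp: inj_on_def)

text \<open>These are the beads that can be pushed down by \<open>t\<close> into a gap. Each such
  move removes a rim hook of length \<open>t\<close>, so they correspond to the cells of hook length
  \<open>t\<close>; \<open>num_hooks_eq_hooks\<close> proves the count.\<close>

definition hooks :: "int \<Rightarrow> int set \<Rightarrow> int set" where
  "hooks t S = {x \<in> S. x - t \<notin> S}"

lemma maya_vac [simp]: "maya {..<0}"
  by (simp add: maya_def)

lemma msum_vac [simp]: "msum g {..<0} = 0"
  by (simp add: msum_def)

lemma maya_insert: "maya S \<Longrightarrow> maya (insert y S)"
  by (auto simp: maya_def insert_Diff_if finite_subset[OF Diff_mono[OF order_refl subset_insertI]])

lemma msum_insert:
  assumes "maya S" "y \<notin> S"
  shows "msum g (insert y S) = msum g S + g y"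
proof (cases "y < 0")
  case True
  have *: "{..<0} - insert y S = ({..<0} - S) - {y}" "insert y S - {..<0} = S - {..<0}"
    using True by auto
  show ?thesis
    using assms True by (simp add: msum_def maya_def * sum_diff1)
next
  case False
  have *: "{..<0} - insert y S = {..<0} - S" "insert y S - {..<0} = insert y (S - {..<0})"
    using False by auto
  show ?thesis
    using assms False by (simp add: msum_def maya_def *)
qed

lemma maya_shift:
  assumes "maya S"
  shows "maya (shift c S)"
proof -
  have "shift c S - {..<0} \<subseteq> shift c (S - {..<0}) \<union> {0..<c}"
    by (auto simp: mem_shift_iff)
  moreover have "{..<0} - shift c S \<subseteq> shift c ({..<0} - S) \<union> {c..<0}"
    by (auto simp: mem_shift_iff)
  ultimately show ?thesis
    using assms unfolding maya_def
    by (meson finite_UnI finite_atLeastLessThan_int finite_shift finite_subset)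
qed

text \<open>Only position -1, moved to 0, crosses the border of the vacuum. If it is a bead, a new
  term \<open>g 0\<close> appears; if it is a gap, its subtracted term \<open>g (-1 + 1)\<close>
  disappears. Both changes add \<open>g 0\<close>.\<close>

lemma msum_shift_1:
  assumes "maya S"
  shows "msum g (shift 1 S) = msum (\<lambda>x. g (x + 1)) S + g 0"
proof (cases "-1 \<in> S")
  case True
  have 1: "shift 1 S - {..<0} = insert 0 (shift 1 (S - {..<0}))"
    using True by (intro set_eqI, rename_tac x, case_tac "x = 0") (auto simp: mem_shift_iff)
  have 2: "{..<0} - shift 1 S = shift 1 ({..<0} - S)"
    using True by (intro set_eqI, rename_tac x, case_tac "x = 0") (auto simp: mem_shift_iff)
  have 3: "0 \<notin> shift 1 (S - {..<0})" by (auto simp: mem_shift_iff)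
  show ?thesis
    using assms 3 by (simp add: msum_def 1 2 maya_def sum_shift)
next
  case False
  have 1: "shift 1 S - {..<0} = shift 1 (S - {..<0})"
    using False by (intro set_eqI, rename_tac x, case_tac "x = 0") (auto simp: mem_shift_iff)
  have 2: "{..<0} - shift 1 S = shift 1 ({..<0} - S - {-1})"
    using False by (intro set_eqI, rename_tac x, case_tac "x = 0") (auto simp: mem_shift_iff)
  show ?thesis
    using assms False by (simp add: msum_def 1 2 maya_def sum_shift sum_diff1)
qed

lemma msum_add: "msum (\<lambda>x. f x + g x) S = msum f S + msum g S"
  by (simp add: msum_def sum.distrib)

lemma msum_cmult: "msum (\<lambda>x. a * f x) S = a * msum f S"
  by (simp add: msum_def sum_distrib_left right_diff_distrib)

lemma charge_shift_1: "maya S \<Longrightarrow> charge (shift 1 S) = charge S + 1"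
  by (simp add: msum_shift_1)

lemma energy_shift_1: "maya S \<Longrightarrow> energy (shift 1 S) = energy S + charge S"
  by (simp add: msum_shift_1 msum_add)

text \<open>Each unit shift adds the current charge to the energy, so the energy grows by an
  arithmetic sum. Doubling keeps the triangular number \<open>c * (c - 1) / 2\<close> free of
  division.\<close>

lemma charge_energy_shift:
  assumes "maya S"
  shows "charge (shift c S) = charge S + c \<and> 2 * energy (shift c S) = 2 * energy S + 2 * c * charge S + c * (c - 1)"
proof (induction c rule: int_induct[where k = 0])
  case base
  then show ?case by simp
next
  case (step1 i)
  have "shift (i + 1) S = shift 1 (shift i S)" by (simp add: shift_shift)
  with step1 show ?case
    by (simp add: charge_shift_1 energy_shift_1 maya_shift assms) (simp add: algebra_simps)
next
  case (step2 i)
  have "shift i S = shift 1 (shift (i - 1) S)" by (simp add: shift_shift)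
  then have "charge (shift i S) = charge (shift (i - 1) S) + 1"
    "energy (shift i S) = energy (shift (i - 1) S) + charge (shift (i - 1) S)"
    using charge_shift_1[OF maya_shift[OF assms]] energy_shift_1[OF maya_shift[OF assms]] by metis+
  with step2 show ?case by (simp add: algebra_simps)
qed

lemma charge_shift: "maya S \<Longrightarrow> charge (shift c S) = charge S + c"
  using charge_energy_shift by blast

text \<open>The triangular number is rewritten as the energy of a shifted vacuum, the form in which
  it enters \<open>charge_weight\<close>.\<close>

lemma energy_shift:
  assumes "maya S"
  shows "energy (shift c S) = energy S + c * charge S + energy (shift c {..<0})"
  using charge_energy_shift[OF assms, of c] charge_energy_shift[OF maya_vac, of c]
  by (simp only: msum_vac) linarith

lemma energy_nonneg: "energy S \<ge> 0"
proof -
  have "sum (\<lambda>x. x) (S - {..<0}) \<ge> 0" by (rule sum_nonneg) auto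
  moreover have "sum (\<lambda>x. x) ({..<0} - S) \<le> 0" by (rule sum_nonpos) auto
  ultimately show ?thesis by (simp add: msum_def)
qed

lemma finite_hooks:
  assumes "maya S"
  shows "finite (hooks t S)"
proof -
  have "hooks t S \<subseteq> (S - {..<0}) \<union> shift t ({..<0} - S) \<union> {t..<0}"
    by (auto simp: hooks_def mem_shift_iff)
  then show ?thesis
    using assms unfolding maya_def
    by (meson finite_UnI finite_atLeastLessThan_int finite_shift finite_subset)
qed

lemma hooks_shift: "hooks t (shift c S) = shift c (hooks t S)"
  by (auto simp: hooks_def mem_shift_iff set_eq_iff algebra_simps)

lemma card_hooks_shift: "card (hooks t (shift c S)) = card (hooks t S)"
  unfolding hooks_shift by (simp add: shift_def card_image inj_on_def)

section \<open>The abacus: splitting a Maya diagram along residue classes modulo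
  \<open>t\<close>\<close>

definition runner :: "nat \<Rightarrow> nat \<Rightarrow> int set \<Rightarrow> int set" where
  "runner t i S = {y. int t * y + int i \<in> S}"

lemma sum_runner:
  fixes g :: "int \<Rightarrow> 'a :: comm_monoid_add"
  assumes "0 < t" "finite X"
  shows "sum g X = (\<Sum>i<t. \<Sum>y\<in>runner t i X. g (int t * y + int i))"
proof -
  have fin: "finite (runner t i X)" for i
  proof -
    have "inj (\<lambda>y. int t * y + int i)" using assms(1) by (simp add: inj_def)
    then have "finite ((\<lambda>y. int t * y + int i) -` X)" using assms(2) by (rule finite_vimageI[rotated])
    then show ?thesis by (simp add: runner_def vimage_def)
  qed
  have "(\<Sum>i<t. \<Sum>y\<in>runner t i X. g (int t * y + int i)) =
        (\<Sum>(i, y)\<in>Sigma {..<t} (\<lambda>i. runner t i X). g (int t * y + int i))"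
    using fin by (simp add: sum.Sigma)
  also have "\<dots> = sum g X"
  proof (rule sum.reindex_bij_witness[of _ "\<lambda>x. (nat (x mod int t), x div int t)" "\<lambda>(i, y). int t * y + int i"])
    fix a assume "a \<in> Sigma {..<t} (\<lambda>i. runner t i X)"
    then show "(nat ((case a of (i, y) \<Rightarrow> int t * y + int i) mod int t), (case a of (i, y) \<Rightarrow> int t * y + int i) div int t) = a"
      by (cases a) (auto simp: runner_def)
  qed (use assms in \<open>auto simp: runner_def nat_less_iff\<close>)
  finally show ?thesis by simp
qed

lemma runner_Diff: "runner t i (A - B) = runner t i A - runner t i B"
  by (auto simp: runner_def)

lemma runner_vac: "i < t \<Longrightarrow> runner t i {..<0} = {..<0}"
proof -
  assume "i < t"
  then have "int t * y + int i < 0 \<longleftrightarrow> y < 0" for y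
  proof -
    have "int t * y + int i < 0" if "y < 0"
    proof -
      have "int t * y \<le> int t * (-1)" using that by (intro mult_left_mono) auto
      with \<open>i < t\<close> show ?thesis by simp
    qed
    moreover have "int t * y + int i \<ge> 0" if "\<not> y < 0" using that by simp
    ultimately show ?thesis by fastforce
  qed
  then show ?thesis by (auto simp: runner_def)
qed

lemma maya_runner:
  assumes "maya S" "i < t"
  shows "maya (runner t i S)"
proof -
  have inj: "inj (\<lambda>y. int t * y + int i)" using assms(2) by (auto simp: inj_def)
  have "finite (runner t i X)" if "finite X" for X
    using finite_vimageI[OF that inj] by (simp add: runner_def vimage_def)
  then have "finite (runner t i (S - {..<0}))" "finite (runner t i ({..<0} - S))"
    using assms(1) by (auto simp: maya_def)
  then show ?thesis
    by (simp add: runner_Diff runner_vac[OF assms(2)] maya_def)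
qed

lemma msum_runner:
  assumes "0 < t" "maya S"
  shows "msum g S = (\<Sum>i<t. msum (\<lambda>y. g (int t * y + int i)) (runner t i S))"
  using assms unfolding msum_def maya_def
  by (simp add: sum_runner[OF assms(1)] runner_Diff runner_vac sum_subtractf)

text \<open>Positions \<open>x\<close> and \<open>x - t\<close> lie on the same runner and are
  neighbours there, so a hook of length \<open>t\<close> is a hook of length 1 on exactly one
  runner.\<close>

lemma card_hooks_runner:
  assumes "0 < t" "maya S"
  shows "card (hooks (int t) S) = (\<Sum>i<t. card (hooks 1 (runner t i S)))"
proof -
  have "card (hooks (int t) S) = (\<Sum>i<t. card (runner t i (hooks (int t) S)))"
    using sum_runner[OF assms(1) finite_hooks[OF assms(2), of "int t"], of "\<lambda>_. 1 :: nat"] by simp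
  also have "\<dots> = (\<Sum>i<t. card (hooks 1 (runner t i S)))"
  proof (rule sum.cong)
    fix i
    have "runner t i (hooks (int t) S) = hooks 1 (runner t i S)"
      by (auto simp: runner_def hooks_def algebra_simps)
    then show "card (runner t i (hooks (int t) S)) = card (hooks 1 (runner t i S))" by simp
  qed simp
  finally show ?thesis .
qed

lemma energy_runner:
  assumes "0 < t" "maya S"
  shows "energy S = (\<Sum>i<t. int t * energy (runner t i S) + int i * charge (runner t i S))"
proof -
  have "msum (\<lambda>y. int t * y + int i) R = int t * energy R + int i * charge R" for i R
    using msum_cmult[of "int i" "\<lambda>_. 1" R] msum_cmult[of "int t" "\<lambda>x. x" R]
    by (simp only: msum_add mult_1_right)
  then show ?thesis
    using msum_runner[OF assms, of "\<lambda>x. x"] by presburger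
qed

lemma maya_from_runners:
  assumes "0 < t" "\<And>i. i < t \<Longrightarrow> maya (R i)"
  defines "S \<equiv> \<Union>i<t. (\<lambda>y. int t * y + int i) ` R i"
  shows "maya S" "\<And>i. i < t \<Longrightarrow> runner t i S = R i"
proof -
  have mem_S: "x \<in> S \<longleftrightarrow> x div int t \<in> R (nat (x mod int t))" for x
  proof
    assume "x \<in> S"
    then obtain i y where "i < t" "y \<in> R i" "x = int t * y + int i"
      unfolding S_def by blast
    then show "x div int t \<in> R (nat (x mod int t))" by simp
  next
    assume *: "x div int t \<in> R (nat (x mod int t))"
    have "nat (x mod int t) < t" using assms(1) by (simp add: nat_less_iff)
    moreover have "x = int t * (x div int t) + int (nat (x mod int t))" using assms(1) by simp
    ultimately show "x \<in> S" unfolding S_def using * by blast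
  qed
  show run: "runner t i S = R i" if i: "i < t" for i
    using i unfolding runner_def mem_S by simp
  have cov: "finite X" if "\<And>i. i < t \<Longrightarrow> finite (runner t i X)" for X
  proof (rule finite_subset)
    show "X \<subseteq> (\<Union>i<t. (\<lambda>y. int t * y + int i) ` runner t i X)"
    proof
      fix x assume x: "x \<in> X"
      have "nat (x mod int t) < t" using assms(1) by (simp add: nat_less_iff)
      moreover have "x = int t * (x div int t) + int (nat (x mod int t))" using assms(1) by simp
      moreover from this x have "x div int t \<in> runner t (nat (x mod int t)) X" by (simp add: runner_def)
      ultimately show "x \<in> (\<Union>i<t. (\<lambda>y. int t * y + int i) ` runner t i X)" by blast
    qed
    show "finite (\<Union>i<t. (\<lambda>y. int t * y + int i) ` runner t i X)"
      using that by blast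
  qed
  have "finite (runner t i (S - {..<0}))" "finite (runner t i ({..<0} - S))" if "i < t" for i
    using assms(2)[OF that] by (simp_all add: runner_Diff runner_vac that run maya_def)
  then show "maya S" unfolding maya_def by (blast intro: cov)
qed

lemma eq_from_runners:
  assumes "0 < t" "\<And>i. i < t \<Longrightarrow> runner t i S = runner t i S'"
  shows "S = S'"
proof (rule set_eqI)
  fix x
  have *: "x \<in> X \<longleftrightarrow> x div int t \<in> runner t (nat (x mod int t)) X" for X
    using assms(1) by (simp add: runner_def)
  have "nat (x mod int t) < t" using assms(1) by (simp add: nat_less_iff)
  then show "x \<in> S \<longleftrightarrow> x \<in> S'" unfolding *[of S] *[of S'] by (simp only: assms(2))
qed

section \<open>Partitions as Maya diagrams of charge zero\<close>

text \<open>\<open>maya_of lam\<close> is \<open>{lam\<^sub>i - i | i \<ge> 1}\<close> with \<open>lam\<^sub>i = 0\<close> beyond the length of \<open>lam\<close>.\<close>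

fun maya_of :: "nat list \<Rightarrow> int set" where
  "maya_of [] = {..<0}"
| "maya_of (a # l) = insert (int a - 1) (shift (-1) (maya_of l))"

definition all_partitions :: "nat list set" where
  "all_partitions = {lam. sorted_wrt (\<ge>) lam \<and> (\<forall>p\<in>set lam. 0 < p)}"

lemma partitions_eq: "partitions n = {lam \<in> all_partitions. sum_list lam = n}"
  by (auto simp: partitions_def all_partitions_def)

lemma Nil_all_partitions [simp]: "[] \<in> all_partitions"
  by (simp add: all_partitions_def)

lemma all_partitions_ConsD:
  assumes "a # l \<in> all_partitions"
  shows "l \<in> all_partitions" "0 < a" "\<And>b. b \<in> set l \<Longrightarrow> b \<le> a"
  using assms by (auto simp: all_partitions_def)

text \<open>The beads of \<open>a # l\<close> below the first one are those of \<open>l\<close>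
  moved down by 1, so the bound passes along the list. Its use is that a newly inserted bead is
  always the topmost one.\<close>

lemma maya_of_less:
  assumes "l \<in> all_partitions" "\<And>b. b \<in> set l \<Longrightarrow> b \<le> a" "x \<in> maya_of l"
  shows "x < int a"
proof (cases l)
  case Nil
  with assms show ?thesis by simp
next
  case (Cons b l')
  have "x < int b" using assms(1,3) unfolding Cons
  proof (induction l' arbitrary: x b)
    case Nil
    then show ?case by (auto simp: all_partitions_def mem_shift_iff)
  next
    case (Cons c l')
    have "c \<le> b" "c # l' \<in> all_partitions" using Cons.prems(1) by (auto simp: all_partitions_def)
    then show ?case using Cons.IH[of c "x + 1"] Cons.prems by (auto simp: mem_shift_iff)
  qed
  then show ?thesis using assms(2)[of b] Cons by simp
qed

lemma maya_maya_of: "maya (maya_of l)"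
  by (induction l) (auto intro: maya_insert maya_shift)

lemma maya_of_Cons_notin:
  assumes "a # l \<in> all_partitions"
  shows "int a - 1 \<notin> shift (-1) (maya_of l)"
  using maya_of_less[OF all_partitions_ConsD(1)[OF assms] all_partitions_ConsD(3)[OF assms], of "int a"]
  by (auto simp: mem_shift_iff)

text \<open>Prepending a part \<open>a\<close> moves all beads down by 1, which from charge 0 gives
  charge -1 and one more unit of energy. The bead inserted at \<open>a - 1\<close> restores charge 0
  and adds \<open>a - 1\<close>, so the energy grows by \<open>a\<close> in total.\<close>

lemma charge_energy_maya_of:
  "l \<in> all_partitions \<Longrightarrow> charge (maya_of l) = 0 \<and> energy (maya_of l) = int (sum_list l)"
proof (induction l)
  case (Cons a l)
  note m = maya_maya_of[of l]
  have "charge (maya_of l) = 0" "energy (maya_of l) = int (sum_list l)"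
    using Cons all_partitions_ConsD(1) by blast+
  moreover have "charge (shift (-1) (maya_of l)) = charge (maya_of l) - 1"
    "energy (shift (-1) (maya_of l)) = energy (maya_of l) - charge (maya_of l) + 1"
    using charge_energy_shift[OF m, of "-1"] by auto
  ultimately show ?case
    using maya_of_Cons_notin[OF Cons.prems] m
    by (simp add: msum_insert maya_shift)
qed simp

lemma maya_of_Cons_less:
  assumes "a # l \<in> all_partitions" "x \<in> maya_of (a # l)"
  shows "x < int a"
  by (rule maya_of_less[OF assms(1) _ assms(2)]) (use all_partitions_ConsD(3)[OF assms(1)] in auto)

text \<open>The topmost bead sits at the first part minus 1, so the diagram determines the first
  part. Removing that bead leaves the shifted diagram of the tail.\<close>

lemma maya_of_inj:
  "l \<in> all_partitions \<Longrightarrow> l' \<in> all_partitions \<Longrightarrow> maya_of l = maya_of l' \<Longrightarrow> l = l'"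
proof (induction l arbitrary: l')
  case Nil
  show ?case
  proof (cases l')
    case (Cons a k)
    then have "int a - 1 \<in> maya_of []" using Nil by simp
    then have "int a - 1 < 0" by simp
    moreover have "0 < a" using Nil Cons all_partitions_ConsD(2) by blast
    ultimately show ?thesis by simp
  qed simp
next
  case (Cons a l)
  note l = all_partitions_ConsD[OF Cons.prems(1)]
  show ?case
  proof (cases l')
    case Nil
    have "int a - 1 \<in> maya_of (a # l)" by simp
    then have "int a - 1 \<in> maya_of []" using Cons.prems(3) Nil by (simp only:)
    with l(2) show ?thesis by simp
  next
    case l': (Cons b k)
    note k = all_partitions_ConsD[OF Cons.prems(2)[unfolded l']]
    have "int a - 1 \<in> maya_of (a # l)" "int b - 1 \<in> maya_of (b # k)" by simp_all
    then have "int a - 1 \<in> maya_of (b # k)" "int b - 1 \<in> maya_of (a # l)"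
      using Cons.prems(3) unfolding l' by (simp_all only:)
    then have "int a - 1 < int b" "int b - 1 < int a"
      using maya_of_Cons_less Cons.prems(1,2) unfolding l' by blast+
    then have ab: "a = b" by simp
    have "shift (-1) (maya_of l) = maya_of (a # l) - {int a - 1}"
      using maya_of_Cons_notin[OF Cons.prems(1)] by simp
    also have "\<dots> = shift (-1) (maya_of k)"
      using maya_of_Cons_notin[OF Cons.prems(2)[unfolded l']] Cons.prems(3) l' ab by simp
    finally have "maya_of l = maya_of k" by (simp add: shift_eq_iff)
    then show ?thesis using Cons.IH[OF l(1) k(1)] ab l' by simp
  qed
qed

text \<open>Induction on the energy inverts the recursion of \<open>maya_of\<close>: the topmost
  bead \<open>y\<close> gives the first part \<open>y + 1\<close>, and the remaining beads, moved up
  by 1, have charge 0 again and energy smaller by \<open>y + 1\<close>.\<close>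

lemma maya_of_surj:
  assumes "maya S" "charge S = 0"
  shows "\<exists>l\<in>all_partitions. maya_of l = S"
  using assms
proof (induction "nat (energy S)" arbitrary: S rule: less_induct)
  case less
  show ?case
  proof (cases "S - {..<0} = {}")
    case True
    \<comment> \<open>At charge 0, having no bead at or above 0 forces having no gap below 0, so
      only the vacuum remains.\<close>
    have "card ({..<0} - S) = card (S - {..<0})" using less.prems by (simp add: msum_def)
    then have "card ({..<0} - S) = 0" unfolding True by simp
    then have "{..<0} - S = {}" using less.prems by (simp add: maya_def)
    with True have "S = {..<0}" by blast
    then show ?thesis by (intro bexI[of _ "[]"]) auto
  next
    case False
    define y where "y = Max (S - {..<0})"
    have fin: "finite (S - {..<0})" using less.prems by (simp add: maya_def)
    have y: "y \<in> S" "0 \<le> y" using Max_in[OF fin False] by (auto simp: y_def)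
    have ymax: "x \<le> y" if "x \<in> S" for x
    proof (cases "x < 0")
      case False
      then show ?thesis using Max_ge[OF fin, of x] that by (simp add: y_def)
    qed (use y in simp)
    define R where "R = S - {y}"
    have R: "maya R"
      using less.prems(1) finite_subset[of "{..<0} - R" "insert y ({..<0} - S)"]
        finite_subset[of "R - {..<0}" "S - {..<0}"] by (auto simp: maya_def R_def)
    have S: "S = insert y R" "y \<notin> R" using y by (auto simp: R_def)
    have cR: "charge R = -1" "energy R = energy S - y"
      using less.prems msum_insert[OF R S(2)] S(1) by auto
    define Q where "Q = shift 1 R"
    have Q: "maya Q" "charge Q = 0" "energy Q = energy S - y - 1"
      using R cR by (simp_all add: Q_def maya_shift charge_shift_1 energy_shift_1)
    have "nat (energy Q) < nat (energy S)"
      using Q y energy_nonneg[of Q] by simp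
    from less.hyps[OF this Q(1,2)] obtain l where l: "l \<in> all_partitions" "maya_of l = Q" by blast
    have R_eq: "shift (-1) Q = R" by (simp add: Q_def shift_shift)
    have "b \<le> nat (y + 1)" if "b \<in> set l" for b
    proof -
      from that obtain c k where ck: "l = c # k" by (cases l) auto
      then have "b \<le> c" using that l(1) by (auto simp: all_partitions_def)
      moreover have "int c - 2 \<in> R" using l(2) ck R_eq by (auto simp: mem_shift_iff)
      then have "int c - 2 \<le> y - 1" using ymax[of "int c - 2"] by (cases "int c - 2 = y") (auto simp: R_def)
      ultimately show ?thesis using y by simp
    qed
    then have "nat (y + 1) # l \<in> all_partitions" using l(1) y by (auto simp: all_partitions_def)
    moreover have "maya_of (nat (y + 1) # l) = S" using y S l R_eq by simp
    ultimately show ?thesis by blast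
  qed
qed

lemma bij_betw_maya_of: "bij_betw maya_of all_partitions {S. maya S \<and> charge S = 0}"
  unfolding bij_betw_def inj_on_def
  using maya_of_inj maya_of_surj maya_maya_of charge_energy_maya_of by (auto simp: image_iff) metis

section \<open>Hook lengths of a partition read off from its Maya diagram\<close>

lemma conjugate_part_Cons: "conjugate_part (a # l) j = conjugate_part l j + (if j \<le> a then 1 else 0)"
  by (simp add: conjugate_part_def)

text \<open>Beads encode the rows and gaps the columns: classically, the numbers
  \<open>lam_i - i\<close> and \<open>j - 1 - lam'_j\<close> together exhaust the integers without
  overlap.\<close>

lemma notin_maya_of_iff:
  "l \<in> all_partitions \<Longrightarrow> x \<notin> maya_of l \<longleftrightarrow> (\<exists>j\<ge>1. x = int j - 1 - int (conjugate_part l j))"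
proof (induction l arbitrary: x)
  case Nil
  show ?case
  proof
    assume "x \<notin> maya_of []"
    then have "nat (x + 1) \<ge> 1 \<and> x = int (nat (x + 1)) - 1 - int (conjugate_part [] (nat (x + 1)))"
      by (auto simp: conjugate_part_def)
    then show "\<exists>j\<ge>1. x = int j - 1 - int (conjugate_part [] j)" by blast
  qed (auto simp: conjugate_part_def)
next
  case (Cons a l)
  note l = all_partitions_ConsD[OF Cons.prems]
  have zero: "conjugate_part l j = 0" if "a < j" for j
    using l(3) that by (fastforce simp: conjugate_part_def filter_empty_conv)
  have "x \<notin> maya_of (a # l) \<longleftrightarrow> x \<noteq> int a - 1 \<and> (\<exists>j\<ge>1. x + 1 = int j - 1 - int (conjugate_part l j))"
    using Cons.IH[OF l(1), of "x + 1"] by (simp add: mem_shift_iff)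
  also have "\<dots> \<longleftrightarrow> (\<exists>j\<ge>1. x = int j - 1 - int (conjugate_part (a # l) j))"
  proof (intro iffI; (elim conjE exE)?)
    fix j assume *: "x \<noteq> int a - 1" "1 \<le> j" "x + 1 = int j - 1 - int (conjugate_part l j)"
    show "\<exists>j\<ge>1. x = int j - 1 - int (conjugate_part (a # l) j)"
    proof (cases "j \<le> a")
      case True
      with * show ?thesis by (intro exI[of _ j]) (simp add: conjugate_part_Cons)
    next
      case False
      \<comment> \<open>Columns beyond \<open>a\<close> are empty, so lowering \<open>x\<close> by 1
        lowers the column index instead of raising the height. Column \<open>a + 1\<close> is
        excluded because it would give \<open>x = a - 1\<close>, the place of the new bead.\<close>
      with * zero[of j] have "a < j - 1" by simp
      with * zero[of j] zero[of "j - 1"] False show ?thesis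
        by (intro exI[of _ "j - 1"]) (simp add: conjugate_part_Cons)
    qed
  next
    fix j assume *: "1 \<le> j" "x = int j - 1 - int (conjugate_part (a # l) j)"
    show "x \<noteq> int a - 1 \<and> (\<exists>j\<ge>1. x + 1 = int j - 1 - int (conjugate_part l j))"
    proof (cases "j \<le> a")
      case True
      with * have "x \<noteq> int a - 1" by (simp add: conjugate_part_Cons)
      with * True show ?thesis by (auto intro!: exI[of _ j] simp: conjugate_part_Cons)
    next
      case False
      with * zero[of j] zero[of "j + 1"] show ?thesis
        by (auto intro!: exI[of _ "j + 1"] simp: conjugate_part_Cons)
    qed
  qed
  finally show ?case .
qed

lemma num_hooks_eq_card:
  "num_hooks t lam = card {(k, j) \<in> young_diagram lam. hook_length lam k j = int t}"
proof -
  have "num_hooks t lam = card {p \<in> young_diagram lam. (case p of (k, j) \<Rightarrow> hook_length lam k j) = int t}"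
    unfolding num_hooks_def hook_lengths_def
    using finite_young_diagram[of lam]
    by (simp add: count_image_mset vimage_def Int_def conj_commute)
  also have "{p \<in> young_diagram lam. (case p of (k, j) \<Rightarrow> hook_length lam k j) = int t}
     = {(k, j) \<in> young_diagram lam. hook_length lam k j = int t}" by auto
  finally show ?thesis .
qed

lemma conjugate_part_antimono: "i \<le> j \<Longrightarrow> conjugate_part l j \<le> conjugate_part l i"
  by (induction l) (auto simp: conjugate_part_def)

lemma young_diagram_Cons:
  "young_diagram (a # l) = (\<lambda>j. (1, j)) ` {1..a} \<union> (\<lambda>(k, j). (k + 1, j)) ` young_diagram l"
proof (intro set_eqI iffI)
  fix p assume "p \<in> young_diagram (a # l)"
  then obtain k j where p: "p = (k, j)" "1 \<le> k" "k \<le> Suc (length l)" "1 \<le> j" "j \<le> (a # l) ! (k - 1)"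
    by (auto simp: young_diagram_def)
  show "p \<in> (\<lambda>j. (1, j)) ` {1..a} \<union> (\<lambda>(k, j). (k + 1, j)) ` young_diagram l"
  proof (cases "k = 1")
    case False
    then have "(k - 1, j) \<in> young_diagram l" using p by (auto simp: young_diagram_def nth_Cons')
    then show ?thesis using p by (intro UnI2 image_eqI[of _ _ "(k - 1, j)"]) auto
  qed (use p in auto)
qed (auto simp: young_diagram_def nth_Cons')

text \<open>A new first row leaves the hook lengths of the lower rows unchanged. Along the new row
  they strictly decrease, so \<open>t\<close> occurs at most once, and it occurs exactly when
  \<open>a - t\<close> is a gap by \<open>notin_maya_of_iff\<close>.\<close>

lemma num_hooks_Cons:
  assumes "a # l \<in> all_partitions" "0 < t"
  shows "num_hooks t (a # l) = num_hooks t l + (if int a - int t \<notin> maya_of l then 1 else 0)"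
proof -
  note l = all_partitions_ConsD[OF assms(1)]
  have low: "hook_length (a # l) (Suc k) j = hook_length l k j" if "(k, j) \<in> young_diagram l" for k j
  proof -
    have k: "1 \<le> k" "k \<le> length l" "1 \<le> j" "j \<le> l ! (k - 1)" using that by (auto simp: young_diagram_def)
    then have "l ! (k - 1) \<in> set l" by (intro nth_mem) auto
    then have "j \<le> a" using l(3) k by (meson le_trans)
    then show ?thesis using k by (simp add: hook_length_def conjugate_part_Cons nth_Cons')
  qed
  have top: "hook_length (a # l) 1 j = int a - int j + 1 + int (conjugate_part l j)" if "1 \<le> j" "j \<le> a" for j
    using that by (simp add: hook_length_def conjugate_part_Cons)
  define J where "J = {j\<in>{1..a}. hook_length (a # l) 1 j = int t}"
  have J_eq: "J = {j\<in>{1..a}. int a - int t = int j - 1 - int (conjugate_part l j)}"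
    using top by (auto simp: J_def)
  have J_sub: "j = j'" if "j \<in> J" "j' \<in> J" for j j'
    using that conjugate_part_antimono[of j j' l] conjugate_part_antimono[of j' j l]
    by (cases j j' rule: linorder_cases) (auto simp: J_eq)
  have J_ne: "J \<noteq> {} \<longleftrightarrow> int a - int t \<notin> maya_of l"
  proof -
    \<comment> \<open>A column beyond \<open>a\<close> is empty and would give
      \<open>a - t = j - 1 >= a\<close>, against \<open>0 < t\<close>. So every such gap comes from
      a cell of the new row.\<close>
    have "j \<le> a" if "int a - int t = int j - 1 - int (conjugate_part l j)" for j
    proof (rule ccontr)
      assume "\<not> j \<le> a"
      then have "conjugate_part l j = 0"
        using l(3) by (fastforce simp: conjugate_part_def filter_empty_conv)
      with that \<open>\<not> j \<le> a\<close> assms(2) show False by simp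
    qed
    then show ?thesis unfolding notin_maya_of_iff[OF l(1)] J_eq by auto
  qed
  have card_J: "card J = (if int a - int t \<notin> maya_of l then 1 else 0)"
  proof (cases "J = {}")
    case False
    then obtain j where "j \<in> J" by blast
    then have "J = {j}" using J_sub by blast
    then show ?thesis using J_ne by simp
  qed (use J_ne in auto)
  have "{(k, j) \<in> young_diagram (a # l). hook_length (a # l) k j = int t} =
     (\<lambda>j. (1, j)) ` J \<union> (\<lambda>(k, j). (k + 1, j)) ` {(k, j) \<in> young_diagram l. hook_length l k j = int t}"
    using low by (auto simp: young_diagram_Cons J_def image_iff)
  also have "card \<dots> = card J + card {(k, j) \<in> young_diagram l. hook_length l k j = int t}"
  proof (subst card_Un_disjoint)
    show "finite ((\<lambda>j. (1::nat, j)) ` J)" by (simp add: J_def)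
    show "finite ((\<lambda>(k, j). (k + 1, j)) ` {(k, j) \<in> young_diagram l. hook_length l k j = int t})"
      by (intro finite_imageI finite_subset[OF _ finite_young_diagram[of l]]) auto
    show "(\<lambda>j. (1, j)) ` J \<inter> (\<lambda>(k, j). (k + 1, j)) ` {(k, j) \<in> young_diagram l. hook_length l k j = int t} = {}"
      by (auto simp: young_diagram_def)
    show "card ((\<lambda>j. (1::nat, j)) ` J) + card ((\<lambda>(k, j). (k + 1, j)) ` {(k, j) \<in> young_diagram l. hook_length l k j = int t})
      = card J + card {(k, j) \<in> young_diagram l. hook_length l k j = int t}"
      by (intro arg_cong2[of _ _ _ _ "(+)"] card_image) (auto simp: inj_on_def)
  qed
  finally show ?thesis by (simp add: num_hooks_eq_card card_J)
qed

text \<open>Both sides obey the same recursion. The new bead lies above all others, so it fills no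
  gap used by an old hook, and it adds one hook exactly when the position \<open>t\<close> below it
  is empty.\<close>

lemma num_hooks_eq_hooks:
  assumes "0 < t"
  shows "l \<in> all_partitions \<Longrightarrow> num_hooks t l = card (hooks (int t) (maya_of l))"
proof (induction l)
  case Nil
  have "{(k, j) \<in> young_diagram []. hook_length [] k j = int t} = {}"
    by (auto simp: young_diagram_def)
  moreover have "hooks (int t) (maya_of []) = {}" using assms by (auto simp: hooks_def)
  ultimately show ?case by (simp only: num_hooks_eq_card card.empty)
next
  case (Cons a l)
  note l = all_partitions_ConsD[OF Cons.prems]
  define R where "R = shift (-1) (maya_of l)"
  have less: "x < int a - 1" if "x \<in> R" for x
    using maya_of_less[OF l(1,3), of "x + 1"] that by (simp add: R_def mem_shift_iff)
  have neq: "x - int t \<noteq> int a - 1" if "x \<in> R" for x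
    using less[OF that] by simp
  have "hooks (int t) (maya_of (a # l)) = hooks (int t) R \<union> (if int a - 1 - int t \<notin> R then {int a - 1} else {})"
    using assms by (auto simp: hooks_def R_def[symmetric] neq)
  moreover have "int a - 1 \<notin> hooks (int t) R" using less by (force simp: hooks_def)
  moreover have "finite (hooks (int t) R)" unfolding R_def by (intro finite_hooks maya_shift maya_maya_of)
  moreover have "card (hooks (int t) R) = num_hooks t l"
    using Cons.IH[OF l(1)] by (simp add: R_def card_hooks_shift)
  moreover have "int a - 1 - int t \<notin> R \<longleftrightarrow> int a - int t \<notin> maya_of l" by (simp add: R_def mem_shift_iff)
  ultimately show ?case using num_hooks_Cons[OF Cons.prems assms] by simp
qed

text \<open>Hooks of length 1 are the corners of the diagram, one for each distinct part. In the
  recursion, a prepended part \<open>a\<close> is a repetition exactly when \<open>l\<close> already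
  has a bead at \<open>a - 1\<close>.\<close>

lemma card_hooks_1_maya_of:
  "l \<in> all_partitions \<Longrightarrow> card (hooks 1 (maya_of l)) = card (set l)"
proof (induction l)
  case Nil
  have "hooks 1 {..<0} = {}" by (auto simp: hooks_def)
  then show ?case by simp
next
  case (Cons a l)
  note l = all_partitions_ConsD[OF Cons.prems]
  have "int a - 1 \<in> maya_of l \<longleftrightarrow> a \<in> set l"
  proof (cases l)
    case Nil
    with l show ?thesis by simp
  next
    case l': (Cons b k)
    have b: "b \<le> a" using l l' by auto
    have kb: "c \<le> b" if "c \<in> set k" for c using l(1) l' that by (auto simp: all_partitions_def)
    show ?thesis
    proof (cases "a = b")
      case False
      then have "a \<notin> set l" "b < a" using b kb l' by force+
      moreover have "int a - 1 \<notin> maya_of l"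
        using maya_of_less[OF l(1), of b "int a - 1"] kb l' \<open>b < a\<close> by auto
      ultimately show ?thesis by simp
    qed (use l' in simp)
  qed
  then show ?case
    using num_hooks_Cons[OF Cons.prems, of 1] num_hooks_eq_hooks[of 1 "a # l"] num_hooks_eq_hooks[of 1 l] Cons l(1)
    by (auto simp: insert_absorb)
qed

section \<open>Infinite sums over partitions\<close>

abbreviation norm_summable_on :: "('a \<Rightarrow> 'b :: real_normed_vector) \<Rightarrow> 'a set \<Rightarrow> bool" (infixr "norm'_summable'_on" 46) where
  "f norm_summable_on A \<equiv> (\<lambda>x. norm (f x)) summable_on A"

lemma abs_summable_on_Times:
  fixes f :: "'a \<Rightarrow> 'c :: {banach, real_normed_div_algebra}"
  assumes "f norm_summable_on A" "g norm_summable_on B"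
  shows "(\<lambda>(x, y). f x * g y) norm_summable_on A \<times> B"
  unfolding Infinite_Sum.abs_summable_on_Sigma_iff
  using assms by (auto simp: norm_mult infsum_cmult_right' abs_mult intro!: summable_on_cmult_right summable_on_cmult_left)

lemma infsum_Times:
  fixes f :: "'a \<Rightarrow> 'c :: {banach, real_normed_div_algebra}"
  assumes "f norm_summable_on A" "g norm_summable_on B"
  shows "infsum (\<lambda>(x, y). f x * g y) (A \<times> B) = infsum f A * infsum g B"
proof -
  have "infsum (\<lambda>(x, y). f x * g y) (A \<times> B) = infsum (\<lambda>x. infsum (\<lambda>y. f x * g y) B) A"
    using infsum_Sigma_banach[OF Infinite_Sum.abs_summable_summable[OF abs_summable_on_Times[OF assms]]] by simp
  then show ?thesis by (simp add: infsum_cmult_right' infsum_cmult_left')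
qed

lemma abs_summable_on_prod_PiE:
  fixes f :: "'a \<Rightarrow> 'b \<Rightarrow> 'c :: {banach, real_normed_field}"
  assumes "finite A" "\<And>x. x \<in> A \<Longrightarrow> f x norm_summable_on B x"
  shows "(\<lambda>g. \<Prod>x\<in>A. f x (g x)) norm_summable_on PiE A B"
  using assms
proof (induction rule: finite_induct)
  case empty
  then show ?case by simp
next
  case (insert a A)
  have inj: "inj_on (\<lambda>(y, g). g(a := y)) (B a \<times> PiE A B)"
    by (rule inj_combinator) fact
  have eq: "(\<Prod>x\<in>A. f x ((g(a := y)) x)) = (\<Prod>x\<in>A. f x (g x))" for g y
    using insert.hyps by (intro prod.cong) auto
  have "(\<lambda>(y, g). f a y * (\<Prod>x\<in>A. f x (g x))) norm_summable_on B a \<times> PiE A B"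
    using insert by (intro abs_summable_on_Times) auto
  then show ?case
    unfolding PiE_insert_eq summable_on_reindex[OF inj]
    using insert.hyps by (simp add: o_def case_prod_unfold eq del: fun_upd_apply) simp
qed

lemma has_sum_distE:
  fixes f :: "'a \<Rightarrow> 'b :: {comm_monoid_add, metric_space}"
  assumes "(f has_sum a) A" "e > 0"
  obtains X where "finite X" "X \<subseteq> A" "\<And>Y. finite Y \<Longrightarrow> X \<subseteq> Y \<Longrightarrow> Y \<subseteq> A \<Longrightarrow> dist (sum f Y) a < e"
proof -
  have "eventually (\<lambda>Y. dist (sum f Y) a < e) (finite_subsets_at_top A)"
    using assms by (intro tendstoD) (auto simp: has_sum_def)
  then obtain X where "finite X" "X \<subseteq> A" "\<forall>Y. finite Y \<and> X \<subseteq> Y \<and> Y \<subseteq> A \<longrightarrow> dist (sum f Y) a < e"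
    unfolding eventually_finite_subsets_at_top by auto
  then show thesis using that[of X] by simp
qed

text \<open>Continuity of absolutely convergent sums along an increasing exhaustion. It turns the
  finite products over parts at most \<open>K\<close> into the infinite product.\<close>

lemma infsum_incseq_tendsto:
  fixes f :: "'a \<Rightarrow> 'b :: banach"
  assumes f: "f norm_summable_on A" and A: "A = (\<Union>k::nat. B k)" and mono: "\<And>i j. i \<le> j \<Longrightarrow> B i \<subseteq> B j"
  shows "(\<lambda>k. infsum f (B k)) \<longlonglongrightarrow> infsum f A"
proof (rule metric_LIMSEQ_I)
  fix e :: real assume "0 < e"
  have e2: "e / 2 > 0" using \<open>0 < e\<close> by simp
  have "(f has_sum infsum f A) A" using has_sum_infsum[OF Infinite_Sum.abs_summable_summable[OF f]] .
  then obtain X where X: "finite X" "X \<subseteq> A" "\<And>Y. finite Y \<Longrightarrow> X \<subseteq> Y \<Longrightarrow> Y \<subseteq> A \<Longrightarrow> dist (sum f Y) (infsum f A) < e / 2"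
    using e2 by (rule has_sum_distE) blast
  have "\<exists>k. X \<subseteq> B k" using X(1,2)
  proof (induction rule: finite_induct)
    case (insert x X)
    obtain k where "X \<subseteq> B k" using insert.IH insert.prems by blast
    moreover obtain j where "x \<in> B j" using insert.prems A by blast
    moreover have "B k \<subseteq> B (max k j)" "B j \<subseteq> B (max k j)" by (rule mono; simp)+
    ultimately have "insert x X \<subseteq> B (max k j)" by blast
    then show ?case by blast
  qed simp
  then obtain N where N: "X \<subseteq> B N" by blast
  have "dist (infsum f (B k)) (infsum f A) < e" if "k \<ge> N" for k
  proof -
    have "f summable_on B k"
      using summable_on_subset_banach[OF Infinite_Sum.abs_summable_summable[OF f]] A by blast
    then have "(f has_sum infsum f (B k)) (B k)" by (rule has_sum_infsum)
    then obtain Y where Y: "finite Y" "Y \<subseteq> B k" "\<And>Z. finite Z \<Longrightarrow> Y \<subseteq> Z \<Longrightarrow> Z \<subseteq> B k \<Longrightarrow> dist (sum f Z) (infsum f (B k)) < e / 2"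
      using e2 by (rule has_sum_distE) blast
    have "X \<union> Y \<subseteq> B k" using N mono[OF that] Y by blast
    moreover have "X \<union> Y \<subseteq> A" using \<open>X \<union> Y \<subseteq> B k\<close> A by blast
    ultimately have "dist (sum f (X \<union> Y)) (infsum f (B k)) < e / 2" "dist (sum f (X \<union> Y)) (infsum f A) < e / 2"
      using X(1,3) Y(1,3) by simp_all
    then show ?thesis by (metis dist_triangle_half_l dist_commute)
  qed
  then show "\<exists>N. \<forall>k\<ge>N. dist (infsum f (B k)) (infsum f A) < e" by blast
qed

section \<open>The generating function by size and number of distinct parts\<close>

definition distinct_weight :: "'a \<Rightarrow> 'a \<Rightarrow> nat list \<Rightarrow> 'a :: {banach, real_normed_field}" where
  "distinct_weight T z l = z ^ sum_list l * T ^ card (set l)"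

definition bounded_partitions :: "nat \<Rightarrow> nat list set" where
  "bounded_partitions K = {l \<in> all_partitions. set l \<subseteq> {..K}}"

lemma bounded_partitions_0: "bounded_partitions 0 = {[]}"
proof (intro equalityI subsetI)
  fix l assume "l \<in> bounded_partitions 0"
  then have "p \<notin> set l" for p
    by (cases "p = 0") (auto simp: bounded_partitions_def all_partitions_def)
  then have "set l = {}" unfolding set_eq_iff by simp
  then show "l \<in> {[]}" by simp
qed (simp add: bounded_partitions_def)

lemma sorted_wrt_ge_replicate_append:
  assumes "sorted_wrt (\<ge>) l" "set l \<subseteq> {..Suc K}"
  shows "\<exists>j k. l = replicate j (Suc K) @ k \<and> set k \<subseteq> {..K} \<and> sorted_wrt (\<ge>) k"
  using assms
proof (induction l)
  case (Cons a l)
  show ?case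
  proof (cases "a = Suc K")
    case True
    have "\<exists>j k. l = replicate j (Suc K) @ k \<and> set k \<subseteq> {..K} \<and> sorted_wrt (\<ge>) k"
      by (rule Cons.IH) (use Cons.prems in auto)
    then obtain j k where "l = replicate j (Suc K) @ k \<and> set k \<subseteq> {..K} \<and> sorted_wrt (\<ge>) k" by blast
    then have "a # l = replicate (Suc j) (Suc K) @ k \<and> set k \<subseteq> {..K} \<and> sorted_wrt (\<ge>) k" using True by simp
    then show ?thesis by blast
  next
    case False
    then have "a \<le> K" using Cons.prems by auto
    then have "a # l = replicate 0 (Suc K) @ (a # l) \<and> set (a # l) \<subseteq> {..K} \<and> sorted_wrt (\<ge>) (a # l)"
      using Cons.prems by auto
    then show ?thesis by blast
  qed
qed simp

lemma bounded_partitions_Suc_subset: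
  assumes "l \<in> bounded_partitions (Suc K)"
  shows "\<exists>j. \<exists>k\<in>bounded_partitions K. l = replicate j (Suc K) @ k"
proof -
  have l: "sorted_wrt (\<ge>) l" "set l \<subseteq> {..Suc K}" "\<forall>p\<in>set l. 0 < p"
    using assms by (simp_all add: bounded_partitions_def all_partitions_def)
  from sorted_wrt_ge_replicate_append[OF l(1,2)]
  obtain j where "\<exists>k. l = replicate j (Suc K) @ k \<and> set k \<subseteq> {..K} \<and> sorted_wrt (\<ge>) k" ..
  then obtain k where k: "l = replicate j (Suc K) @ k \<and> set k \<subseteq> {..K} \<and> sorted_wrt (\<ge>) k" ..
  have "set k \<subseteq> set l" by (subst conjunct1[OF k]) (simp only: set_append Un_upper2)
  with l(3) have "\<forall>p\<in>set k. 0 < p" by blast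
  with k have "k \<in> bounded_partitions K" by (simp add: bounded_partitions_def all_partitions_def)
  then show ?thesis using k by (intro exI[of _ j] bexI[of _ k] conjunct1[OF k])
qed

text \<open>The pair records the multiplicity of the part \<open>K + 1\<close> and the partition
  formed by the smaller parts. This peels off one factor of the product at a time.\<close>

lemma bij_betw_bounded_partitions_Suc:
  "bij_betw (\<lambda>(j, l). replicate j (Suc K) @ l) (UNIV \<times> bounded_partitions K) (bounded_partitions (Suc K))"
  unfolding bij_betw_def
proof
  show "inj_on (\<lambda>(j, l). replicate j (Suc K) @ l) (UNIV \<times> bounded_partitions K)"
  proof (rule inj_onI, clarify)
    fix i j l k assume *: "replicate i (Suc K) @ l = replicate j (Suc K) @ k" "l \<in> bounded_partitions K" "k \<in> bounded_partitions K"
    then have no: "filter (\<lambda>x. x = Suc K) l = []" "filter (\<lambda>x. x = Suc K) k = []"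
      by (auto simp: bounded_partitions_def filter_empty_conv)
    have "length (filter (\<lambda>x. x = Suc K) (replicate i (Suc K) @ l)) = length (filter (\<lambda>x. x = Suc K) (replicate j (Suc K) @ k))"
      by (simp only: *(1))
    then have "i = j" using no by simp
    with * show "i = j \<and> l = k" by simp
  qed
  show "(\<lambda>(j, l). replicate j (Suc K) @ l) ` (UNIV \<times> bounded_partitions K) = bounded_partitions (Suc K)"
  proof (intro equalityI subsetI)
    fix x assume "x \<in> bounded_partitions (Suc K)"
    then obtain j k where "k \<in> bounded_partitions K" "x = replicate j (Suc K) @ k"
      using bounded_partitions_Suc_subset by blast
    then show "x \<in> (\<lambda>(j, l). replicate j (Suc K) @ l) ` (UNIV \<times> bounded_partitions K)"
      by (intro image_eqI[of _ _ "(j, k)"]) simp_all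
  next
    fix x assume "x \<in> (\<lambda>(j, l). replicate j (Suc K) @ l) ` (UNIV \<times> bounded_partitions K)"
    then obtain j k where x: "x = replicate j (Suc K) @ k" and k: "k \<in> bounded_partitions K" by auto
    from k have k: "sorted_wrt (\<ge>) k" "\<forall>p\<in>set k. 0 < p \<and> p \<le> K"
      by (auto simp: bounded_partitions_def all_partitions_def)
    have "sorted_wrt (\<ge>) (replicate j (Suc K))" by (simp add: sorted_wrt_iff_nth_less)
    then have "sorted_wrt (\<ge>) x" using k by (auto simp: x sorted_wrt_append)
    moreover have "\<forall>p\<in>set x. 0 < p \<and> p \<le> Suc K" using k by (auto simp: x)
    ultimately show "x \<in> bounded_partitions (Suc K)"
      by (auto simp: bounded_partitions_def all_partitions_def)
  qed
qed

lemma distinct_weight_replicate_append: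
  assumes "l \<in> bounded_partitions K"
  shows "distinct_weight T z (replicate j (Suc K) @ l) = (if j = 0 then 1 else T * (z ^ Suc K) ^ j) * distinct_weight T z l"
proof -
  have "Suc K \<notin> set l" using assms by (auto simp: bounded_partitions_def)
  then have "card (set (replicate j (Suc K) @ l)) = (if j = 0 then 0 else 1) + card (set l)"
    by (auto simp: set_replicate_conv_if)
  moreover have "z ^ (j * Suc K) = (z ^ Suc K) ^ j" by (metis mult.commute power_mult)
  ultimately show ?thesis
    by (simp add: distinct_weight_def sum_list_replicate power_add del: mult_Suc_right)
qed

text \<open>All positive multiplicities carry the same single factor \<open>T\<close>, since a part
  counts once however often it occurs.\<close>

lemma part_multiplicity_sum:
  fixes x T :: "'a :: {banach, real_normed_field}"
  assumes "norm x < 1"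
  shows "(\<lambda>j::nat. if j = 0 then 1 else T * x ^ j) norm_summable_on UNIV"
    and "infsum (\<lambda>j::nat. if j = 0 then 1 else T * x ^ j) UNIV = 1 + T * x / (1 - x)"
proof -
  define a where "a = (\<lambda>j::nat. if j = 0 then 1 else T * x ^ j)"
  have "(\<lambda>j. norm T * norm x ^ j) sums (norm T * (1 / (1 - norm x)))"
    using assms by (intro sums_mult geometric_sums) auto
  then have 1: "summable (\<lambda>j. norm (a j))"
    by (rule summable_comparison_test_ev[OF _ sums_summable, rotated])
       (auto simp: a_def norm_mult norm_power eventually_sequentially intro!: exI[of _ 1])
  then show "a norm_summable_on UNIV"
    by (rule norm_summable_imp_summable_on[of "\<lambda>j. norm (a j)", simplified])
  have "(\<lambda>j. T * x * x ^ j) sums (T * x * (1 / (1 - x)))"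
    using assms by (intro sums_mult geometric_sums) auto
  then have "(\<lambda>j. a (Suc j)) sums (T * x / (1 - x))"
    by (simp add: a_def mult.assoc)
  then have "a sums (T * x / (1 - x) + a 0)" by (rule sums_Suc)
  then have "(a has_sum (T * x / (1 - x) + a 0)) UNIV"
    using 1 by (simp add: norm_summable_imp_has_sum)
  then show "infsum a UNIV = 1 + T * x / (1 - x)"
    by (simp add: infsumI a_def)
qed

lemma norm_power_Suc_less_1: "norm (z :: 'a :: real_normed_field) < 1 \<Longrightarrow> norm (z ^ Suc K) < 1"
  using power_Suc_less_one[of "norm z" K] by (cases "z = 0") (auto simp: norm_power norm_mult)

lemma bounded_partitions_sum:
  fixes z T :: "'a :: {banach, real_normed_field}"
  assumes "norm z < 1"
  shows "distinct_weight T z norm_summable_on bounded_partitions K \<and>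
    infsum (distinct_weight T z) (bounded_partitions K) = (\<Prod>m=1..K. 1 + T * z ^ m / (1 - z ^ m))"
proof (induction K)
  case 0
  then show ?case by (simp add: bounded_partitions_0 distinct_weight_def)
next
  case (Suc K)
  note bij = bij_betw_bounded_partitions_Suc[of K]
  define a where "a = (\<lambda>j::nat. if j = 0 then 1 else T * (z ^ Suc K) ^ j)"
  have a: "a norm_summable_on UNIV" "infsum a UNIV = 1 + T * z ^ Suc K / (1 - z ^ Suc K)"
    unfolding a_def by (rule part_multiplicity_sum norm_power_Suc_less_1 assms)+
  have eq: "distinct_weight T z (case p of (j, l) \<Rightarrow> replicate j (Suc K) @ l) = (case p of (j, l) \<Rightarrow> a j * distinct_weight T z l)"
    if "p \<in> UNIV \<times> bounded_partitions K" for p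
    using that distinct_weight_replicate_append[of "snd p" K T z "fst p"] unfolding a_def by (auto simp: case_prod_unfold)
  have "(\<lambda>(j, l). a j * distinct_weight T z l) norm_summable_on UNIV \<times> bounded_partitions K"
    using Suc a by (intro abs_summable_on_Times) auto
  then have "(\<lambda>p. norm (distinct_weight T z (case p of (j, l) \<Rightarrow> replicate j (Suc K) @ l))) summable_on (UNIV \<times> bounded_partitions K)"
    by (rule summable_on_cong[THEN iffD1, rotated]) (simp add: eq)
  then have 1: "distinct_weight T z norm_summable_on bounded_partitions (Suc K)"
    by (subst (asm) summable_on_reindex_bij_betw[OF bij])
  have "infsum (distinct_weight T z) (bounded_partitions (Suc K)) =
    infsum (\<lambda>p. distinct_weight T z (case p of (j, l) \<Rightarrow> replicate j (Suc K) @ l)) (UNIV \<times> bounded_partitions K)"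
    by (subst infsum_reindex_bij_betw[OF bij]) simp
  also have "\<dots> = infsum (\<lambda>(j, l). a j * distinct_weight T z l) (UNIV \<times> bounded_partitions K)"
    by (rule infsum_cong) (simp add: eq)
  also have "\<dots> = infsum a UNIV * infsum (distinct_weight T z) (bounded_partitions K)"
    using Suc a by (intro infsum_Times) auto
  also have "\<dots> = (1 + T * z ^ Suc K / (1 - z ^ Suc K)) * (\<Prod>m=1..K. 1 + T * z ^ m / (1 - z ^ m))"
    by (simp only: a(2) conjunct2[OF Suc])
  also have "\<dots> = (\<Prod>m=1..Suc K. 1 + T * z ^ m / (1 - z ^ m))"
    by (subst prod.nat_ivl_Suc') (simp_all add: mult.commute)
  finally show ?case by (rule conjI[OF 1])
qed

lemma all_partitions_eq_Union: "all_partitions = (\<Union>K. bounded_partitions K)"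
proof (intro equalityI subsetI)
  fix l assume "l \<in> all_partitions"
  then have "l \<in> bounded_partitions (sum_list l)"
    by (auto simp: bounded_partitions_def member_le_sum_list)
  then show "l \<in> (\<Union>K. bounded_partitions K)" by blast
qed (auto simp: bounded_partitions_def)

lemma bounded_partitions_mono: "i \<le> j \<Longrightarrow> bounded_partitions i \<subseteq> bounded_partitions j"
  by (auto simp: bounded_partitions_def)

lemma norm_distinct_weight: "norm (distinct_weight T z l) = distinct_weight (norm T) (norm z) l"
  by (simp add: distinct_weight_def norm_mult norm_power)

text \<open>Every finite partial sum is bounded by one of the finite products, and these are bounded
  uniformly in \<open>K\<close> by \<open>1 + y <= exp y\<close> and the geometric series.\<close>

lemma abs_summable_distinct_weight:
  fixes z T :: "'a :: {banach, real_normed_field}"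
  assumes "norm z < 1"
  shows "distinct_weight T z norm_summable_on all_partitions"
proof (rule nonneg_bdd_above_summable_on)
  define r where "r = norm z"
  have r: "0 \<le> r" "r < 1" using assms by (auto simp: r_def)
  have bound: "(\<Prod>m=1..K. 1 + norm T * r ^ m / (1 - r ^ m)) \<le> exp (norm T / (1 - r) / (1 - r))" for K
  proof -
    have "(\<Prod>m=1..K. 1 + norm T * r ^ m / (1 - r ^ m)) \<le> (\<Prod>m=1..K. exp (norm T / (1 - r) * r ^ m))"
    proof (rule prod_mono, safe)
      fix m :: nat assume m: "m \<in> {1..K}"
      have rm: "r ^ m \<le> r" "r ^ m \<ge> 0" using power_decreasing[of 1 m r] m r by auto
      then show "0 \<le> 1 + norm T * r ^ m / (1 - r ^ m)" using r by (auto intro!: add_nonneg_nonneg divide_nonneg_nonneg)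
      have "norm T * r ^ m / (1 - r ^ m) \<le> norm T * r ^ m / (1 - r)"
        using r rm by (intro divide_left_mono) (auto intro!: mult_pos_pos)
      also have "1 + \<dots> \<le> exp (norm T * r ^ m / (1 - r))" by (rule exp_ge_add_one_self)
      finally show "1 + norm T * r ^ m / (1 - r ^ m) \<le> exp (norm T / (1 - r) * r ^ m)" by simp
    qed
    also have "\<dots> = exp (norm T / (1 - r) * (\<Sum>m=1..K. r ^ m))"
      by (simp add: exp_sum sum_distrib_left)
    also have "\<dots> \<le> exp (norm T / (1 - r) * (1 / (1 - r)))"
    proof -
      have "(\<Sum>m=1..K. r ^ m) \<le> (\<Sum>m. r ^ m)"
        using r by (intro sum_le_suminf summable_geometric) auto
      also have "\<dots> = 1 / (1 - r)" using r by (simp add: suminf_geometric)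
      finally show ?thesis using r by (intro iffD2[OF exp_le_cancel_iff] mult_left_mono) auto
    qed
    finally show ?thesis by simp
  qed
  show "bdd_above (sum (\<lambda>l. norm (distinct_weight T z l)) ` {F. F \<subseteq> all_partitions \<and> finite F})"
  proof (rule bdd_aboveI2)
    fix F assume "F \<in> {F. F \<subseteq> all_partitions \<and> finite F}"
    then have F: "F \<subseteq> all_partitions" "finite F" by auto
    have "\<exists>K. F \<subseteq> bounded_partitions K"
      using F(2,1)
    proof (induction rule: finite_induct)
      case (insert x X)
      obtain k where "X \<subseteq> bounded_partitions k" using insert.IH insert.prems by blast
      moreover obtain j where "x \<in> bounded_partitions j" using insert.prems all_partitions_eq_Union by blast
      moreover have "bounded_partitions k \<subseteq> bounded_partitions (max k j)" "bounded_partitions j \<subseteq> bounded_partitions (max k j)"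
        by (rule bounded_partitions_mono; simp)+
      ultimately have "insert x X \<subseteq> bounded_partitions (max k j)" by blast
      then show ?case by blast
    qed simp
    then obtain K where K: "F \<subseteq> bounded_partitions K" by blast
    have s: "distinct_weight (norm T) (norm z) norm_summable_on bounded_partitions K \<and>
      infsum (distinct_weight (norm T) (norm z)) (bounded_partitions K) = (\<Prod>m=1..K. 1 + norm T * norm z ^ m / (1 - norm z ^ m))"
      by (rule bounded_partitions_sum) (use assms in simp)
    have "(\<Sum>l\<in>F. norm (distinct_weight T z l)) \<le> infsum (distinct_weight (norm T) (norm z)) (bounded_partitions K)"
      unfolding norm_distinct_weight
      by (rule finite_sum_le_infsum[OF Infinite_Sum.abs_summable_summable[OF conjunct1[OF s]] F(2) K])
         (simp add: distinct_weight_def)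
    also have "\<dots> \<le> exp (norm T / (1 - r) / (1 - r))" using s bound[of K] by (simp add: r_def)
    finally show "(\<Sum>l\<in>F. norm (distinct_weight T z l)) \<le> exp (norm T / (1 - r) / (1 - r))" .
  qed
qed auto

definition distinct_gf :: "complex \<Rightarrow> complex \<Rightarrow> complex" where
  "distinct_gf T z = infsum (distinct_weight T z) all_partitions"

lemma distinct_gf_tendsto:
  assumes "norm z < 1"
  shows "(\<lambda>K. \<Prod>m=1..K. 1 + T * z ^ m / (1 - z ^ m)) \<longlonglongrightarrow> distinct_gf T z"
  using infsum_incseq_tendsto[OF abs_summable_distinct_weight[OF assms, of T] all_partitions_eq_Union bounded_partitions_mono]
    bounded_partitions_sum[OF assms, of T]
  by (simp add: distinct_gf_def)

section \<open>The Littlewood decomposition\<close>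

text \<open>Possible charges of the runners of a diagram of total charge 0; these vectors index the
  \<open>t\<close>-cores. Extensionality makes a vector determined by its \<open>t\<close>
  entries.\<close>

definition charge_vectors :: "nat \<Rightarrow> (nat \<Rightarrow> int) set" where
  "charge_vectors t = {c \<in> {..<t} \<rightarrow>\<^sub>E UNIV. (\<Sum>i<t. c i) = 0}"

text \<open>The size of the \<open>t\<close>-core with runner charges \<open>c\<close>, that is, the
  energy of the diagram whose runners are shifted vacua.\<close>

definition charge_weight :: "nat \<Rightarrow> (nat \<Rightarrow> int) \<Rightarrow> int" where
  "charge_weight t c = (\<Sum>i<t. int t * energy (shift (c i) {..<0}) + int i * c i)"

definition glue :: "nat \<Rightarrow> (nat \<Rightarrow> int) \<Rightarrow> (nat \<Rightarrow> nat list) \<Rightarrow> int set" where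
  "glue t c L = (\<Union>i<t. (\<lambda>y. int t * y + int i) ` shift (c i) (maya_of (L i)))"

text \<open>The inverse of the Littlewood decomposition: the partition with core given by
  \<open>c\<close> and quotient \<open>L\<close>.\<close>

definition assemble :: "nat \<Rightarrow> (nat \<Rightarrow> int) \<Rightarrow> (nat \<Rightarrow> nat list) \<Rightarrow> nat list" where
  "assemble t c L = inv_into all_partitions maya_of (glue t c L)"

context
  fixes t :: nat
  assumes t: "0 < t"
begin

lemma maya_glue: "maya (glue t c L)"
  and runner_glue: "i < t \<Longrightarrow> runner t i (glue t c L) = shift (c i) (maya_of (L i))"
  using maya_from_runners[OF t, of "\<lambda>i. shift (c i) (maya_of (L i))"]
  by (simp_all add: glue_def maya_shift maya_maya_of)

lemma charge_glue:
  assumes "\<And>i. i < t \<Longrightarrow> L i \<in> all_partitions"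
  shows "charge (glue t c L) = (\<Sum>i<t. c i)"
proof -
  have "charge (glue t c L) = (\<Sum>i<t. charge (runner t i (glue t c L)))"
    by (rule msum_runner[OF t maya_glue])
  also have "\<dots> = (\<Sum>i<t. c i)"
    by (rule sum.cong) (use assms in \<open>simp_all add: runner_glue charge_shift maya_maya_of charge_energy_maya_of\<close>)
  finally show ?thesis .
qed

lemma energy_glue:
  assumes "\<And>i. i < t \<Longrightarrow> L i \<in> all_partitions"
  shows "energy (glue t c L) = charge_weight t c + int t * (\<Sum>i<t. int (sum_list (L i)))"
proof -
  have "energy (glue t c L) = (\<Sum>i<t. int t * energy (runner t i (glue t c L)) + int i * charge (runner t i (glue t c L)))"
    by (rule energy_runner[OF t maya_glue])
  also have "\<dots> = (\<Sum>i<t. int t * energy (shift (c i) {..<0}) + int i * c i + int t * int (sum_list (L i)))"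
  proof (rule sum.cong)
    fix i assume "i \<in> {..<t}"
    then have i: "i < t" by simp
    note m = maya_maya_of[of "L i"] and ce = charge_energy_maya_of[OF assms[OF i]]
    have "charge (runner t i (glue t c L)) = c i"
      using ce by (simp add: runner_glue[OF i] charge_shift[OF m])
    moreover have "energy (runner t i (glue t c L)) = int (sum_list (L i)) + energy (shift (c i) {..<0})"
      using ce by (simp add: runner_glue[OF i] energy_shift[OF m])
    ultimately show "int t * energy (runner t i (glue t c L)) + int i * charge (runner t i (glue t c L))
      = int t * energy (shift (c i) {..<0}) + int i * c i + int t * int (sum_list (L i))"
      by (simp add: algebra_simps)
  qed simp
  also have "\<dots> = charge_weight t c + int t * (\<Sum>i<t. int (sum_list (L i)))"
    unfolding charge_weight_def by (subst sum.distrib) (simp add: sum_distrib_left)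
  finally show ?thesis .
qed

lemma hooks_glue:
  assumes "\<And>i. i < t \<Longrightarrow> L i \<in> all_partitions"
  shows "card (hooks (int t) (glue t c L)) = (\<Sum>i<t. card (set (L i)))"
proof -
  have "card (hooks (int t) (glue t c L)) = (\<Sum>i<t. card (hooks 1 (runner t i (glue t c L))))"
    by (rule card_hooks_runner[OF t maya_glue])
  also have "\<dots> = (\<Sum>i<t. card (set (L i)))"
    by (rule sum.cong) (use assms in \<open>simp_all add: runner_glue card_hooks_shift card_hooks_1_maya_of\<close>)
  finally show ?thesis .
qed

lemma assemble:
  assumes c: "c \<in> charge_vectors t" and L: "L \<in> {..<t} \<rightarrow>\<^sub>E all_partitions"
  shows "assemble t c L \<in> all_partitions" "maya_of (assemble t c L) = glue t c L"
    and "int (sum_list (assemble t c L)) = charge_weight t c + int t * (\<Sum>i<t. int (sum_list (L i)))"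
    and "num_hooks t (assemble t c L) = (\<Sum>i<t. card (set (L i)))"
proof -
  have L': "L i \<in> all_partitions" if "i < t" for i using L that by auto
  have "charge (glue t c L) = 0" using charge_glue[OF L'] c by (simp add: charge_vectors_def)
  then have im: "glue t c L \<in> maya_of ` all_partitions"
    using bij_betw_imp_surj_on[OF bij_betw_maya_of] maya_glue by blast
  show 1: "assemble t c L \<in> all_partitions" unfolding assemble_def by (rule inv_into_into[OF im])
  show 2: "maya_of (assemble t c L) = glue t c L" unfolding assemble_def by (rule f_inv_into_f[OF im])
  show "int (sum_list (assemble t c L)) = charge_weight t c + int t * (\<Sum>i<t. int (sum_list (L i)))"
    using energy_glue[OF L'] charge_energy_maya_of[OF 1] 2 by simp
  show "num_hooks t (assemble t c L) = (\<Sum>i<t. card (set (L i)))"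
    using hooks_glue[OF L'] num_hooks_eq_hooks[OF t 1] 2 by simp
qed

text \<open>A runner determines its charge \<open>c i\<close>, and shifting it by
  \<open>- c i\<close> leaves a diagram of charge 0, hence a unique partition \<open>L i\<close>.
  The charges sum to 0 because charge is additive over the runners.\<close>

lemma bij_betw_assemble:
  "bij_betw (\<lambda>(c, L). assemble t c L) (charge_vectors t \<times> ({..<t} \<rightarrow>\<^sub>E all_partitions)) all_partitions"
  unfolding bij_betw_def
proof
  show "inj_on (\<lambda>(c, L). assemble t c L) (charge_vectors t \<times> ({..<t} \<rightarrow>\<^sub>E all_partitions))"
  proof (rule inj_onI, clarify)
    fix c L c' L'
    assume c: "c \<in> charge_vectors t" "c' \<in> charge_vectors t"
      and L: "L \<in> {..<t} \<rightarrow>\<^sub>E all_partitions" "L' \<in> {..<t} \<rightarrow>\<^sub>E all_partitions"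
      and eq: "assemble t c L = assemble t c' L'"
    have glue: "glue t c L = glue t c' L'"
      using assemble(2)[OF c(1) L(1)] assemble(2)[OF c(2) L(2)] eq by simp
    have *: "c i = c' i \<and> L i = L' i" if i: "i < t" for i
    proof -
      have Li: "L i \<in> all_partitions" "L' i \<in> all_partitions" using L i by auto
      have sh: "shift (c i) (maya_of (L i)) = shift (c' i) (maya_of (L' i))"
        using runner_glue[OF i, of c L] runner_glue[OF i, of c' L'] glue by simp
      then have "charge (shift (c i) (maya_of (L i))) = charge (shift (c' i) (maya_of (L' i)))" by simp
      then have "c i = c' i" using charge_energy_maya_of Li by (simp add: charge_shift maya_maya_of)
      moreover from this sh have "maya_of (L i) = maya_of (L' i)" by (simp add: shift_eq_iff)
      ultimately show ?thesis using maya_of_inj Li by blast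
    qed
    show "c = c' \<and> L = L'"
    proof
      show "c = c'" by (rule PiE_ext[of _ "{..<t}" "\<lambda>_. UNIV"]) (use c * in \<open>auto simp: charge_vectors_def\<close>)
      show "L = L'" by (rule PiE_ext[OF L]) (use * in auto)
    qed
  qed
  show "(\<lambda>(c, L). assemble t c L) ` (charge_vectors t \<times> ({..<t} \<rightarrow>\<^sub>E all_partitions)) = all_partitions"
  proof (intro equalityI subsetI)
    fix l assume l: "l \<in> all_partitions"
    define R where "R = (\<lambda>i. runner t i (maya_of l))"
    define c where "c = restrict (\<lambda>i. charge (R i)) {..<t}"
    define L where "L = restrict (\<lambda>i. inv_into all_partitions maya_of (shift (- c i) (R i))) {..<t}"
    have Lc: "L i \<in> all_partitions \<and> shift (c i) (maya_of (L i)) = R i" if i: "i < t" for i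
    proof -
      have R: "maya (R i)" unfolding R_def by (rule maya_runner[OF maya_maya_of i])
      have "charge (shift (- c i) (R i)) = 0" using i by (simp add: charge_shift[OF R] c_def)
      then have im: "shift (- c i) (R i) \<in> maya_of ` all_partitions"
        using bij_betw_imp_surj_on[OF bij_betw_maya_of] maya_shift[OF R] by blast
      have "L i = inv_into all_partitions maya_of (shift (- c i) (R i))" using i by (simp add: L_def)
      then have "L i \<in> all_partitions" "maya_of (L i) = shift (- c i) (R i)"
        using inv_into_into[OF im] f_inv_into_f[OF im] by simp_all
      then show ?thesis by (simp add: shift_shift)
    qed
    have "(\<Sum>i<t. c i) = charge (maya_of l)"
      using msum_runner[OF t maya_maya_of, of "\<lambda>_. 1" l] by (simp add: c_def R_def)
    then have c: "c \<in> charge_vectors t"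
      using charge_energy_maya_of[OF l] by (simp add: charge_vectors_def c_def)
    have L: "L \<in> {..<t} \<rightarrow>\<^sub>E all_partitions"
      using Lc by (auto simp: L_def)
    have "glue t c L = maya_of l"
      by (rule eq_from_runners[OF t]) (use Lc in \<open>simp add: runner_glue R_def\<close>)
    then have "assemble t c L = l"
      using maya_of_inj[OF assemble(1)[OF c L] l] assemble(2)[OF c L] by simp
    then show "l \<in> (\<lambda>(c, L). assemble t c L) ` (charge_vectors t \<times> ({..<t} \<rightarrow>\<^sub>E all_partitions))"
      using c L by (intro image_eqI[of _ _ "(c, L)"]) simp_all
  next
    fix l assume "l \<in> (\<lambda>(c, L). assemble t c L) ` (charge_vectors t \<times> ({..<t} \<rightarrow>\<^sub>E all_partitions))"
    then obtain p where p: "p \<in> charge_vectors t \<times> ({..<t} \<rightarrow>\<^sub>E all_partitions)" "l = (case p of (c, L) \<Rightarrow> assemble t c L)"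
      by (rule imageE)
    then show "l \<in> all_partitions"
      using assemble(1)[of "fst p" "snd p"] by (simp add: mem_Times_iff case_prod_unfold)
  qed
qed

lemma charge_weight_nonneg:
  assumes "c \<in> charge_vectors t"
  shows "charge_weight t c \<ge> 0"
proof -
  \<comment> \<open>With the empty quotient the weight is the size of an actual partition.\<close>
  have "(\<lambda>i\<in>{..<t}. []) \<in> {..<t} \<rightarrow>\<^sub>E all_partitions" by simp
  from assemble(3)[OF assms this] show ?thesis by simp
qed

end

definition hook_weight :: "nat \<Rightarrow> 'a \<Rightarrow> 'a \<Rightarrow> nat list \<Rightarrow> 'a :: {banach, real_normed_field}" where
  "hook_weight t T z l = z ^ sum_list l * T ^ num_hooks t l"

definition hook_gf :: "nat \<Rightarrow> complex \<Rightarrow> complex \<Rightarrow> complex" where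
  "hook_gf t T z = infsum (hook_weight t T z) all_partitions"

lemma hook_weight_assemble:
  assumes "0 < t" "c \<in> charge_vectors t" "L \<in> {..<t} \<rightarrow>\<^sub>E all_partitions"
  shows "hook_weight t T z (assemble t c L) = z ^ nat (charge_weight t c) * (\<Prod>i<t. distinct_weight T (z ^ t) (L i))"
proof -
  note as = assemble[OF assms]
  have "sum_list (assemble t c L) = nat (charge_weight t c) + t * (\<Sum>i<t. sum_list (L i))"
    using as(3) charge_weight_nonneg[OF assms(1,2)]
    by (metis int_nat_eq of_nat_add of_nat_eq_iff of_nat_mult of_nat_sum)
  then have "z ^ sum_list (assemble t c L) = z ^ nat (charge_weight t c) * (\<Prod>i<t. (z ^ t) ^ sum_list (L i))"
    by (simp add: power_add power_mult power_sum)
  then show ?thesis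
    by (simp add: hook_weight_def distinct_weight_def as(4) power_sum prod.distrib)
qed

text \<open>Taking the empty quotient embeds the charge vectors into the partitions with
  \<open>charge_weight\<close> as the size, so the series is part of the absolutely convergent
  partition series.\<close>

lemma norm_summable_charge_weight:
  assumes "0 < t" "norm (z :: complex) < 1"
  shows "(\<lambda>c. z ^ nat (charge_weight t c)) norm_summable_on charge_vectors t"
proof -
  define E where "E = (\<lambda>i\<in>{..<t}. [] :: nat list)"
  have E: "E \<in> {..<t} \<rightarrow>\<^sub>E all_partitions" by (simp add: E_def)
  define g where "g = (\<lambda>c. assemble t c E)"
  have inj: "inj_on g (charge_vectors t)"
  proof (rule inj_onI)
    fix c c' assume "c \<in> charge_vectors t" "c' \<in> charge_vectors t" "g c = g c'"
    then have "(c, E) = (c', E)"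
      using bij_betw_imp_inj_on[OF bij_betw_assemble[OF assms(1)]] E
      by (intro inj_onD[of "\<lambda>(c, L). assemble t c L"]) (auto simp: g_def)
    then show "c = c'" by simp
  qed
  have "g ` charge_vectors t \<subseteq> all_partitions"
    using assemble(1)[OF assms(1) _ E] by (auto simp: g_def)
  then have "distinct_weight 1 z norm_summable_on g ` charge_vectors t"
    using abs_summable_distinct_weight[OF assms(2), of 1] by (rule summable_on_subset_banach[rotated])
  then have "(\<lambda>c. norm (distinct_weight 1 z (g c))) summable_on charge_vectors t"
    unfolding summable_on_reindex[OF inj] by (simp add: o_def)
  also have "?this \<longleftrightarrow> ?thesis"
  proof (rule summable_on_cong)
    fix c assume c: "c \<in> charge_vectors t"
    have "int (sum_list (g c)) = charge_weight t c"
      using assemble(3)[OF assms(1) c E] by (simp add: g_def E_def)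
    then have "sum_list (g c) = nat (charge_weight t c)" by simp
    then show "norm (distinct_weight 1 z (g c)) = norm (z ^ nat (charge_weight t c))"
      by (simp add: distinct_weight_def)
  qed
  finally show ?thesis .
qed

text \<open>Sizes add up over core and quotient, and all hooks of length \<open>t\<close> come from
  the quotient. The sum over pairs therefore factorises into a core series and \<open>t\<close>
  equal factors in \<open>z ^ t\<close>.\<close>

lemma hook_gf_factor:
  assumes t: "0 < t" and z: "norm z < 1"
  shows "hook_weight t T z norm_summable_on all_partitions"
    and "hook_gf t T z = infsum (\<lambda>c. z ^ nat (charge_weight t c)) (charge_vectors t) * distinct_gf T (z ^ t) ^ t"
proof -
  have zt: "norm (z ^ t) < 1" using z t norm_power_Suc_less_1[of z "t - 1"] by simp
  define f where "f = (\<lambda>L. \<Prod>i<t. distinct_weight T (z ^ t) (L i))"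
  have f: "f norm_summable_on {..<t} \<rightarrow>\<^sub>E all_partitions"
    unfolding f_def by (rule abs_summable_on_prod_PiE[OF finite_lessThan abs_summable_distinct_weight[OF zt]])
  have "infsum f ({..<t} \<rightarrow>\<^sub>E all_partitions) = (\<Prod>i<t. infsum (distinct_weight T (z ^ t)) all_partitions)"
    unfolding f_def by (rule infsum_prod_PiE_abs[OF finite_lessThan abs_summable_distinct_weight[OF zt]])
  then have f_sum: "infsum f ({..<t} \<rightarrow>\<^sub>E all_partitions) = distinct_gf T (z ^ t) ^ t"
    by (simp only: distinct_gf_def prod_constant card_lessThan)
  note K = norm_summable_charge_weight[OF t z]
  note bij = bij_betw_assemble[OF t]
  have eq: "hook_weight t T z (case p of (c, L) \<Rightarrow> assemble t c L) = (case p of (c, L) \<Rightarrow> z ^ nat (charge_weight t c) * f L)"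
    if "p \<in> charge_vectors t \<times> ({..<t} \<rightarrow>\<^sub>E all_partitions)" for p
    using hook_weight_assemble[OF t, of "fst p" "snd p" T z] that
    by (simp add: f_def case_prod_unfold mem_Times_iff)
  have "(\<lambda>p. norm (hook_weight t T z (case p of (c, L) \<Rightarrow> assemble t c L))) summable_on charge_vectors t \<times> ({..<t} \<rightarrow>\<^sub>E all_partitions)"
    using abs_summable_on_Times[OF K f]
    by (rule summable_on_cong[THEN iffD1, rotated]) (simp add: eq)
  then show "hook_weight t T z norm_summable_on all_partitions"
    by (subst (asm) summable_on_reindex_bij_betw[OF bij])
  have "hook_gf t T z = infsum (\<lambda>p. hook_weight t T z (case p of (c, L) \<Rightarrow> assemble t c L)) (charge_vectors t \<times> ({..<t} \<rightarrow>\<^sub>E all_partitions))"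
    unfolding hook_gf_def by (subst infsum_reindex_bij_betw[OF bij]) simp
  also have "\<dots> = infsum (\<lambda>(c, L). z ^ nat (charge_weight t c) * f L) (charge_vectors t \<times> ({..<t} \<rightarrow>\<^sub>E all_partitions))"
    by (rule infsum_cong) (simp add: eq)
  also have "\<dots> = infsum (\<lambda>c. z ^ nat (charge_weight t c)) (charge_vectors t) * distinct_gf T (z ^ t) ^ t"
    by (subst infsum_Times[OF K f]) (simp add: f_sum)
  finally show "hook_gf t T z = infsum (\<lambda>c. z ^ nat (charge_weight t c)) (charge_vectors t) * distinct_gf T (z ^ t) ^ t" .
qed

text \<open>The sum over charge vectors (the generating function of the \<open>t\<close>-cores) does not depend on \<open>T\<close>,
  so it is eliminated by comparison with \<open>T = 1\<close>.\<close>

theorem hook_gf_eq: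
  assumes "0 < t" "norm z < 1"
  shows "hook_gf t T z * distinct_gf 1 (z ^ t) ^ t = distinct_gf 1 z * distinct_gf T (z ^ t) ^ t"
proof -
  have "hook_weight t 1 z = distinct_weight 1 z"
    by (simp add: fun_eq_iff hook_weight_def distinct_weight_def)
  then have "hook_gf t 1 z = distinct_gf 1 z"
    by (simp add: hook_gf_def distinct_gf_def)
  then show ?thesis
    using hook_gf_factor(2)[OF assms, of T] hook_gf_factor(2)[OF assms, of 1] by simp
qed

section \<open>Coefficients as Fourier integrals\<close>

definition hook_poly :: "nat \<Rightarrow> complex \<Rightarrow> nat \<Rightarrow> complex" where
  "hook_poly t T n = (\<Sum>l\<in>partitions n. T ^ num_hooks t l)"

lemma hook_gf_sums:
  assumes "0 < t" "norm z < 1"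
  shows "summable (\<lambda>n. norm (hook_poly t T n * z ^ n))"
    and "(\<lambda>n. hook_poly t T n * z ^ n) sums hook_gf t T z"
proof -
  note w = hook_gf_factor(1)[OF assms, of T]
  define S where "S = (SIGMA n:UNIV. partitions n)"
  have bij: "bij_betw snd S all_partitions"
  proof (rule bij_betw_byWitness[where f' = "\<lambda>l. (sum_list l, l)"])
    show "snd ` S \<subseteq> all_partitions" "(\<lambda>l. (sum_list l, l)) ` all_partitions \<subseteq> S"
      by (auto simp: S_def partitions_eq)
  qed (auto simp: S_def partitions_eq)
  have S: "(\<lambda>p. norm (hook_weight t T z (snd p))) summable_on S"
    using w by (subst summable_on_reindex_bij_betw[OF bij])
  have poly: "hook_poly t T n * z ^ n = infsum (\<lambda>l. hook_weight t T z (snd (n, l))) (partitions n)" for n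
  proof -
    have "hook_poly t T n * z ^ n = (\<Sum>l\<in>partitions n. hook_weight t T z l)"
      unfolding hook_poly_def sum_distrib_right
      by (rule sum.cong) (auto simp: hook_weight_def partitions_eq)
    then show ?thesis by (simp add: infsum_finite[OF finite_partitions])
  qed
  have "(\<lambda>n. infsum (\<lambda>l. norm (hook_weight t T z (snd (n, l)))) (partitions n)) summable_on UNIV"
    using summable_on_Sigma_banach[of "\<lambda>n l. norm (hook_weight t T z (snd (n, l)))" UNIV partitions] S
    by (simp add: S_def case_prod_unfold)
  then have "(\<lambda>n. norm (hook_poly t T n * z ^ n)) summable_on UNIV"
  proof (rule Infinite_Sum.abs_summable_on_comparison_test')
    fix n
    show "norm (hook_poly t T n * z ^ n) \<le> infsum (\<lambda>l. norm (hook_weight t T z (snd (n, l)))) (partitions n)"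
      unfolding poly using finite_partitions[of n] by (simp add: infsum_finite sum_norm_le)
  qed
  then show sm: "summable (\<lambda>n. norm (hook_poly t T n * z ^ n))"
    by (rule summable_on_imp_summable)
  have "hook_gf t T z = infsum (\<lambda>p. hook_weight t T z (snd p)) S"
    unfolding hook_gf_def by (rule infsum_reindex_bij_betw[OF bij, symmetric])
  also have "\<dots> = infsum (\<lambda>n. hook_poly t T n * z ^ n) UNIV"
    unfolding poly S_def
    by (rule infsum_Sigma_banach[symmetric]) (use Infinite_Sum.abs_summable_summable[OF S] in \<open>simp add: S_def\<close>)
  finally have eq: "hook_gf t T z = infsum (\<lambda>n. hook_poly t T n * z ^ n) UNIV" .
  have "((\<lambda>n. hook_poly t T n * z ^ n) has_sum hook_gf t T z) UNIV"
    unfolding eq by (rule has_sum_infsum[OF norm_summable_imp_summable_on[OF sm]])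
  then show "(\<lambda>n. hook_poly t T n * z ^ n) sums hook_gf t T z"
    by (rule has_sum_imp_sums)
qed

lemma integral_cis_multiple:
  fixes m :: int
  shows "(\<integral>x. indicator {-pi..pi} x *\<^sub>R exp (\<i> * of_int m * of_real x) \<partial>lborel) = (if m = 0 then 2 * of_real pi else 0)"
proof (cases "m = 0")
  case True
  then show ?thesis by (simp add: scaleR_conv_of_real)
next
  case False
  define F where "F = (\<lambda>x::real. exp (\<i> * of_int m * of_real x) / (\<i> * of_int m))"
  have "(\<integral>x. indicator {-pi..pi} x *\<^sub>R exp (\<i> * of_int m * of_real x) \<partial>lborel) = F pi - F (-pi)"
  proof (rule integral_FTC_Icc)
    fix x :: real
    show "(F has_vector_derivative exp (\<i> * of_int m * of_real x)) (at x within {-pi..pi})"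
      unfolding F_def using False
      by (auto intro!: derivative_eq_intros has_vector_derivative_real_field)
  qed (auto intro!: continuous_intros)
  also have "F pi = F (-pi)"
  proof -
    have "exp (\<i> * of_int m * of_real pi) = exp (\<i> * of_int m * of_real (-pi)) * exp (of_int m * (2 * of_real pi * \<i>))"
      by (subst exp_add[symmetric]) (simp add: algebra_simps)
    also have "exp (of_int m * (2 * of_real pi * \<i>)) = 1"
      by (simp add: exp_eq_1)
    finally show ?thesis by (simp add: F_def)
  qed
  finally show ?thesis using False by simp
qed

text \<open>The series converges absolutely on the circle, so it can be integrated term by term;
  orthogonality of the exponentials leaves only the term \<open>k = n\<close>.\<close>

lemma power_series_coefficient_integral:
  fixes a :: "nat \<Rightarrow> complex"
  assumes r: "0 < r" and sm: "summable (\<lambda>k. norm (a k) * r ^ k)"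
    and sums: "\<And>x. (\<lambda>k. a k * (of_real r * exp (\<i> * of_real x)) ^ k) sums F x"
  shows "integrable lborel (\<lambda>x. indicator {-pi..pi} x *\<^sub>R (F x * exp (- (\<i> * of_nat n * of_real x))))" (is ?I)
    and "(\<integral>x. indicator {-pi..pi} x *\<^sub>R (F x * exp (- (\<i> * of_nat n * of_real x))) \<partial>lborel) = 2 * of_real pi * a n * of_real r ^ n" (is ?E)
proof -
  define f where "f = (\<lambda>k x. indicator {-pi..pi} x *\<^sub>R (a k * of_real r ^ k * exp (\<i> * of_int (int k - int n) * of_real x)))"
  have f_eq: "f k x = indicator {-pi..pi} x *\<^sub>R (a k * (of_real r * exp (\<i> * of_real x)) ^ k * exp (- (\<i> * of_nat n * of_real x)))" for k x
  proof -
    have "exp (\<i> * of_int (int k - int n) * of_real x) = exp (\<i> * of_real x) ^ k * exp (- (\<i> * of_nat n * of_real x))"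
      by (subst exp_of_nat_mult[symmetric], subst exp_add[symmetric]) (simp add: algebra_simps)
    then show ?thesis by (simp add: f_def power_mult_distrib)
  qed
  have nf: "norm (f k x) = indicator {-pi..pi} x * (norm (a k) * r ^ k)" for k x
    using r by (simp add: f_def norm_mult norm_power)
  have f_int: "integral\<^sup>L lborel (f k) = (if k = n then 2 * of_real pi * a n * of_real r ^ n else 0)" for k
  proof -
    have "integral\<^sup>L lborel (f k) = (\<integral>x. a k * of_real r ^ k * (indicator {-pi..pi} x *\<^sub>R exp (\<i> * of_int (int k - int n) * of_real x)) \<partial>lborel)"
      unfolding f_def by simp
    also have "\<dots> = a k * of_real r ^ k * (if int k - int n = 0 then 2 * of_real pi else 0)"
      by (simp only: integral_mult_right_zero integral_cis_multiple)
    finally show ?thesis by simp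
  qed
  have 1: "integrable lborel (f k)" for k
    unfolding f_def by (rule borel_integrable_compact) (auto intro!: continuous_intros)
  have 2: "AE x in lborel. summable (\<lambda>k. norm (f k x))"
    using sm by (intro AE_I2) (simp add: nf summable_mult)
  have 3: "summable (\<lambda>k. \<integral>x. norm (f k x) \<partial>lborel)"
    using sm by (simp add: nf summable_mult)
  have f_suminf: "(\<lambda>x. \<Sum>k. f k x) = (\<lambda>x. indicator {-pi..pi} x *\<^sub>R (F x * exp (- (\<i> * of_nat n * of_real x))))"
  proof
    fix x
    have "(\<lambda>k. f k x) sums (indicator {-pi..pi} x *\<^sub>R (F x * exp (- (\<i> * of_nat n * of_real x))))"
      unfolding f_eq by (intro sums_scaleR_right sums_mult2 sums)
    then show "(\<Sum>k. f k x) = indicator {-pi..pi} x *\<^sub>R (F x * exp (- (\<i> * of_nat n * of_real x)))"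
      by (rule sums_unique[symmetric])
  qed
  show ?I using integrable_suminf[OF 1 2 3] unfolding f_suminf .
  have "(\<integral>x. (\<Sum>k. f k x) \<partial>lborel) = (\<Sum>k. integral\<^sup>L lborel (f k))"
    by (rule integral_suminf[OF 1 2 3])
  also have "\<dots> = (\<Sum>k. if k = n then 2 * of_real pi * a n * of_real r ^ n else 0)"
    by (simp only: f_int)
  also have "\<dots> = 2 * of_real pi * a n * of_real r ^ n"
    using sums_unique[OF sums_single[of n "\<lambda>_. 2 * of_real pi * a n * of_real r ^ n"]] by simp
  finally show ?E unfolding f_suminf .
qed

text \<open>The sign in \<open>Complex \<tau> (-x)\<close> makes the argument equal to
  \<open>exp (- \<tau>) * exp (i x)\<close>, which fits the convention \<open>z = exp (- s)\<close>
  of the logarithmic expansions.\<close>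

lemma hook_poly_integral:
  assumes t: "0 < t" and \<tau>: "0 < \<tau>"
  shows "integrable lborel (\<lambda>x. indicator {-pi..pi} x *\<^sub>R (hook_gf t T (exp (- Complex \<tau> (-x))) * exp (- (\<i> * of_nat n * of_real x))))"
    and "(\<integral>x. indicator {-pi..pi} x *\<^sub>R (hook_gf t T (exp (- Complex \<tau> (-x))) * exp (- (\<i> * of_nat n * of_real x))) \<partial>lborel)
      = 2 * of_real pi * hook_poly t T n * of_real (exp (- \<tau>)) ^ n"
proof -
  have z: "exp (- Complex \<tau> (-x)) = of_real (exp (- \<tau>)) * exp (\<i> * of_real x)" for x
    by (simp add: exp_of_real[symmetric] exp_add[symmetric] complex_eq_iff Complex_eq)
  have nz: "norm (exp (- Complex \<tau> (-x))) < 1" for x using \<tau> by simp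
  have 1: "0 < exp (- \<tau>)" by simp
  have 2: "summable (\<lambda>k. norm (hook_poly t T k) * exp (- \<tau>) ^ k)"
    using hook_gf_sums(1)[OF t nz[of 0], of T] by (simp add: norm_mult norm_power)
  have 3: "(\<lambda>k. hook_poly t T k * (of_real (exp (- \<tau>)) * exp (\<i> * of_real x)) ^ k) sums hook_gf t T (exp (- Complex \<tau> (-x)))" for x
    using hook_gf_sums(2)[OF t nz[of x], of T] by (simp only: z)
  show "integrable lborel (\<lambda>x. indicator {-pi..pi} x *\<^sub>R (hook_gf t T (exp (- Complex \<tau> (-x))) * exp (- (\<i> * of_nat n * of_real x))))"
    and "(\<integral>x. indicator {-pi..pi} x *\<^sub>R (hook_gf t T (exp (- Complex \<tau> (-x))) * exp (- (\<i> * of_nat n * of_real x))) \<partial>lborel)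
      = 2 * of_real pi * hook_poly t T n * of_real (exp (- \<tau>)) ^ n"
    by (rule power_series_coefficient_integral[OF 1 2 3])+
qed

section \<open>Logarithms of the generating functions\<close>

lemma norm_exp_minus_less_1: "0 < Re s \<Longrightarrow> norm (exp (- s)) < 1"
  by simp

lemma norm_exp_minus_1_ge: "exp (Re s) - 1 \<le> norm (exp s - 1)"
  using norm_triangle_ineq2[of "exp s" 1] by simp

lemma exp_minus_1_nonzero: "0 < Re s \<Longrightarrow> exp s - 1 \<noteq> 0"
  using norm_exp_minus_1_ge[of s] by (metis exp_gt_one diff_gt_0_iff_gt norm_zero not_less)

lemma geometric_exp_minus:
  assumes "0 < Re s"
  shows "exp (- s) / (1 - exp (- s)) = 1 / (exp s - 1)"
  using exp_minus_1_nonzero[OF assms] by (simp add: exp_minus field_simps)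

lemma norm_exp_multiple:
  assumes "0 < Re s"
  shows "0 < Re (of_nat (Suc k) * s)"
  using assms by simp

text \<open>The logarithm of the product of \<open>1 / (1 - z ^ m)\<close> at
  \<open>z = exp (- s)\<close>: each factor is expanded in powers indexed by \<open>k + 1\<close>,
  and the geometric sum over \<open>m\<close> is carried out first. The series fixes a branch on the
  whole right half-plane.\<close>

definition partition_log :: "complex \<Rightarrow> complex" where
  "partition_log s = (\<Sum>k. 1 / (of_nat (Suc k) * (exp (of_nat (Suc k) * s) - 1)))"

lemma distinct_gf_1_eq_exp:
  assumes s: "0 < Re s"
  shows "distinct_gf 1 (exp (- s)) = exp (partition_log s)"
    and "summable (\<lambda>k. norm (1 / (of_nat (Suc k) * (exp (of_nat (Suc k) * s) - 1))))"
proof -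
  define z where "z = exp (- s)"
  define r where "r = norm z"
  have r: "0 < r" "r < 1" using s by (simp_all add: r_def z_def)
  \<comment> \<open>\<open>k\<close> indexes the powers in the logarithm and \<open>K\<close>
    truncates the product. Letting \<open>K\<close> grow under the sum over \<open>k\<close>
    exchanges the two summations.\<close>
  define a where "a = (\<lambda>k K. (\<Sum>m=1..K. (z ^ m) ^ Suc k / of_nat (Suc k)))"
  have zpow: "(z ^ m) ^ Suc k = (z ^ Suc k) ^ m" for m k by (metis mult.commute power_mult)
  have zk: "norm (z ^ Suc k) < 1" for k unfolding z_def by (intro norm_power_Suc_less_1 norm_exp_minus_less_1 s)
  have lim: "(\<lambda>K. a k K) \<longlonglongrightarrow> 1 / (of_nat (Suc k) * (exp (of_nat (Suc k) * s) - 1))" for k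
  proof -
    define w where "w = z ^ Suc k"
    have "(\<lambda>m. w ^ Suc m) sums (w * (1 / (1 - w)))"
      unfolding power_Suc by (intro sums_mult geometric_sums) (use zk in \<open>simp add: w_def\<close>)
    then have "(\<lambda>K. \<Sum>m<K. w ^ Suc m) \<longlonglongrightarrow> w / (1 - w)" by (simp add: sums_def)
    moreover have "(\<Sum>m<K. w ^ Suc m) = (\<Sum>m=1..K. w ^ m)" for K
      by (rule sum.reindex_bij_witness[of _ "\<lambda>m. m - 1" Suc]) auto
    ultimately have "(\<lambda>K. (\<Sum>m=1..K. w ^ m) / of_nat (Suc k)) \<longlonglongrightarrow> w / (1 - w) / of_nat (Suc k)"
      by (intro tendsto_divide tendsto_const) (auto simp del: of_nat_Suc)
    also have "(\<lambda>K. (\<Sum>m=1..K. w ^ m) / of_nat (Suc k)) = a k"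
      by (simp add: a_def zpow w_def sum_divide_distrib del: of_nat_Suc power_Suc)
    also have "w = exp (- (of_nat (Suc k) * s))"
      unfolding w_def z_def by (subst exp_of_nat_mult[symmetric]) simp
    finally have f: "a k \<longlonglongrightarrow> exp (- (of_nat (Suc k) * s)) / (1 - exp (- (of_nat (Suc k) * s))) / of_nat (Suc k)" .
    show ?thesis
      using f[unfolded geometric_exp_minus[OF norm_exp_multiple[OF s]] divide_divide_eq_left]
      by (simp only: mult.commute)
  qed
  \<comment> \<open>Independent of \<open>K\<close> and summable in \<open>k\<close>, as Tannery's
    theorem requires.\<close>
  have bound: "norm (a k K) \<le> r / (1 - r) * r ^ k" for k K
  proof -
    have "norm (a k K) \<le> (\<Sum>m=1..K. norm ((z ^ m) ^ Suc k / of_nat (Suc k)))"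
      unfolding a_def by (rule norm_sum)
    also have "\<dots> \<le> (\<Sum>m=1..K. r ^ m * r ^ k)"
    proof (rule sum_mono)
      fix m assume m: "m \<in> {1..K}"
      have "norm ((z ^ m) ^ Suc k / of_nat (Suc k)) = (r ^ m) ^ Suc k / real (Suc k)"
        by (simp add: norm_divide norm_power r_def norm_mult del: of_nat_Suc)
      also have "\<dots> \<le> (r ^ m) ^ Suc k"
        using divide_left_mono[of 1 "real (Suc k)" "(r ^ m) ^ Suc k"] r by simp
      also have "\<dots> \<le> r ^ m * r ^ k"
      proof -
        have "(r ^ m) ^ k \<le> r ^ k" using r m power_decreasing[of 1 m r] by (intro power_mono) auto
        then show ?thesis using r by (simp add: mult_left_mono)
      qed
      finally show "norm ((z ^ m) ^ Suc k / of_nat (Suc k)) \<le> r ^ m * r ^ k" .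
    qed
    also have "\<dots> = (\<Sum>m<K. r ^ Suc m) * r ^ k"
      unfolding sum_distrib_right
      by (rule sum.reindex_bij_witness[of _ Suc "\<lambda>m. m - 1"]) auto
    also have "(\<Sum>m<K. r ^ Suc m) \<le> (\<Sum>m. r ^ Suc m)"
      using r by (intro sum_le_suminf) (auto intro!: summable_mult summable_geometric)
    also have "(\<Sum>m. r ^ Suc m) = r / (1 - r)"
      using r suminf_mult[OF summable_geometric[of r], of r] by (simp add: suminf_geometric)
    finally show ?thesis using r by (simp add: mult_right_mono)
  qed
  have tan: "eventually (\<lambda>K. summable (\<lambda>k. norm (a k K))) sequentially \<and>
    summable (\<lambda>k. norm (1 / (of_nat (Suc k) * (exp (of_nat (Suc k) * s) - 1)))) \<and>
    (\<lambda>K. suminf (\<lambda>k. a k K)) \<longlonglongrightarrow> partition_log s"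
    unfolding partition_log_def
  proof (rule tannerys_theorem)
    show "\<forall>\<^sub>F (k, n) in sequentially \<times>\<^sub>F sequentially. cmod (a k n) \<le> r / (1 - r) * r ^ k"
      using bound by (simp add: always_eventually)
    show "summable (\<lambda>k. r / (1 - r) * r ^ k)" using r by (intro summable_mult summable_geometric) auto
  qed (use lim in auto)
  then show "summable (\<lambda>k. norm (1 / (of_nat (Suc k) * (exp (of_nat (Suc k) * s) - 1))))" by blast
  have factor: "1 + 1 * z ^ m / (1 - z ^ m) = exp (- ln (1 - z ^ m))" if "m \<ge> 1" for m
  proof -
    have "norm (z ^ m) < 1" using zk[of "m - 1"] that by simp
    then have "1 - z ^ m \<noteq> 0" by auto
    then show ?thesis by (simp add: exp_minus field_simps)
  qed
  have ser: "(\<lambda>k. (z ^ m) ^ Suc k / of_nat (Suc k)) sums (- ln (1 - z ^ m))" if "m \<ge> 1" for m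
  proof -
    have "norm (z ^ m) < 1" using zk[of "m - 1"] that by simp
    then have "(\<lambda>n. - ((- (- (z ^ m))) ^ n) / of_nat n) sums ln (1 + (- (z ^ m)))"
      by (intro Ln_series') simp
    then have "(\<lambda>n. (z ^ m) ^ n / of_nat n) sums (- ln (1 - z ^ m))"
      using sums_minus by fastforce
    then show ?thesis
      by (subst sums_Suc_iff) (simp del: of_nat_Suc)
  qed
  have "(\<lambda>k. a k K) sums (\<Sum>m=1..K. - ln (1 - z ^ m))" for K
    unfolding a_def by (rule sums_sum) (use ser in auto)
  then have "suminf (\<lambda>k. a k K) = (\<Sum>m=1..K. - ln (1 - z ^ m))" for K
    by (rule sums_unique[symmetric])
  then have "(\<lambda>K. exp (\<Sum>m=1..K. - ln (1 - z ^ m))) \<longlonglongrightarrow> exp (partition_log s)"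
    using tan by (intro tendsto_exp) simp
  moreover have "exp (\<Sum>m=1..K. - ln (1 - z ^ m)) = (\<Prod>m=1..K. 1 + 1 * z ^ m / (1 - z ^ m))" for K
    unfolding exp_sum[OF finite_atLeastAtMost] by (rule prod.cong) (use factor in auto)
  ultimately have "(\<lambda>K. \<Prod>m=1..K. 1 + 1 * z ^ m / (1 - z ^ m)) \<longlonglongrightarrow> exp (partition_log s)"
    by simp
  then show "distinct_gf 1 (exp (- s)) = exp (partition_log s)"
    using distinct_gf_tendsto[of z 1] r LIMSEQ_unique by (auto simp: r_def z_def)
qed

text \<open>The logarithm of the product of \<open>1 + u * z ^ m\<close> for \<open>m >= 1\<close>,
  where \<open>u\<close> stands for \<open>T - 1\<close> and \<open>z = exp (- s)\<close>.\<close>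

definition marked_log :: "complex \<Rightarrow> complex \<Rightarrow> complex" where
  "marked_log u s = (\<Sum>m. ln (1 + u * exp (- s) ^ Suc m))"

text \<open>The order is dictated by the scaling: \<open>T - 1\<close> has order n^(-1/4) and about
  n^(1/2) factors matter, so linear and quadratic terms survive while the cubic remainder sums to
  order n^(-1/4).\<close>

lemma ln_1_plus_quadratic:
  fixes x :: complex
  assumes "norm x \<le> 1 / 2"
  shows "norm (ln (1 + x) - x + x\<^sup>2 / 2) \<le> 2 * norm x ^ 3"
proof -
  have x: "norm x < 1" using assms by simp
  have "(\<lambda>n. - ((- x) ^ n) / of_nat n) sums ln (1 + x)" by (rule Ln_series'[OF x])
  then have s0: "(\<lambda>n. - ((- x) ^ (n + 3)) / of_nat (n + 3)) sums (ln (1 + x) - (\<Sum>n<3. - ((- x) ^ n) / of_nat n))"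
    by (rule sums_split_initial_segment)
  have "ln (1 + x) - (\<Sum>n<3. - ((- x) ^ n) / of_nat n) = ln (1 + x) - x + x\<^sup>2 / 2"
    by (simp add: eval_nat_numeral)
  note s = s0[unfolded this]
  have g: "(\<lambda>n. norm x ^ 3 * norm x ^ n) sums (norm x ^ 3 * (1 / (1 - norm x)))"
    using x by (intro sums_mult geometric_sums) simp
  have le: "norm (- ((- x) ^ (n + 3)) / of_nat (n + 3)) \<le> norm x ^ 3 * norm x ^ n" for n
  proof -
    have "norm (- ((- x) ^ (n + 3)) / of_nat (n + 3)) = norm x ^ 3 * norm x ^ n / real (n + 3)"
      by (simp add: norm_divide norm_power norm_mult power_add del: of_nat_add)
    also have "\<dots> \<le> norm x ^ 3 * norm x ^ n / 1"
      by (rule divide_left_mono) auto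
    finally show ?thesis by simp
  qed
  have "norm (ln (1 + x) - x + x\<^sup>2 / 2) \<le> norm x ^ 3 * (1 / (1 - norm x))"
    unfolding sums_unique[OF s] sums_unique[OF g]
    by (rule norm_suminf_le) (use le sums_summable[OF g] in auto)
  also have "\<dots> \<le> norm x ^ 3 * 2"
    using assms by (intro mult_left_mono) (auto simp: field_simps)
  finally show ?thesis by simp
qed

lemma exp_multiples_sums:
  assumes "0 < Re s"
  shows "(\<lambda>m. exp (- s) ^ Suc m) sums (1 / (exp s - 1))"
proof -
  have "(\<lambda>m. exp (- s) * exp (- s) ^ m) sums (exp (- s) * (1 / (1 - exp (- s))))"
    by (intro sums_mult geometric_sums norm_exp_minus_less_1 assms)
  then show ?thesis using geometric_exp_minus[OF assms] by simp
qed

text \<open>The linear and quadratic terms of the logarithms are geometric series in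
  \<open>z\<close> and \<open>z^2\<close>, hence \<open>exp s\<close> and
  \<open>exp (2 * s)\<close>. The product formula rests on
  \<open>1 + (1 + u) z^m / (1 - z^m) = (1 + u z^m) / (1 - z^m)\<close>.\<close>

lemma marked_log_estimate:
  assumes s: "0 < Re s" and u: "norm u \<le> 1 / 2"
  shows "norm (marked_log u s - u / (exp s - 1) + u\<^sup>2 / (2 * (exp (2 * s) - 1))) \<le> 2 * norm u ^ 3 / (exp (Re s) - 1)"
    and "distinct_gf (1 + u) (exp (- s)) = distinct_gf 1 (exp (- s)) * exp (marked_log u s)"
proof -
  define z where "z = exp (- s)"
  define r where "r = norm z"
  have r: "0 < r" "r < 1" using s by (simp_all add: r_def z_def)
  define R where "R = (\<lambda>m. ln (1 + u * z ^ Suc m) - u * z ^ Suc m + (u * z ^ Suc m)\<^sup>2 / 2)"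
  have uz: "norm (u * z ^ Suc m) \<le> norm u * r ^ Suc m" "norm (u * z ^ Suc m) \<le> 1 / 2" for m
  proof -
    show 1: "norm (u * z ^ Suc m) \<le> norm u * r ^ Suc m" by (simp add: norm_mult norm_power r_def)
    have "r ^ Suc m \<le> 1" using r by (intro power_le_one) auto
    then have "norm u * r ^ Suc m \<le> norm u" by (simp add: mult_left_le)
    with 1 u show "norm (u * z ^ Suc m) \<le> 1 / 2" by linarith
  qed
  have R: "norm (R m) \<le> 2 * norm u ^ 3 * r ^ Suc m" for m
  proof -
    have "norm (R m) \<le> 2 * norm (u * z ^ Suc m) ^ 3" unfolding R_def by (rule ln_1_plus_quadratic[OF uz(2)])
    also have "\<dots> \<le> 2 * (norm u * r ^ Suc m) ^ 3" using uz(1) by (intro mult_left_mono power_mono) auto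
    also have "\<dots> = 2 * norm u ^ 3 * (r ^ Suc m * (r ^ Suc m) ^ 2)"
      by (simp add: power_mult_distrib power3_eq_cube power2_eq_square mult_ac)
    also have "\<dots> \<le> 2 * norm u ^ 3 * (r ^ Suc m * 1)"
      using r by (intro mult_left_mono power_le_one) (auto intro!: mult_nonneg_nonneg power_le_one simp del: power_Suc)
    finally show ?thesis by simp
  qed
  have rs: "(\<lambda>m. r ^ Suc m) sums (1 / (exp (Re s) - 1))"
  proof -
    have "(\<lambda>m. r * r ^ m) sums (r * (1 / (1 - r)))" using r by (intro sums_mult geometric_sums) auto
    moreover have "r = exp (- Re s)" by (simp add: r_def z_def)
    then have "r = inverse (exp (Re s))" by (simp add: exp_minus)
    moreover have "inverse (exp (Re s)) * (1 / (1 - inverse (exp (Re s)))) = 1 / (exp (Re s) - 1)"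
      using s by (simp add: field_simps)
    ultimately show ?thesis by simp
  qed
  then have Rg: "(\<lambda>m. 2 * norm u ^ 3 * r ^ Suc m) sums (2 * norm u ^ 3 * (1 / (exp (Re s) - 1)))" by (rule sums_mult)
  have R_sum: "summable (\<lambda>m. norm (R m))"
    by (rule summable_comparison_test'[OF sums_summable[OF Rg], of 0]) (use R in auto)
  have s1: "(\<lambda>m. u * z ^ Suc m) sums (u * (1 / (exp s - 1)))"
    unfolding z_def by (intro sums_mult exp_multiples_sums s)
  have "(\<lambda>m. exp (- (2 * s)) ^ Suc m) sums (1 / (exp (2 * s) - 1))"
    by (rule exp_multiples_sums) (use s in simp)
  moreover have "exp (- (2 * s)) = z\<^sup>2" by (simp add: z_def exp_double[symmetric])
  ultimately have "(\<lambda>m. u\<^sup>2 / 2 * (z\<^sup>2) ^ Suc m) sums (u\<^sup>2 / 2 * (1 / (exp (2 * s) - 1)))"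
    by (intro sums_mult) simp
  moreover have "u\<^sup>2 / 2 * (z\<^sup>2) ^ Suc m = (u * z ^ Suc m)\<^sup>2 / 2" for m
    by (simp add: power_mult_distrib power_mult[symmetric] mult.commute)
  ultimately have s2: "(\<lambda>m. (u * z ^ Suc m)\<^sup>2 / 2) sums (u\<^sup>2 / (2 * (exp (2 * s) - 1)))" by simp
  have "(\<lambda>m. R m + u * z ^ Suc m - (u * z ^ Suc m)\<^sup>2 / 2) sums
    (suminf R + u * (1 / (exp s - 1)) - u\<^sup>2 / (2 * (exp (2 * s) - 1)))"
    by (intro sums_add sums_diff s1 s2 summable_sums[OF summable_norm_cancel[OF R_sum]])
  then have ml: "(\<lambda>m. ln (1 + u * z ^ Suc m)) sums (suminf R + u * (1 / (exp s - 1)) - u\<^sup>2 / (2 * (exp (2 * s) - 1)))"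
    by (simp add: R_def)
  then have eq: "marked_log u s = suminf R + u * (1 / (exp s - 1)) - u\<^sup>2 / (2 * (exp (2 * s) - 1))"
    unfolding marked_log_def z_def by (rule sums_unique[symmetric])
  have "norm (suminf R) \<le> 2 * norm u ^ 3 * (1 / (exp (Re s) - 1))"
    unfolding sums_unique[OF Rg] by (rule norm_suminf_le) (use R sums_summable[OF Rg] in auto)
  then show "norm (marked_log u s - u / (exp s - 1) + u\<^sup>2 / (2 * (exp (2 * s) - 1))) \<le> 2 * norm u ^ 3 / (exp (Re s) - 1)"
    by (simp add: eq)
  have "(\<lambda>K. \<Sum>m<K. ln (1 + u * z ^ Suc m)) \<longlonglongrightarrow> marked_log u s"
    using ml unfolding eq[symmetric] sums_def .
  then have "(\<lambda>K. exp (\<Sum>m<K. ln (1 + u * z ^ Suc m))) \<longlonglongrightarrow> exp (marked_log u s)" by (rule tendsto_exp)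
  moreover have "exp (\<Sum>m<K. ln (1 + u * z ^ Suc m)) = (\<Prod>m=1..K. 1 + u * z ^ m)" for K
  proof -
    have nz: "1 + u * z ^ Suc m \<noteq> 0" for m
      using uz(2)[of m] by (metis add_eq_0_iff norm_minus_cancel norm_one not_less one_less_numeral_iff semiring_norm(76) divide_less_eq_1_pos zero_less_numeral)
    have "exp (\<Sum>m<K. ln (1 + u * z ^ Suc m)) = (\<Prod>m<K. 1 + u * z ^ Suc m)"
      unfolding exp_sum[OF finite_lessThan] by (rule prod.cong) (use nz in auto)
    also have "\<dots> = (\<Prod>m=1..K. 1 + u * z ^ m)"
      by (rule prod.reindex_bij_witness[of _ "\<lambda>m. m - 1" Suc]) auto
    finally show ?thesis .
  qed
  ultimately have "(\<lambda>K. \<Prod>m=1..K. 1 + u * z ^ m) \<longlonglongrightarrow> exp (marked_log u s)" by simp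
  then have "(\<lambda>K. (\<Prod>m=1..K. 1 + 1 * z ^ m / (1 - z ^ m)) * (\<Prod>m=1..K. 1 + u * z ^ m)) \<longlonglongrightarrow> distinct_gf 1 z * exp (marked_log u s)"
    using r by (intro tendsto_mult distinct_gf_tendsto) (auto simp: r_def)
  moreover have "(\<Prod>m=1..K. 1 + 1 * z ^ m / (1 - z ^ m)) * (\<Prod>m=1..K. 1 + u * z ^ m) = (\<Prod>m=1..K. 1 + (1 + u) * z ^ m / (1 - z ^ m))" for K
    unfolding prod.distrib[symmetric]
  proof (rule prod.cong)
    fix m assume "m \<in> {1..K}"
    then have "norm (z ^ m) < 1" using norm_power_Suc_less_1[of z "m - 1"] r by (simp add: r_def)
    then have "1 - z ^ m \<noteq> 0" by auto
    then show "(1 + 1 * z ^ m / (1 - z ^ m)) * (1 + u * z ^ m) = 1 + (1 + u) * z ^ m / (1 - z ^ m)"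
      by (simp add: field_simps)
  qed simp
  ultimately have "(\<lambda>K. \<Prod>m=1..K. 1 + (1 + u) * z ^ m / (1 - z ^ m)) \<longlonglongrightarrow> distinct_gf 1 z * exp (marked_log u s)" by simp
  moreover have "(\<lambda>K. \<Prod>m=1..K. 1 + (1 + u) * z ^ m / (1 - z ^ m)) \<longlonglongrightarrow> distinct_gf (1 + u) z"
    using r by (intro distinct_gf_tendsto) (simp add: r_def)
  ultimately show "distinct_gf (1 + u) (exp (- s)) = distinct_gf 1 (exp (- s)) * exp (marked_log u s)"
    unfolding z_def by (rule LIMSEQ_unique[rotated])
qed

section \<open>Estimates for the Bose function\<close>

text \<open>This is \<open>a / 2 <= sinh (a / 2)\<close>, multiplied by
  \<open>2 * exp (a / 2)\<close> and squared.\<close>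

lemma exp_minus_1_square_ge:
  fixes a :: real
  assumes "0 \<le> a"
  shows "a\<^sup>2 * exp a \<le> (exp a - 1)\<^sup>2"
proof -
  have "a / 2 \<le> (exp (a / 2) - inverse (exp (a / 2))) / 2"
    using assms by (intro real_le_x_sinh) simp
  then have "a * exp (a / 2) \<le> (exp (a / 2) - inverse (exp (a / 2))) * exp (a / 2)"
    by (intro mult_right_mono) auto
  also have "\<dots> = exp a - 1" by (simp add: algebra_simps exp_add[symmetric])
  finally have "(a * exp (a / 2))\<^sup>2 \<le> (exp a - 1)\<^sup>2" using assms by (intro power_mono) auto
  then show ?thesis by (simp add: power_mult_distrib exp_double[symmetric])
qed

lemma norm_exp_minus_1_ge_Re: "0 < Re s \<Longrightarrow> Re s \<le> norm (exp s - 1)"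
  using norm_exp_minus_1_ge[of s] exp_ge_add_one_self[of "Re s"] by linarith

lemma norm_bose_le:
  assumes "0 < Re s"
  shows "norm (1 / (exp s - 1)) \<le> 1 / Re s"
  using norm_exp_minus_1_ge_Re[OF assms] assms by (simp add: norm_divide frac_le)

lemma norm_bose_deriv_le:
  assumes "0 < Re s"
  shows "norm (exp s / (exp s - 1)\<^sup>2) \<le> 1 / (Re s)\<^sup>2"
proof -
  have "(exp (Re s) - 1)\<^sup>2 \<le> norm (exp s - 1) ^ 2"
    using norm_exp_minus_1_ge[of s] assms by (intro power_mono) auto
  then have "(Re s)\<^sup>2 * exp (Re s) \<le> norm (exp s - 1) ^ 2"
    using exp_minus_1_square_ge[of "Re s"] assms by linarith
  moreover have "0 < norm (exp s - 1)" using exp_minus_1_nonzero[OF assms] by simp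
  ultimately show ?thesis
    using assms by (simp add: norm_divide norm_power norm_mult field_simps)
qed

lemma has_field_derivative_bose:
  assumes "0 < Re s"
  shows "((\<lambda>x. 1 / (exp x - 1)) has_field_derivative - (exp s / (exp s - 1)\<^sup>2)) (at s within S)"
  using exp_minus_1_nonzero[OF assms] by (auto intro!: derivative_eq_intros simp: power2_eq_square)

text \<open>Mean value bound along the vertical line through \<open>\<tau>\<close>, on which the
  derivative is controlled by the real part alone. The line is written as an intersection of
  half-planes to obtain convexity.\<close>

lemma norm_bose_diff_le:
  assumes "0 < \<tau>"
  shows "norm (1 / (exp (Complex \<tau> y) - 1) - 1 / (exp (of_real \<tau>) - 1)) \<le> \<bar>y\<bar> / \<tau>\<^sup>2"
proof -
  have "norm (1 / (exp (Complex \<tau> y) - 1) - 1 / (exp (Complex \<tau> 0) - 1)) \<le> 1 / \<tau>\<^sup>2 * norm (Complex \<tau> y - Complex \<tau> 0)"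
  proof (rule field_differentiable_bound[where S = "{s. Re s \<le> \<tau>} \<inter> {s. Re s \<ge> \<tau>}"])
    show "convex ({s. Re s \<le> \<tau>} \<inter> {s. Re s \<ge> \<tau>})"
      by (intro convex_Int convex_halfspace_Re_le convex_halfspace_Re_ge)
    fix s :: complex assume "s \<in> {s. Re s \<le> \<tau>} \<inter> {s. Re s \<ge> \<tau>}"
    then have s: "Re s = \<tau>" by simp
    show "((\<lambda>x. 1 / (exp x - 1)) has_field_derivative - (exp s / (exp s - 1)\<^sup>2)) (at s within {s. Re s \<le> \<tau>} \<inter> {s. Re s \<ge> \<tau>})"
      by (rule has_field_derivative_bose) (use s assms in simp)
    show "norm (- (exp s / (exp s - 1)\<^sup>2)) \<le> 1 / \<tau>\<^sup>2"
      using norm_bose_deriv_le[of s] s assms by simp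
  qed auto
  moreover have "norm (Complex \<tau> y - Complex \<tau> 0) = \<bar>y\<bar>" by (simp add: cmod_def)
  moreover have "Complex \<tau> 0 = of_real \<tau>" by (simp add: complex_of_real_def)
  ultimately show ?thesis by simp
qed

lemma sin_ge_third:
  fixes x :: real
  assumes "0 \<le> x" "x \<le> 2"
  shows "x / 3 \<le> sin x"
proof -
  have "\<bar>sin x - (\<Sum>m<3. sin_coeff m * x ^ m)\<bar> \<le> inverse (fact 3) * \<bar>x\<bar> ^ 3"
    by (rule Maclaurin_sin_bound)
  moreover have "(\<Sum>m<3. sin_coeff m * x ^ m) = x"
    by (simp add: eval_nat_numeral sin_coeff_def)
  ultimately have "\<bar>sin x - x\<bar> \<le> x ^ 3 / 6"
    using assms by (simp add: fact_numeral eval_nat_numeral)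
  moreover have "x ^ 3 \<le> 4 * x"
  proof -
    have "x * x \<le> 2 * 2" using assms by (intro mult_mono) auto
    then have "x * (x * x) \<le> x * 4" using assms by (intro mult_left_mono) auto
    then show ?thesis by (simp add: power3_eq_cube mult_ac)
  qed
  ultimately show ?thesis by linarith
qed

text \<open>From \<open>1 - cos x = 2 sin^2 (|x| / 2)\<close> and
  \<open>sin (|x| / 2) >= |x| / 6\<close>; here \<open>|x| / 2 <= pi / 2 < 2\<close> lies in the
  range of \<open>sin_ge_third\<close>.\<close>

lemma one_minus_cos_ge:
  fixes x :: real
  assumes "\<bar>x\<bar> \<le> pi"
  shows "x\<^sup>2 / 18 \<le> 1 - cos x"
proof -
  have "\<bar>x\<bar> / 2 / 3 \<le> sin (\<bar>x\<bar> / 2)"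
    using assms pi_less_4 by (intro sin_ge_third) auto
  then have "(\<bar>x\<bar> / 2 / 3)\<^sup>2 \<le> (sin (\<bar>x\<bar> / 2))\<^sup>2" by (intro power_mono) auto
  moreover have "cos x = 1 - 2 * (sin (\<bar>x\<bar> / 2))\<^sup>2"
    using cos_double_sin[of "\<bar>x\<bar> / 2"] by simp
  ultimately show ?thesis by (simp add: power_divide)
qed

text \<open>With \<open>z = \<rho> e^(-iy)\<close> and \<open>D = |1 - z|^2\<close>, the difference
  of real parts is exactly \<open>- (1 + \<rho>) / (2 (1 - \<rho>)) * \<delta> / D\<close>. The
  bound reaches up to \<open>|y| = pi\<close>, so one estimate covers both the neighbourhood of the
  saddle and the rest of the circle.\<close>

lemma Re_bose_diff_le:
  assumes \<tau>: "0 < \<tau>" "exp (- \<tau>) \<ge> 1 / 2" and y: "\<bar>y\<bar> \<le> pi"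
  shows "Re (1 / (exp (Complex \<tau> y) - 1)) - 1 / (exp \<tau> - 1) \<le> - (1 / (2 * \<tau>) * (y\<^sup>2 / (y\<^sup>2 + 18 * \<tau>\<^sup>2)))"
proof -
  define \<rho> where "\<rho> = exp (- \<tau>)"
  define \<delta> where "\<delta> = 2 * \<rho> * (1 - cos y)"
  define D where "D = (1 - \<rho>)\<^sup>2 + \<delta>"
  have \<rho>: "1 / 2 \<le> \<rho>" "\<rho> < 1" using \<tau> by (simp_all add: \<rho>_def)
  have "1 * (1 - cos y) \<le> 2 * \<rho> * (1 - cos y)" using \<rho> by (intro mult_right_mono) auto
  then have \<delta>: "y\<^sup>2 / 18 \<le> \<delta>" using one_minus_cos_ge[OF y] by (simp add: \<delta>_def)
  have \<delta>0: "0 \<le> \<delta>" using \<delta> zero_le_power2[of y] by linarith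
  have D: "0 < D" using \<rho> \<delta>0 by (auto simp: D_def intro!: add_pos_nonneg)
  have \<rho>\<tau>: "1 - \<rho> \<le> \<tau>" using exp_ge_add_one_self[of "- \<tau>"] by (simp add: \<rho>_def)
  have z: "exp (- Complex \<tau> y) = Complex (\<rho> * cos y) (- \<rho> * sin y)"
    by (simp add: complex_eq_iff Re_exp Im_exp \<rho>_def)
  have cs: "(\<rho> * cos y)\<^sup>2 + (\<rho> * sin y)\<^sup>2 = \<rho>\<^sup>2"
    using sin_cos_squared_add[of y] by (simp add: power_mult_distrib distrib_left[symmetric])
  have "(1 - \<rho> * cos y)\<^sup>2 + (\<rho> * sin y)\<^sup>2 = 1 - 2 * \<rho> * cos y + ((\<rho> * cos y)\<^sup>2 + (\<rho> * sin y)\<^sup>2)"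
    by (simp add: power2_eq_square algebra_simps)
  also have "\<dots> = D" unfolding cs by (simp add: D_def \<delta>_def power2_eq_square algebra_simps)
  finally have nD: "(1 - \<rho> * cos y)\<^sup>2 + (\<rho> * sin y)\<^sup>2 = D" .
  have "Re (1 / (exp (Complex \<tau> y) - 1)) = Re (exp (- Complex \<tau> y) / (1 - exp (- Complex \<tau> y)))"
    using geometric_exp_minus[of "Complex \<tau> y"] \<tau> by simp
  also have "\<dots> = (\<rho> * cos y * (1 - \<rho> * cos y) - (\<rho> * sin y)\<^sup>2) / D"
    unfolding z Re_divide using nD by (simp add: power2_eq_square)
  also have "\<rho> * cos y * (1 - \<rho> * cos y) - (\<rho> * sin y)\<^sup>2 = \<rho> * cos y - ((\<rho> * cos y)\<^sup>2 + (\<rho> * sin y)\<^sup>2)"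
    by (simp add: power2_eq_square algebra_simps)
  also have "\<dots> = \<rho> * (1 - \<rho>) - \<delta> / 2"
    unfolding cs by (simp add: \<delta>_def power2_eq_square field_simps)
  finally have 1: "Re (1 / (exp (Complex \<tau> y) - 1)) = (\<rho> * (1 - \<rho>) - \<delta> / 2) / D" .
  have 2: "1 / (exp \<tau> - 1) = \<rho> / (1 - \<rho>)"
    using \<tau> by (simp add: \<rho>_def exp_minus field_simps)
  have "\<rho> / (1 - \<rho>) - (\<rho> * (1 - \<rho>) - \<delta> / 2) / D = (1 + \<rho>) / (2 * (1 - \<rho>)) * (\<delta> / D)"
    using D \<rho> by (simp add: field_simps) (simp add: D_def power2_eq_square algebra_simps)
  moreover have "(1 + \<rho>) / (2 * (1 - \<rho>)) * (\<delta> / D) \<ge> 1 / (2 * \<tau>) * (y\<^sup>2 / (y\<^sup>2 + 18 * \<tau>\<^sup>2))"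
  proof (rule mult_mono)
    show "1 / (2 * \<tau>) \<le> (1 + \<rho>) / (2 * (1 - \<rho>))"
      using \<rho> \<rho>\<tau> by (intro frac_le) auto
    have "D \<le> \<tau>\<^sup>2 + \<delta>" unfolding D_def using \<rho> \<rho>\<tau> by (intro add_right_mono power_mono) auto
    then have "\<delta> / (\<tau>\<^sup>2 + \<delta>) \<le> \<delta> / D" using D \<delta>0 by (intro divide_left_mono) (auto intro!: mult_pos_pos)
    moreover have "y\<^sup>2 / (y\<^sup>2 + 18 * \<tau>\<^sup>2) \<le> \<delta> / (\<tau>\<^sup>2 + \<delta>)"
    proof -
      have p: "0 < y\<^sup>2 + 18 * \<tau>\<^sup>2" "0 < \<tau>\<^sup>2 + \<delta>" using \<tau> \<delta>0 by (intro add_nonneg_pos add_pos_nonneg; simp)+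
      have "y\<^sup>2 * (\<tau>\<^sup>2 + \<delta>) \<le> \<delta> * (y\<^sup>2 + 18 * \<tau>\<^sup>2)"
        using mult_right_mono[OF \<delta>, of "18 * \<tau>\<^sup>2"] by (simp add: algebra_simps)
      then show ?thesis using p by (simp add: frac_le_eq divide_le_eq le_divide_eq mult.commute divide_simps)
    qed
    ultimately show "y\<^sup>2 / (y\<^sup>2 + 18 * \<tau>\<^sup>2) \<le> \<delta> / D" by linarith
    show "0 \<le> (1 + \<rho>) / (2 * (1 - \<rho>))" using \<rho> by simp
  qed auto
  ultimately show ?thesis unfolding 1 2 by linarith
qed

lemma exp_Taylor_near_0:
  fixes x :: complex
  assumes "norm x \<le> 1 / 4"
  shows "norm (exp x - 1 - x) \<le> 2 * norm x ^ 2"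
    and "norm (exp x - 1 - x - x\<^sup>2 / 2) \<le> norm x ^ 3"
    and "norm x / 2 \<le> norm (exp x - 1)"
proof -
  have "\<bar>Re x\<bar> \<le> 1 / 4" using abs_Re_le_cmod[of x] assms by linarith
  then have e: "exp \<bar>Re x\<bar> \<le> 2"
    using exp_bound[of "\<bar>Re x\<bar>"] power_mono[of "\<bar>Re x\<bar>" "1/4" 2] by (simp add: power2_eq_square)
  have "norm (exp x - (\<Sum>k\<le>1. x ^ k / fact k)) \<le> exp \<bar>Re x\<bar> * norm x ^ Suc 1 / fact 1" by (rule Taylor_exp)
  also have "\<dots> \<le> 2 * norm x ^ 2" using e by (auto simp: numeral_2_eq_2 intro!: mult_right_mono)
  also have "exp x - (\<Sum>k\<le>1. x ^ k / fact k) = exp x - 1 - x" by simp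
  finally show 1: "norm (exp x - 1 - x) \<le> 2 * norm x ^ 2" .
  have "norm (exp x - (\<Sum>k\<le>2. x ^ k / fact k)) \<le> exp \<bar>Re x\<bar> * norm x ^ Suc 2 / fact 2" by (rule Taylor_exp)
  also have "\<dots> \<le> 2 * norm x ^ Suc 2 / fact 2" using e by (intro divide_right_mono mult_right_mono) auto
  also have "\<dots> = norm x ^ 3" by (simp add: fact_2 eval_nat_numeral)
  also have "exp x - (\<Sum>k\<le>2. x ^ k / fact k) = exp x - 1 - x - x\<^sup>2 / 2" by (simp add: eval_nat_numeral)
  finally show "norm (exp x - 1 - x - x\<^sup>2 / 2) \<le> norm x ^ 3" .
  have "norm x \<le> norm (exp x - 1) + norm (exp x - 1 - x)"
    using norm_triangle_ineq4[of "exp x - 1" "exp x - 1 - x"] by simp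
  moreover have "2 * norm x ^ 2 \<le> norm x / 2"
    using mult_right_mono[OF assms, of "norm x"] by (simp add: power2_eq_square)
  ultimately show "norm x / 2 \<le> norm (exp x - 1)" using 1 by linarith
qed

section \<open>The Bose function with its pole at 0 removed\<close>

definition bose_reg :: "complex \<Rightarrow> complex" where
  "bose_reg x = 1 / (exp x - 1) - 1 / x"

lemma norm_bose_reg_le:
  assumes "0 < norm x" "norm x \<le> 1 / 4"
  shows "norm (bose_reg x) \<le> 4"
proof -
  note t = exp_Taylor_near_0[OF assms(2)]
  have nz: "x \<noteq> 0" "exp x - 1 \<noteq> 0" using assms t(3) by auto
  then have "bose_reg x = - (exp x - 1 - x) / (x * (exp x - 1))"
    by (simp add: bose_reg_def field_simps)
  then have "norm (bose_reg x) = norm (exp x - 1 - x) / (norm x * norm (exp x - 1))"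
    by (simp add: norm_divide norm_mult norm_minus_commute)
  also have "\<dots> \<le> (2 * norm x ^ 2) / (norm x * (norm x / 2))"
    using assms t by (intro frac_le mult_left_mono) auto
  also have "\<dots> = 4" using assms by (simp add: power2_eq_square)
  finally show ?thesis .
qed

definition bose_reg_deriv :: "complex \<Rightarrow> complex" where
  "bose_reg_deriv x = 1 / x\<^sup>2 - exp x / (exp x - 1)\<^sup>2"

lemma has_field_derivative_bose_reg:
  assumes "0 < Re x"
  shows "(bose_reg has_field_derivative bose_reg_deriv x) (at x within S)"
proof -
  have "x \<noteq> 0" using assms by auto
  then have "((\<lambda>x. 1 / x) has_field_derivative - (1 / x\<^sup>2)) (at x within S)"
    by (auto intro!: derivative_eq_intros simp: power2_eq_square)
  from DERIV_diff[OF has_field_derivative_bose[OF assms] this] show ?thesis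
    unfolding bose_reg_def[abs_def] bose_reg_deriv_def by (simp add: algebra_simps)
qed

lemma norm_bose_reg_deriv_small:
  assumes "0 < norm x" "norm x \<le> 1 / 4"
  shows "norm (bose_reg_deriv x) \<le> 16"
proof -
  note t = exp_Taylor_near_0[OF assms(2)]
  define p where "p = exp x - 1"
  define r where "r = exp x - 1 - x - x\<^sup>2 / 2"
  have p: "p = x + x\<^sup>2 / 2 + r" by (simp add: p_def r_def)
  have nz: "x \<noteq> 0" "p \<noteq> 0" using assms t(3) by (auto simp: p_def)
  \<comment> \<open>As \<open>1 + p = exp x\<close>, this is the numerator of the derivative. Its
    terms of order 2 and 3 cancel, so it is of fourth order like the denominator
    \<open>x^2 p^2\<close>.\<close>
  have "p\<^sup>2 - x\<^sup>2 * (1 + p) = - (x ^ 4) / 4 + 2 * r * x + r\<^sup>2"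
    unfolding p by (simp add: eval_nat_numeral algebra_simps)
  have "norm (p\<^sup>2 - x\<^sup>2 * (1 + p)) \<le> norm x ^ 4 / 4 + 2 * norm r * norm x + norm r ^ 2"
  proof -
    have "norm (- (x ^ 4) / 4 + 2 * r * x + r\<^sup>2) \<le> norm (- (x ^ 4) / 4) + norm (2 * r * x) + norm (r\<^sup>2)"
      by (rule norm_triangle_mono[OF norm_triangle_ineq order_refl])
    then show ?thesis
      using \<open>p\<^sup>2 - x\<^sup>2 * (1 + p) = _\<close> by (simp add: norm_mult norm_power norm_divide)
  qed
  also have "\<dots> \<le> norm x ^ 4 / 4 + 2 * norm x ^ 3 * norm x + (norm x ^ 3) ^ 2"
    using t(2) by (intro add_mono mult_right_mono mult_left_mono power_mono order_refl) (auto simp: r_def)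
  also have "\<dots> \<le> 4 * norm x ^ 4"
  proof -
    have "norm x ^ 6 \<le> norm x ^ 4" using assms by (intro power_decreasing) auto
    moreover have "2 * norm x ^ 3 * norm x = 2 * norm x ^ 4" "(norm x ^ 3)\<^sup>2 = norm x ^ 6"
      by (simp_all add: power_mult[symmetric] eval_nat_numeral)
    moreover have "0 \<le> norm x ^ 4" by simp
    ultimately show ?thesis by linarith
  qed
  finally have num: "norm (p\<^sup>2 - x\<^sup>2 * (1 + p)) \<le> 4 * norm x ^ 4" .
  have "bose_reg_deriv x = (p\<^sup>2 - x\<^sup>2 * (1 + p)) / (x\<^sup>2 * p\<^sup>2)"
    using nz by (simp add: bose_reg_deriv_def p_def field_simps)
  then have "norm (bose_reg_deriv x) = norm (p\<^sup>2 - x\<^sup>2 * (1 + p)) / (norm x ^ 2 * norm p ^ 2)"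
    by (simp add: norm_divide norm_mult norm_power)
  also have "\<dots> \<le> (4 * norm x ^ 4) / (norm x ^ 2 * (norm x / 2) ^ 2)"
    using assms t(3) num by (intro frac_le mult_left_mono power_mono) (auto simp: p_def)
  also have "\<dots> = 16" using assms by (simp add: eval_nat_numeral)
  finally show ?thesis .
qed

text \<open>Any exponent strictly between 1 and 3/2 would serve instead of 5/4: above 1 the sum over
  multiples of \<open>x\<close> converges, and below 3/2 the resulting error \<open>|\<phi>| \<tau>\<^bsup>-5/4\<^esup>\<close> vanishes for
  \<open>|\<phi>| \<approx> n\<^bsup>-3/4\<^esup>\<close> and \<open>\<tau> \<approx> n\<^bsup>-1/2\<^esup>\<close>.\<close>

lemma norm_bose_reg_deriv_le:
  assumes x: "0 < Re x" "\<bar>Im x\<bar> \<le> Re x"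
  shows "norm (bose_reg_deriv x) \<le> 16 * Re x powr (- (5 / 4))"
proof (cases "norm x \<le> 1 / 4")
  case True
  have "0 < norm x" using x by auto
  then have "norm (bose_reg_deriv x) \<le> 16" using True by (rule norm_bose_reg_deriv_small)
  moreover have "1 \<le> Re x powr (- (5 / 4))"
  proof -
    have "Re x \<le> 1" using complex_Re_le_cmod[of x] True by linarith
    then have "1 powr (- (5/4)) \<le> Re x powr (- (5 / 4))"
      using x(1) by (intro powr_mono2') simp_all
    then show ?thesis by (simp only: powr_one_eq_one)
  qed
  ultimately show ?thesis by simp
next
  case False
  have "norm x \<le> \<bar>Re x\<bar> + \<bar>Im x\<bar>" by (rule cmod_le)
  \<comment> \<open>Inside the cone the real part carries at least half of the norm; away from 0,
    surplus negative powers of \<open>Re x\<close> are therefore bounded by constants.\<close>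
  then have a: "1 / 8 \<le> Re x" using x False by linarith
  have "norm (1 / x\<^sup>2) \<le> 1 / (Re x)\<^sup>2"
    using x complex_Re_le_cmod[of x] by (simp add: norm_divide norm_power frac_le power_mono)
  then have "norm (bose_reg_deriv x) \<le> 2 * (1 / (Re x)\<^sup>2)"
    using norm_bose_deriv_le[OF x(1)] norm_triangle_ineq4[of "1 / x\<^sup>2" "exp x / (exp x - 1)\<^sup>2"]
    unfolding bose_reg_deriv_def by linarith
  also have "1 / (Re x)\<^sup>2 = Re x powr (- (3 / 4)) * Re x powr (- (5 / 4))"
  proof -
    have "Re x powr (- (3 / 4)) * Re x powr (- (5 / 4)) = Re x powr (- 2)" by (simp flip: powr_add)
    also have "\<dots> = 1 / (Re x)\<^sup>2" using x(1) by (simp add: powr_minus_divide)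
    finally show ?thesis by simp
  qed
  also have "2 * \<dots> \<le> 2 * (8 * Re x powr (- (5 / 4)))"
  proof (intro mult_left_mono mult_right_mono)
    have "Re x powr (- (3 / 4)) \<le> (1 / 8) powr (- (3 / 4))" using a by (intro powr_mono2') simp_all
    also have "\<dots> \<le> (1 / 8) powr (- 1)" by (rule powr_mono') simp_all
    also have "\<dots> = 8" by (simp add: powr_minus)
    finally show "Re x powr (- (3 / 4)) \<le> 8" .
  qed auto
  finally show ?thesis by simp
qed

lemma norm_bose_reg_diff_le:
  assumes "0 < a" "\<bar>y\<bar> \<le> a"
  shows "norm (bose_reg (Complex a y) - bose_reg (of_real a)) \<le> 16 * a powr (- (5 / 4)) * \<bar>y\<bar>"
proof -
  define S where "S = {s. Re s \<le> a} \<inter> {s. Re s \<ge> a} \<inter> {s. Im s \<le> a} \<inter> {s. Im s \<ge> - a}"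
  have "norm (bose_reg (Complex a y) - bose_reg (Complex a 0)) \<le> 16 * a powr (- (5 / 4)) * norm (Complex a y - Complex a 0)"
  proof (rule field_differentiable_bound[where S = S])
    show "convex S" unfolding S_def
      by (intro convex_Int convex_halfspace_Re_le convex_halfspace_Re_ge convex_halfspace_Im_le convex_halfspace_Im_ge)
    fix s :: complex assume "s \<in> S"
    then have s: "Re s = a" "\<bar>Im s\<bar> \<le> a" by (auto simp: S_def)
    show "(bose_reg has_field_derivative bose_reg_deriv s) (at s within S)"
      by (rule has_field_derivative_bose_reg) (use s assms in simp)
    show "norm (bose_reg_deriv s) \<le> 16 * a powr (- (5 / 4))"
      using norm_bose_reg_deriv_le[of s] s assms by simp
  qed (use assms in \<open>auto simp: S_def\<close>)
  moreover have "norm (Complex a y - Complex a 0) = \<bar>y\<bar>" by (simp add: cmod_def)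
  moreover have "Complex a 0 = of_real a" by (simp add: complex_of_real_def)
  ultimately show ?thesis by simp
qed

text \<open>The poles \<open>1 / (k s)\<close>, weighted by \<open>1 / k\<close>, add up to
  \<open>zeta(2) / s\<close>, the source of \<open>pi^2 / 6\<close>. The regularised function in
  term \<open>k\<close> changes by at most \<open>16 (k \<tau>)^(-5/4) k |y|\<close>; after division
  by \<open>k\<close> the sum converges to a multiple of \<open>\<tau>^(-5/4) |y|\<close>.\<close>

lemma partition_log_diff_estimate:
  "\<exists>C. \<forall>\<tau>>0. \<forall>y. \<bar>y\<bar> \<le> \<tau> \<longrightarrow>
     norm (partition_log (Complex \<tau> y) - partition_log (of_real \<tau>) - of_real (pi\<^sup>2 / 6) * (1 / Complex \<tau> y - 1 / of_real \<tau>))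
       \<le> C * \<bar>y\<bar> * \<tau> powr (- (5 / 4))"
proof -
  define Z where "Z = (\<lambda>k::nat. real (Suc k) powr (- (5 / 4)))"
  have Z: "summable Z"
    unfolding Z_def by (subst summable_Suc_iff) (simp add: summable_real_powr_iff)
  have "norm (partition_log (Complex \<tau> y) - partition_log (of_real \<tau>) - of_real (pi\<^sup>2 / 6) * (1 / Complex \<tau> y - 1 / of_real \<tau>))
       \<le> (16 * suminf Z) * \<bar>y\<bar> * \<tau> powr (- (5 / 4))" if \<tau>: "0 < \<tau>" and y: "\<bar>y\<bar> \<le> \<tau>" for \<tau> y
  proof -
    define s where "s = Complex \<tau> y"
    define g where "g = (\<lambda>k w. 1 / (of_nat (Suc k) * (exp (of_nat (Suc k) * w) - 1)) :: complex)"
    define d where "d = (\<lambda>k. (bose_reg (of_nat (Suc k) * s) - bose_reg (of_nat (Suc k) * of_real \<tau>)) / of_nat (Suc k))"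
    have sRe: "0 < Re s" "0 < Re (of_real \<tau>)" using \<tau> by (simp_all add: s_def)
    have nz: "s \<noteq> 0" "complex_of_real \<tau> \<noteq> 0" using sRe by auto
    have "(\<lambda>k. g k w) sums partition_log w" if "0 < Re w" for w
      unfolding g_def partition_log_def
      by (rule summable_sums[OF summable_norm_cancel[OF distinct_gf_1_eq_exp(2)[OF that]]])
    from sums_diff[OF this[OF sRe(1)] this[OF sRe(2)]]
    have s1: "(\<lambda>k. g k s - g k (of_real \<tau>)) sums (partition_log s - partition_log (of_real \<tau>))" .
    have "(\<lambda>n. complex_of_real (1 / real ((n + 1)\<^sup>2))) sums of_real (pi\<^sup>2 / 6)"
      using inverse_squares_sums by (rule sums_of_real)
    moreover have "real ((n + 1)\<^sup>2) = (real n + 1)\<^sup>2" for n by simp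
    ultimately have "(\<lambda>n. complex_of_real (1 / (real n + 1)\<^sup>2)) sums of_real (pi\<^sup>2 / 6)" by (simp only:)
    then have s2: "(\<lambda>n. of_real (1 / (real n + 1)\<^sup>2) * (1 / s - 1 / of_real \<tau>)) sums (of_real (pi\<^sup>2 / 6) * (1 / s - 1 / of_real \<tau>))"
      by (rule sums_mult2)
    have d_eq: "g k s - g k (of_real \<tau>) - of_real (1 / (real k + 1)\<^sup>2) * (1 / s - 1 / of_real \<tau>) = d k" for k
    proof -
      have c: "of_real (1 / (real k + 1)\<^sup>2) = (1 / (of_nat (Suc k) * of_nat (Suc k)) :: complex)"
        by (simp add: power2_eq_square add.commute)
      have h: "bose_reg (of_nat (Suc k) * w) / of_nat (Suc k) = g k w - 1 / (of_nat (Suc k) * of_nat (Suc k)) * (1 / w)" for w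
        by (simp add: g_def bose_reg_def diff_divide_distrib mult_ac del: of_nat_Suc)
      show ?thesis
        unfolding d_def diff_divide_distrib h c by (simp only: right_diff_distrib) simp
    qed
    have ds: "d sums (partition_log s - partition_log (of_real \<tau>) - of_real (pi\<^sup>2 / 6) * (1 / s - 1 / of_real \<tau>))"
      using sums_diff[OF s1 s2] unfolding d_eq .
    have le: "norm (d k) \<le> 16 * \<bar>y\<bar> * \<tau> powr (- (5 / 4)) * Z k" for k
    proof -
      have 1: "of_nat (Suc k) * s = Complex (real (Suc k) * \<tau>) (real (Suc k) * y)"
        by (simp add: s_def complex_eq_iff)
      have 2: "of_nat (Suc k) * complex_of_real \<tau> = of_real (real (Suc k) * \<tau>)" by simp
      have "norm (bose_reg (of_nat (Suc k) * s) - bose_reg (of_nat (Suc k) * of_real \<tau>))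
        \<le> 16 * (real (Suc k) * \<tau>) powr (- (5 / 4)) * \<bar>real (Suc k) * y\<bar>"
        unfolding 1 2 by (rule norm_bose_reg_diff_le) (use \<tau> y in \<open>auto simp: abs_mult intro!: mult_left_mono\<close>)
      then have "norm (d k) \<le> 16 * (real (Suc k) * \<tau>) powr (- (5 / 4)) * \<bar>real (Suc k) * y\<bar> / real (Suc k)"
        unfolding d_def norm_divide norm_of_nat by (rule divide_right_mono) simp
      also have "\<dots> = 16 * \<bar>y\<bar> * \<tau> powr (- (5 / 4)) * Z k"
        using \<tau> by (simp add: Z_def powr_mult abs_mult del: of_nat_Suc)
      finally show ?thesis .
    qed
    have Zs: "(\<lambda>k. 16 * \<bar>y\<bar> * \<tau> powr (- (5 / 4)) * Z k) sums (16 * \<bar>y\<bar> * \<tau> powr (- (5 / 4)) * suminf Z)"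
      by (intro sums_mult summable_sums Z)
    have "norm (suminf d) \<le> 16 * \<bar>y\<bar> * \<tau> powr (- (5 / 4)) * suminf Z"
      unfolding sums_unique[OF Zs] by (rule norm_suminf_le) (use le sums_summable[OF Zs] in auto)
    then show ?thesis using sums_unique[OF ds] by (simp add: s_def mult_ac)
  qed
  then show ?thesis by blast
qed

text \<open>Every term of the series contributes a nonpositive difference, so the first one is an upper bound.\<close>

lemma Re_partition_log_diff_le:
  assumes "0 < \<tau>"
  shows "Re (partition_log (Complex \<tau> y)) - Re (partition_log (of_real \<tau>)) \<le> Re (1 / (exp (Complex \<tau> y) - 1)) - 1 / (exp \<tau> - 1)"
proof -
  define g where "g = (\<lambda>k w. 1 / (of_nat (Suc k) * (exp (of_nat (Suc k) * w) - 1)) :: complex)"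
  define d where "d = (\<lambda>k. Re (g k (Complex \<tau> y)) - Re (g k (of_real \<tau>)))"
  have "(\<lambda>k. Re (g k w)) sums Re (partition_log w)" if "0 < Re w" for w
    unfolding g_def partition_log_def
    by (intro sums_Re summable_sums[OF summable_norm_cancel[OF distinct_gf_1_eq_exp(2)[OF that]]])
  from sums_diff[OF this[of "Complex \<tau> y"] this[of "of_real \<tau>"]]
  have ds: "d sums (Re (partition_log (Complex \<tau> y)) - Re (partition_log (of_real \<tau>)))"
    using assms by (simp add: d_def)
  have real: "Re (g k (of_real \<tau>)) = 1 / (real (Suc k) * (exp (real (Suc k) * \<tau>) - 1))" for k
  proof -
    have "g k (of_real \<tau>) = of_real (1 / (real (Suc k) * (exp (real (Suc k) * \<tau>) - 1)))"
      by (simp add: g_def exp_of_real[symmetric])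
    then show ?thesis by simp
  qed
  have "d k \<le> 0" for k
  proof -
    have Re: "Re (of_nat (Suc k) * Complex \<tau> y) = real (Suc k) * \<tau>" by simp
    have pos: "0 < exp (real (Suc k) * \<tau>) - 1" using assms by simp
    \<comment> \<open>On a vertical line \<open>|exp s - 1|\<close> is least at the real point, so
      the modulus there is the largest.\<close>
    have "Re (g k (Complex \<tau> y)) \<le> norm (g k (Complex \<tau> y))" by (rule complex_Re_le_cmod)
    also have "\<dots> = 1 / (real (Suc k) * norm (exp (of_nat (Suc k) * Complex \<tau> y) - 1))"
      by (simp add: g_def norm_divide norm_mult del: of_nat_Suc)
    also have "\<dots> \<le> 1 / (real (Suc k) * (exp (real (Suc k) * \<tau>) - 1))"
      using norm_exp_minus_1_ge[of "of_nat (Suc k) * Complex \<tau> y"] pos unfolding Re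
      by (intro divide_left_mono mult_left_mono mult_pos_pos) auto
    finally show ?thesis by (simp add: d_def real)
  qed
  note d_le = this
  have "(\<lambda>k. - d (Suc k)) sums (- (suminf d - d 0))"
    by (intro sums_minus sums_Suc_iff[THEN iffD2]) (use summable_sums[OF sums_summable[OF ds]] in simp)
  then have "0 \<le> - (suminf d - d 0)"
    unfolding sums_unique[OF \<open>(\<lambda>k. - d (Suc k)) sums _\<close>]
    by (intro suminf_nonneg sums_summable[OF \<open>(\<lambda>k. - d (Suc k)) sums _\<close>]) (simp add: d_le)
  then have "suminf d \<le> d 0" by simp
  moreover have "d 0 = Re (1 / (exp (Complex \<tau> y) - 1)) - 1 / (exp \<tau> - 1)"
    unfolding d_def real by (simp add: g_def)
  ultimately show ?thesis using sums_unique[OF ds] by simp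
qed

section \<open>The saddle point expansion\<close>

text \<open>Everything is parametrised by \<open>r = n\<^bsup>1/4\<^esup>\<close>: the radius is \<open>exp (-\<tau>)\<close> with
  \<open>\<tau> = saddle_const / r\<^sup>2\<close>, the angle is \<open>u / r\<^sup>3\<close>, and the mark is \<open>T = exp (w / r)\<close>.\<close>

definition saddle_const :: real where "saddle_const = pi / sqrt 6"

lemma saddle_const_pos [simp]: "0 < saddle_const"
  by (simp add: saddle_const_def)

text \<open>This is the saddle point equation: for \<open>\<tau> = saddle_const / r^2\<close> and
  \<open>n = r^4\<close> it says \<open>pi^2 / (6 \<tau>^2) = n\<close>, which makes
  \<open>pi^2 / (6 \<tau>) + n \<tau>\<close> stationary.\<close>

lemma saddle_const_square: "saddle_const\<^sup>2 = pi\<^sup>2 / 6"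
  by (simp add: saddle_const_def power_divide)

definition saddle :: "real \<Rightarrow> real \<Rightarrow> complex" where
  "saddle r u = Complex (saddle_const / r\<^sup>2) (- (u / r ^ 3))"

text \<open>Normalised to vanish at \<open>u = 0\<close>. The phase \<open>i r u\<close> is
  \<open>i n x\<close> for the angle \<open>x = u / r^3\<close> and \<open>n = r^4\<close>.\<close>

definition partition_exponent :: "real \<Rightarrow> real \<Rightarrow> complex" where
  "partition_exponent r u = partition_log (saddle r u) - partition_log (of_real (saddle_const / r\<^sup>2)) - \<i> * of_real (r * u)"

text \<open>The subtracted term centres the hook count at
  \<open>r^2 / saddle_const = sqrt (6 n) / pi\<close>, measured in units of
  \<open>r\<close>.\<close>

definition marked_exponent :: "nat \<Rightarrow> complex \<Rightarrow> real \<Rightarrow> real \<Rightarrow> complex" where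
  "marked_exponent t w r u = of_nat t * marked_log (exp (w / of_real r) - 1) (of_nat t * saddle r u) - w * of_real r / of_real saddle_const"

definition scaled_saddle :: "real \<Rightarrow> real \<Rightarrow> complex" where
  "scaled_saddle r u = of_real saddle_const - \<i> * of_real (u / r)"

lemma scaled_saddle_nonzero: "scaled_saddle r u \<noteq> 0"
proof
  assume "scaled_saddle r u = 0"
  then have "Re (scaled_saddle r u) = 0" by simp
  then show False using saddle_const_pos by (simp add: scaled_saddle_def del: saddle_const_pos)
qed

lemma saddle_eq_scaled: "0 < r \<Longrightarrow> saddle r u = scaled_saddle r u / of_real (r\<^sup>2)"
  by (simp add: complex_eq_iff saddle_def scaled_saddle_def Re_divide_of_real Im_divide_of_real power2_eq_square power3_eq_cube)

lemma scaled_saddle_tendsto: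
  assumes "filterlim r at_top F"
  shows "((\<lambda>n. scaled_saddle (r n) u) \<longlongrightarrow> of_real saddle_const) F"
proof -
  have "((\<lambda>n. u / r n) \<longlongrightarrow> 0) F" by (intro real_tendsto_divide_at_top[OF tendsto_const assms])
  then have "((\<lambda>n. of_real saddle_const - \<i> * of_real (u / r n)) \<longlongrightarrow> of_real saddle_const - \<i> * of_real 0) F"
    by (intro tendsto_intros)
  then show ?thesis by (simp add: scaled_saddle_def)
qed

text \<open>By the saddle point equation the first-order part of \<open>pi^2 / (6 s)\<close> cancels
  the phase and leaves exactly \<open>- u^2 / scaled_saddle r u\<close>. The error of
  \<open>partition_log_diff_estimate\<close> has order
  \<open>r^(-3) r^(5/2) = r^(-1/2)\<close>.\<close>

lemma partition_exponent_tendsto: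
  assumes r: "filterlim r at_top F"
  shows "((\<lambda>n. partition_exponent (r n) u) \<longlongrightarrow> - of_real (u\<^sup>2 / saddle_const)) F"
proof -
  obtain C where C: "\<And>\<tau> y. 0 < \<tau> \<Longrightarrow> \<bar>y\<bar> \<le> \<tau> \<Longrightarrow>
     norm (partition_log (Complex \<tau> y) - partition_log (of_real \<tau>) - of_real (pi\<^sup>2 / 6) * (1 / Complex \<tau> y - 1 / of_real \<tau>))
       \<le> C * \<bar>y\<bar> * \<tau> powr (- (5 / 4))"
    using partition_log_diff_estimate by blast
  have alg: "of_real (pi\<^sup>2 / 6) * (1 / saddle r u - 1 / of_real (saddle_const / r\<^sup>2)) - \<i> * of_real (r * u)
    = - (of_real (u\<^sup>2) / scaled_saddle r u)" if "0 < r" for r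
  proof -
    define S where "S = scaled_saddle r u"
    define b where "b = complex_of_real saddle_const"
    have b: "b \<noteq> 0" using saddle_const_pos by (simp add: b_def del: saddle_const_pos)
    have S0: "S \<noteq> 0" by (simp add: S_def scaled_saddle_nonzero)
    have Sb: "b - S = \<i> * of_real (u / r)" by (simp add: S_def b_def scaled_saddle_def)
    have "of_real (pi\<^sup>2 / 6) = b\<^sup>2" unfolding b_def of_real_power[symmetric] saddle_const_square ..
    moreover have "1 / saddle r u = of_real (r\<^sup>2) / S" using that by (simp add: saddle_eq_scaled S_def)
    moreover have "1 / complex_of_real (saddle_const / r\<^sup>2) = of_real (r\<^sup>2) / b" by (simp add: b_def)
    ultimately have "of_real (pi\<^sup>2 / 6) * (1 / saddle r u - 1 / of_real (saddle_const / r\<^sup>2)) = b\<^sup>2 * (of_real (r\<^sup>2) / S - of_real (r\<^sup>2) / b)"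
      by (simp only:)
    also have "\<dots> = of_real (r\<^sup>2) * (b * (b - S) / S)"
      using b S0 by (simp add: field_simps power2_eq_square)
    also have "\<dots> = \<i> * of_real (r * u) * b / S"
      unfolding Sb using that by (simp add: field_simps power2_eq_square)
    finally have "of_real (pi\<^sup>2 / 6) * (1 / saddle r u - 1 / of_real (saddle_const / r\<^sup>2)) - \<i> * of_real (r * u) = \<i> * of_real (r * u) * (b - S) / S"
      using S0 by (simp add: field_simps)
    also have "\<dots> = - (of_real (u\<^sup>2) / S)"
      unfolding Sb using that by (simp add: field_simps power2_eq_square)
    finally show ?thesis unfolding S_def .
  qed
  have ev: "\<forall>\<^sub>F n in F. norm (partition_exponent (r n) u + of_real (u\<^sup>2) / scaled_saddle (r n) u)
      \<le> C * \<bar>u\<bar> / r n ^ 3 * (saddle_const / (r n)\<^sup>2) powr (- (5 / 4))"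
    using filterlim_at_top_dense[THEN iffD1, OF r, rule_format, of 0] filterlim_at_top[THEN iffD1, OF r, rule_format, of "\<bar>u\<bar> / saddle_const"]
  proof eventually_elim
    case (elim n)
    define \<tau> where "\<tau> = saddle_const / (r n)\<^sup>2"
    have \<tau>: "0 < \<tau>" using elim by (simp add: \<tau>_def)
    \<comment> \<open>This places the angle in the cone \<open>|y| <= \<tau>\<close> on which the
      estimate holds.\<close>
    have "\<bar>u\<bar> \<le> saddle_const * r n" using elim(2) by (simp add: divide_le_eq mult.commute)
    then have "\<bar>u\<bar> / r n ^ 3 \<le> (saddle_const * r n) / r n ^ 3" using elim by (intro divide_right_mono) auto
    also have "\<dots> = \<tau>" using elim by (simp add: \<tau>_def power2_eq_square power3_eq_cube)
    finally have y: "\<bar>- (u / r n ^ 3)\<bar> \<le> \<tau>" using elim by simp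
    have "partition_exponent (r n) u + of_real (u\<^sup>2) / scaled_saddle (r n) u =
      partition_log (saddle (r n) u) - partition_log (of_real \<tau>) - of_real (pi\<^sup>2 / 6) * (1 / saddle (r n) u - 1 / of_real \<tau>)"
      using alg[OF elim(1)] unfolding partition_exponent_def \<tau>_def by (simp add: algebra_simps)
    then show ?case
      using C[OF \<tau> y] elim by (simp add: saddle_def \<tau>_def[symmetric])
  qed
  have "((\<lambda>r. C * \<bar>u\<bar> / r ^ 3 * (saddle_const / r\<^sup>2) powr (- (5 / 4))) \<longlongrightarrow> 0) at_top"
    using saddle_const_pos by real_asymp
  then have "((\<lambda>n. C * \<bar>u\<bar> / r n ^ 3 * (saddle_const / (r n)\<^sup>2) powr (- (5 / 4))) \<longlongrightarrow> 0) F"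
    by (rule filterlim_compose[OF _ r])
  from Lim_null_comparison[OF ev this]
  have "((\<lambda>n. partition_exponent (r n) u + of_real (u\<^sup>2) / scaled_saddle (r n) u) \<longlongrightarrow> 0) F" .
  moreover have "((\<lambda>n. of_real (u\<^sup>2) / scaled_saddle (r n) u) \<longlongrightarrow> of_real (u\<^sup>2) / of_real saddle_const) F"
    using saddle_const_pos by (intro tendsto_intros scaled_saddle_tendsto[OF r]) (simp del: saddle_const_pos)
  ultimately have "((\<lambda>n. partition_exponent (r n) u + of_real (u\<^sup>2) / scaled_saddle (r n) u - of_real (u\<^sup>2) / scaled_saddle (r n) u)
     \<longlongrightarrow> 0 - of_real (u\<^sup>2) / of_real saddle_const) F" by (rule tendsto_diff)
  then show ?thesis by simp
qed

text \<open>Writing each Bose function as pole plus \<open>bose_reg\<close> isolates what vanishes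
  in the limit: the cubic remainder and the two \<open>bose_reg\<close> terms. The last three terms
  tend to \<open>w^2 / (2 b)\<close>, \<open>- w^2 / (4 b)\<close> and \<open>i w u / b^2\<close>
  with \<open>b = saddle_const\<close>; the factor \<open>t\<close> has cancelled against the pole
  at \<open>t * saddle r u\<close>.\<close>

lemma marked_exponent_decomp:
  fixes w :: complex and r u :: real and t :: nat
  assumes t: "0 < t" and r: "0 < r"
  defines "x \<equiv> exp (w / of_real r) - 1" and "s \<equiv> of_nat t * saddle r u" and "S \<equiv> scaled_saddle r u"
  shows "marked_exponent t w r u =
     of_nat t * (marked_log x s - x / (exp s - 1) + x\<^sup>2 / (2 * (exp (2 * s) - 1)))
     + of_nat t * x * bose_reg s - of_nat t * x\<^sup>2 * bose_reg (2 * s) / 2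
     + (x - w / of_real r) * of_real (r\<^sup>2) / S - (x * of_real r)\<^sup>2 / (4 * S) + \<i> * w * of_real u / (S * of_real saddle_const)"
proof -
  define b where "b = complex_of_real saddle_const"
  define R where "R = complex_of_real r"
  have nz: "S \<noteq> 0" "b \<noteq> 0" "R \<noteq> 0" "of_nat t \<noteq> (0::complex)"
    using saddle_const_pos r t by (simp_all add: S_def b_def R_def scaled_saddle_nonzero del: saddle_const_pos)
  have s: "s = of_nat t * S / R\<^sup>2" using r by (simp add: s_def S_def R_def saddle_eq_scaled)
  have b1: "1 / (exp s - 1) = bose_reg s + R\<^sup>2 / (of_nat t * S)"
    by (simp add: bose_reg_def s)
  have b2: "1 / (exp (2 * s) - 1) = bose_reg (2 * s) + R\<^sup>2 / (2 * of_nat t * S)"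
    by (simp add: bose_reg_def) (simp add: s)
  have u: "\<i> * of_real u = R * (b - S)"
    using r by (simp add: R_def b_def S_def scaled_saddle_def)
  have 1: "of_nat t * (x / (exp s - 1)) = of_nat t * x * bose_reg s + x * R\<^sup>2 / S"
    using nz by (simp add: divide_inverse b1[unfolded divide_inverse mult_1_left] algebra_simps)
  have 2: "of_nat t * (x\<^sup>2 / (2 * (exp (2 * s) - 1))) = of_nat t * x\<^sup>2 * bose_reg (2 * s) / 2 + x\<^sup>2 * R\<^sup>2 / (4 * S)"
  proof -
    have "of_nat t * (x\<^sup>2 / (2 * (exp (2 * s) - 1))) = of_nat t * x\<^sup>2 / 2 * (1 / (exp (2 * s) - 1))" by simp
    then show ?thesis unfolding b2 using nz by (simp add: field_simps)
  qed
  have "x * R\<^sup>2 / S - w * R / b = (x - w / R) * R\<^sup>2 / S + w * (R * (b - S)) / (S * b)"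
    using nz by (simp add: field_simps power2_eq_square)
  also have "w * (R * (b - S)) = \<i> * w * of_real u" unfolding u[symmetric] by simp
  finally have 3: "x * R\<^sup>2 / S - w * R / b = (x - w / R) * R\<^sup>2 / S + \<i> * w * of_real u / (S * b)" .
  have "marked_exponent t w r u = of_nat t * marked_log x s - w * R / b"
    by (simp add: marked_exponent_def x_def s_def R_def b_def)
  also have "\<dots> = of_nat t * (marked_log x s - x / (exp s - 1) + x\<^sup>2 / (2 * (exp (2 * s) - 1)))
     + of_nat t * (x / (exp s - 1)) - of_nat t * (x\<^sup>2 / (2 * (exp (2 * s) - 1))) - w * R / b"
    by (simp add: algebra_simps)
  also have "\<dots> = of_nat t * (marked_log x s - x / (exp s - 1) + x\<^sup>2 / (2 * (exp (2 * s) - 1)))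
     + of_nat t * x * bose_reg s - of_nat t * x\<^sup>2 * bose_reg (2 * s) / 2 + (x * R\<^sup>2 / S - w * R / b) - x\<^sup>2 * R\<^sup>2 / (4 * S)"
    unfolding 1 2 by (simp add: algebra_simps)
  finally show ?thesis
    unfolding 3 by (simp add: R_def b_def power_mult_distrib)
qed

text \<open>The mark may depend on the index because later it is \<open>i s\<close> divided by the
  standard deviation of the centred count, which only converges.\<close>

lemma exp_minus_1_scaled_tendsto:
  fixes w :: "'a \<Rightarrow> complex"
  assumes r: "filterlim r at_top F" and w: "(w \<longlongrightarrow> w0) F"
  shows "((\<lambda>n. (exp (w n / of_real (r n)) - 1) * of_real (r n)) \<longlongrightarrow> w0) F"
    and "((\<lambda>n. (exp (w n / of_real (r n)) - 1 - w n / of_real (r n)) * of_real ((r n)\<^sup>2)) \<longlongrightarrow> w0\<^sup>2 / 2) F"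
    and "((\<lambda>n. exp (w n / of_real (r n)) - 1) \<longlongrightarrow> 0) F"
    and "((\<lambda>n. w n / of_real (r n)) \<longlongrightarrow> 0) F"
proof -
  define v where "v = (\<lambda>n. w n / of_real (r n))"
  have ri: "((\<lambda>n. 1 / r n) \<longlongrightarrow> 0) F" by (intro real_tendsto_divide_at_top[OF tendsto_const r])
  then have "((\<lambda>n. w n * of_real (1 / r n)) \<longlongrightarrow> w0 * of_real 0) F" by (intro tendsto_intros w)
  then have v: "(v \<longlongrightarrow> 0) F" by (simp add: v_def)
  then show "((\<lambda>n. w n / of_real (r n)) \<longlongrightarrow> 0) F" by (simp add: v_def)
  have "((\<lambda>n. exp (v n) - 1) \<longlongrightarrow> exp 0 - 1) F" by (intro tendsto_intros v)
  then show "((\<lambda>n. exp (w n / of_real (r n)) - 1) \<longlongrightarrow> 0) F" by (simp add: v_def)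
  have small: "\<forall>\<^sub>F n in F. norm (v n) \<le> 1 / 4"
    using tendstoD[OF v, of "1/4"] by (auto elim: eventually_mono)
  have pos: "\<forall>\<^sub>F n in F. 0 < r n" using filterlim_at_top_dense[THEN iffD1, OF r] by blast
  have "((\<lambda>n. (exp (v n) - 1) * of_real (r n) - w n) \<longlongrightarrow> 0) F"
  proof (rule Lim_null_comparison)
    show "\<forall>\<^sub>F n in F. norm ((exp (v n) - 1) * of_real (r n) - w n) \<le> 2 * norm (w n) ^ 2 * (1 / r n)"
      using small pos
    proof eventually_elim
      case (elim n)
      have "(exp (v n) - 1) * of_real (r n) - w n = (exp (v n) - 1 - v n) * of_real (r n)"
        using elim by (simp add: v_def algebra_simps)
      then have "norm ((exp (v n) - 1) * of_real (r n) - w n) \<le> 2 * norm (v n) ^ 2 * r n"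
        using exp_Taylor_near_0(1)[OF elim(1)] elim by (simp add: norm_mult mult_right_mono)
      also have "\<dots> = 2 * norm (w n) ^ 2 * (1 / r n)"
        using elim by (simp add: v_def norm_divide power_divide power2_eq_square)
      finally show ?case .
    qed
    have "((\<lambda>n. 2 * norm (w n) ^ 2 * (1 / r n)) \<longlongrightarrow> 2 * norm w0 ^ 2 * 0) F" by (intro tendsto_intros w ri)
    then show "((\<lambda>n. 2 * norm (w n) ^ 2 * (1 / r n)) \<longlongrightarrow> 0) F" by simp
  qed
  from tendsto_add[OF this w] show "((\<lambda>n. (exp (w n / of_real (r n)) - 1) * of_real (r n)) \<longlongrightarrow> w0) F"
    by (simp add: v_def)
  have "((\<lambda>n. (exp (v n) - 1 - v n) * of_real ((r n)\<^sup>2) - (w n)\<^sup>2 / 2) \<longlongrightarrow> 0) F"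
  proof (rule Lim_null_comparison)
    show "\<forall>\<^sub>F n in F. norm ((exp (v n) - 1 - v n) * of_real ((r n)\<^sup>2) - (w n)\<^sup>2 / 2) \<le> norm (w n) ^ 3 * (1 / r n)"
      using small pos
    proof eventually_elim
      case (elim n)
      have "(w n)\<^sup>2 = (v n)\<^sup>2 * of_real ((r n)\<^sup>2)" using elim by (simp add: v_def power_divide)
      then have "(exp (v n) - 1 - v n) * of_real ((r n)\<^sup>2) - (w n)\<^sup>2 / 2 = (exp (v n) - 1 - v n - (v n)\<^sup>2 / 2) * of_real ((r n)\<^sup>2)"
        by (simp add: algebra_simps)
      then have "norm ((exp (v n) - 1 - v n) * of_real ((r n)\<^sup>2) - (w n)\<^sup>2 / 2) \<le> norm (v n) ^ 3 * (r n)\<^sup>2"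
        using exp_Taylor_near_0(2)[OF elim(1)] elim by (simp add: norm_mult norm_power mult_right_mono)
      also have "\<dots> = norm (w n) ^ 3 * (1 / r n)"
        using elim by (simp add: v_def norm_divide power_divide power2_eq_square power3_eq_cube)
      finally show ?case .
    qed
    have "((\<lambda>n. norm (w n) ^ 3 * (1 / r n)) \<longlongrightarrow> norm w0 ^ 3 * 0) F" by (intro tendsto_intros w ri)
    then show "((\<lambda>n. norm (w n) ^ 3 * (1 / r n)) \<longlongrightarrow> 0) F" by simp
  qed
  moreover have "((\<lambda>n. (w n)\<^sup>2 / 2) \<longlongrightarrow> w0\<^sup>2 / 2) F" by (intro tendsto_intros w) simp
  ultimately have "((\<lambda>n. (exp (v n) - 1 - v n) * of_real ((r n)\<^sup>2) - (w n)\<^sup>2 / 2 + (w n)\<^sup>2 / 2) \<longlongrightarrow> 0 + w0\<^sup>2 / 2) F"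
    by (rule tendsto_add)
  then show "((\<lambda>n. (exp (w n / of_real (r n)) - 1 - w n / of_real (r n)) * of_real ((r n)\<^sup>2)) \<longlongrightarrow> w0\<^sup>2 / 2) F"
    by (simp add: v_def)
qed

lemma marked_exponent_tendsto:
  assumes t: "0 < t" and r: "filterlim r at_top F" and w: "(w \<longlongrightarrow> w0) F"
  shows "((\<lambda>n. marked_exponent t (w n) (r n) u) \<longlongrightarrow>
     \<i> * w0 * of_real u / of_real (saddle_const\<^sup>2) + w0\<^sup>2 / of_real (4 * saddle_const)) F"
proof -
  define x where "x = (\<lambda>n. exp (w n / of_real (r n)) - 1)"
  define s where "s = (\<lambda>n. of_nat t * saddle (r n) u)"
  define S where "S = (\<lambda>n. scaled_saddle (r n) u)"
  define b where "b = complex_of_real saddle_const"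
  note lims = exp_minus_1_scaled_tendsto[OF r w, folded x_def]
  have x0: "(x \<longlongrightarrow> 0) F" and xr: "((\<lambda>n. x n * of_real (r n)) \<longlongrightarrow> w0) F"
    and xv: "((\<lambda>n. (x n - w n / of_real (r n)) * of_real ((r n)\<^sup>2)) \<longlongrightarrow> w0\<^sup>2 / 2) F"
    using lims by (simp_all add: x_def)
  have S: "(S \<longlongrightarrow> b) F" unfolding S_def b_def by (rule scaled_saddle_tendsto[OF r])
  have b: "b \<noteq> 0" using saddle_const_pos by (simp add: b_def del: saddle_const_pos)
  have pos: "\<forall>\<^sub>F n in F. 0 < r n" using filterlim_at_top_dense[THEN iffD1, OF r] by blast
  have ri: "((\<lambda>n. 1 / r n) \<longlongrightarrow> 0) F" by (intro real_tendsto_divide_at_top[OF tendsto_const r])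
  have "((\<lambda>n. of_nat t * (S n * of_real (1 / r n) * of_real (1 / r n))) \<longlongrightarrow> of_nat t * (b * of_real 0 * of_real 0)) F"
    by (intro tendsto_intros S ri)
  moreover have "\<forall>\<^sub>F n in F. of_nat t * (S n * of_real (1 / r n) * of_real (1 / r n)) = s n"
    using pos by eventually_elim (simp add: s_def S_def saddle_eq_scaled power2_eq_square)
  ultimately have s: "(s \<longlongrightarrow> 0) F" by (simp add: tendsto_cong)
  have s_nz: "\<forall>\<^sub>F n in F. 0 < norm (s n)"
    using pos by eventually_elim (use t in \<open>simp add: s_def saddle_eq_scaled scaled_saddle_nonzero\<close>)
  have reg: "\<forall>\<^sub>F n in F. norm (bose_reg (c * s n)) \<le> 4" if "0 < norm c" for c :: complex
  proof -
    have "((\<lambda>n. c * s n) \<longlongrightarrow> c * 0) F" by (intro tendsto_intros s)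
    then have "\<forall>\<^sub>F n in F. dist (c * s n) 0 < 1 / 4" by (intro tendstoD) auto
    then show ?thesis using s_nz
    proof eventually_elim
      case (elim n)
      then show ?case using that by (intro norm_bose_reg_le) (simp_all add: norm_mult)
    qed
  qed
  have reg2: "\<forall>\<^sub>F n in F. norm (bose_reg (2 * s n)) \<le> 4" by (rule reg) simp
  \<comment> \<open>\<open>x\<close> has order \<open>1 / r\<close> and \<open>1 / Re s\<close> has
    order \<open>r^2\<close>, so the cubic remainder has order \<open>1 / r\<close>.\<close>
  have A: "((\<lambda>n. of_nat t * (marked_log (x n) (s n) - x n / (exp (s n) - 1) + (x n)\<^sup>2 / (2 * (exp (2 * s n) - 1)))) \<longlongrightarrow> 0) F"
  proof (rule Lim_null_comparison)
    have "\<forall>\<^sub>F n in F. norm (x n) \<le> 1 / 2"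
      using tendstoD[OF x0, of "1/2"] by (auto elim: eventually_mono)
    then show "\<forall>\<^sub>F n in F. norm (of_nat t * (marked_log (x n) (s n) - x n / (exp (s n) - 1) + (x n)\<^sup>2 / (2 * (exp (2 * s n) - 1))))
       \<le> 2 * norm (x n * of_real (r n)) ^ 3 * (1 / r n) / saddle_const"
      using pos
    proof eventually_elim
      case (elim n)
      have Re: "Re (s n) = real t * saddle_const / (r n)\<^sup>2" by (simp add: s_def saddle_def)
      have Re_pos: "0 < Re (s n)" using t elim by (simp add: Re)
      have "norm (marked_log (x n) (s n) - x n / (exp (s n) - 1) + (x n)\<^sup>2 / (2 * (exp (2 * s n) - 1)))
        \<le> 2 * norm (x n) ^ 3 / (exp (Re (s n)) - 1)"
        by (rule marked_log_estimate(1)[OF Re_pos elim(1)])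
      also have "\<dots> \<le> 2 * norm (x n) ^ 3 / Re (s n)"
      proof (rule divide_left_mono)
        show le: "Re (s n) \<le> exp (Re (s n)) - 1" using exp_ge_add_one_self[of "Re (s n)"] by linarith
        show "0 < (exp (Re (s n)) - 1) * Re (s n)" using le Re_pos by (intro mult_pos_pos) linarith+
      qed simp
      finally have "real t * norm (marked_log (x n) (s n) - x n / (exp (s n) - 1) + (x n)\<^sup>2 / (2 * (exp (2 * s n) - 1)))
        \<le> real t * (2 * norm (x n) ^ 3 / Re (s n))" by (rule mult_left_mono) simp
      also have "\<dots> = 2 * norm (x n * of_real (r n)) ^ 3 * (1 / r n) / saddle_const"
        using t elim by (simp add: Re norm_mult power_mult_distrib field_simps power2_eq_square power3_eq_cube)
      finally show ?case by (simp add: norm_mult)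
    qed
    have "((\<lambda>n. 2 * norm (x n * of_real (r n)) ^ 3 * (1 / r n) / saddle_const) \<longlongrightarrow> 2 * norm w0 ^ 3 * 0 / saddle_const) F"
      using saddle_const_pos by (intro tendsto_intros xr ri) (simp del: saddle_const_pos)
    then show "((\<lambda>n. 2 * norm (x n * of_real (r n)) ^ 3 * (1 / r n) / saddle_const) \<longlongrightarrow> 0) F" by simp
  qed
  have B: "((\<lambda>n. of_nat t * x n * bose_reg (s n)) \<longlongrightarrow> 0) F"
  proof (rule Lim_null_comparison)
    show "\<forall>\<^sub>F n in F. norm (of_nat t * x n * bose_reg (s n)) \<le> real t * norm (x n) * 4"
      using reg[of 1] by (auto simp: norm_mult elim!: eventually_mono intro!: mult_left_mono)
    have "((\<lambda>n. real t * norm (x n) * 4) \<longlongrightarrow> real t * norm (0::complex) * 4) F" by (intro tendsto_intros x0)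
    then show "((\<lambda>n. real t * norm (x n) * 4) \<longlongrightarrow> 0) F" by simp
  qed
  have C: "((\<lambda>n. of_nat t * (x n)\<^sup>2 * bose_reg (2 * s n) / 2) \<longlongrightarrow> 0) F"
  proof (rule Lim_null_comparison)
    show "\<forall>\<^sub>F n in F. norm (of_nat t * (x n)\<^sup>2 * bose_reg (2 * s n) / 2) \<le> real t * norm (x n) ^ 2 * 2"
      using reg2
    proof eventually_elim
      case (elim n)
      have "real t * norm (x n) ^ 2 * norm (bose_reg (2 * s n)) \<le> real t * norm (x n) ^ 2 * 4"
        using elim by (intro mult_left_mono) auto
      then show ?case by (simp add: norm_mult norm_power norm_divide)
    qed
    have "((\<lambda>n. real t * norm (x n) ^ 2 * 2) \<longlongrightarrow> real t * norm (0::complex) ^ 2 * 2) F" by (intro tendsto_intros x0)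
    then show "((\<lambda>n. real t * norm (x n) ^ 2 * 2) \<longlongrightarrow> 0) F" by simp
  qed
  have D: "((\<lambda>n. (x n - w n / of_real (r n)) * of_real ((r n)\<^sup>2) / S n) \<longlongrightarrow> w0\<^sup>2 / 2 / b) F"
    by (intro tendsto_divide xv S b)
  have E: "((\<lambda>n. (x n * of_real (r n))\<^sup>2 / (4 * S n)) \<longlongrightarrow> w0\<^sup>2 / (4 * b)) F"
    using b by (intro tendsto_intros xr S) simp
  have G: "((\<lambda>n. \<i> * w n * of_real u / (S n * b)) \<longlongrightarrow> \<i> * w0 * of_real u / (b * b)) F"
    using b by (intro tendsto_intros w S) simp
  have "((\<lambda>n. of_nat t * (marked_log (x n) (s n) - x n / (exp (s n) - 1) + (x n)\<^sup>2 / (2 * (exp (2 * s n) - 1)))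
     + of_nat t * x n * bose_reg (s n) - of_nat t * (x n)\<^sup>2 * bose_reg (2 * s n) / 2
     + (x n - w n / of_real (r n)) * of_real ((r n)\<^sup>2) / S n - (x n * of_real (r n))\<^sup>2 / (4 * S n) + \<i> * w n * of_real u / (S n * b))
     \<longlongrightarrow> 0 + 0 - 0 + w0\<^sup>2 / 2 / b - w0\<^sup>2 / (4 * b) + \<i> * w0 * of_real u / (b * b)) F"
    by (intro tendsto_add tendsto_diff A B C D E G)
  moreover have "0 + 0 - 0 + w0\<^sup>2 / 2 / b - w0\<^sup>2 / (4 * b) + \<i> * w0 * of_real u / (b * b) =
     \<i> * w0 * of_real u / of_real (saddle_const\<^sup>2) + w0\<^sup>2 / of_real (4 * saddle_const)"
    using b by (simp add: b_def power2_eq_square field_simps)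
  moreover have "\<forall>\<^sub>F n in F. of_nat t * (marked_log (x n) (s n) - x n / (exp (s n) - 1) + (x n)\<^sup>2 / (2 * (exp (2 * s n) - 1)))
     + of_nat t * x n * bose_reg (s n) - of_nat t * (x n)\<^sup>2 * bose_reg (2 * s n) / 2
     + (x n - w n / of_real (r n)) * of_real ((r n)\<^sup>2) / S n - (x n * of_real (r n))\<^sup>2 / (4 * S n) + \<i> * w n * of_real u / (S n * b)
     = marked_exponent t (w n) (r n) u"
    using pos by eventually_elim (simp only: marked_exponent_decomp[OF t] x_def s_def S_def b_def)
  ultimately show ?thesis by (simp only: tendsto_cong)
qed

section \<open>Domination\<close>

text \<open>For \<open>|u| <= r\<close> the angle is at most of the order of \<open>\<tau>\<close>
  and the decay is quadratic in \<open>u\<close>; farther out it saturates at order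
  \<open>r^2\<close>. The expression \<open>min |u| r\<close> treats both ranges at once.\<close>

lemma Re_partition_exponent_le:
  assumes r: "1 \<le> r" "2 * saddle_const \<le> r\<^sup>2" and u: "\<bar>u\<bar> \<le> pi * r ^ 3"
  shows "Re (partition_exponent r u) \<le> - (1 / (2 * saddle_const * (1 + 18 * saddle_const\<^sup>2)) * (min \<bar>u\<bar> r)\<^sup>2)"
proof -
  define b where "b = saddle_const"
  define \<tau> where "\<tau> = b / r\<^sup>2"
  define y where "y = - (u / r ^ 3)"
  define m where "m = min \<bar>u\<bar> r"
  have b: "0 < b" by (simp add: b_def)
  have r0: "0 < r" using r by simp
  have \<tau>: "0 < \<tau>" using b r0 by (simp add: \<tau>_def)
  have "\<tau> \<le> 1 / 2" using r r0 by (simp add: \<tau>_def b_def divide_le_eq)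
  then have e: "1 / 2 \<le> exp (- \<tau>)" using exp_ge_add_one_self[of "- \<tau>"] by linarith
  have y: "\<bar>y\<bar> \<le> pi" using u r0 by (simp add: y_def divide_le_eq)
  have "Re (partition_exponent r u) = Re (partition_log (Complex \<tau> y)) - Re (partition_log (of_real \<tau>))"
    by (simp add: partition_exponent_def saddle_def \<tau>_def y_def b_def)
  also have "\<dots> \<le> Re (1 / (exp (Complex \<tau> y) - 1)) - 1 / (exp \<tau> - 1)"
    by (rule Re_partition_log_diff_le[OF \<tau>])
  also have "\<dots> \<le> - (1 / (2 * \<tau>) * (y\<^sup>2 / (y\<^sup>2 + 18 * \<tau>\<^sup>2)))"
    by (rule Re_bose_diff_le[OF \<tau> e y])
  also have "1 / (2 * \<tau>) * (y\<^sup>2 / (y\<^sup>2 + 18 * \<tau>\<^sup>2)) = 1 / (2 * b) * (u\<^sup>2 / (u\<^sup>2 / r\<^sup>2 + 18 * b\<^sup>2))"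
  proof -
    have "y\<^sup>2 = u\<^sup>2 / r ^ 6" "\<tau>\<^sup>2 = b\<^sup>2 / r ^ 4"
      by (simp_all add: y_def \<tau>_def power_divide power_mult[symmetric])
    moreover have "u\<^sup>2 / r ^ 6 / (u\<^sup>2 / r ^ 6 + 18 * (b\<^sup>2 / r ^ 4)) = u\<^sup>2 / (u\<^sup>2 / r\<^sup>2 + 18 * b\<^sup>2) / r\<^sup>2"
    proof -
      have "u\<^sup>2 / r ^ 6 + 18 * (b\<^sup>2 / r ^ 4) = (u\<^sup>2 / r\<^sup>2 + 18 * b\<^sup>2) / r ^ 4"
        using r0 by (simp add: field_simps eval_nat_numeral)
      moreover have "u\<^sup>2 / r ^ 6 / (X / r ^ 4) = u\<^sup>2 / X / r\<^sup>2" for X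
        using r0 by (simp add: eval_nat_numeral)
      ultimately show ?thesis by simp
    qed
    ultimately have "y\<^sup>2 / (y\<^sup>2 + 18 * \<tau>\<^sup>2) = u\<^sup>2 / (u\<^sup>2 / r\<^sup>2 + 18 * b\<^sup>2) / r\<^sup>2" by (simp only:)
    then show ?thesis using r0 b by (simp add: \<tau>_def)
  qed
  also have "- (1 / (2 * b) * (u\<^sup>2 / (u\<^sup>2 / r\<^sup>2 + 18 * b\<^sup>2))) \<le> - (1 / (2 * b) * (m\<^sup>2 / (1 + 18 * b\<^sup>2)))"
  proof -
    have D: "0 < u\<^sup>2 / r\<^sup>2 + 18 * b\<^sup>2" "0 < 1 + 18 * b\<^sup>2"
      using b by (intro add_nonneg_pos; simp)+
    have "m\<^sup>2 * (u\<^sup>2 / r\<^sup>2 + 18 * b\<^sup>2) \<le> u\<^sup>2 * (1 + 18 * b\<^sup>2)"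
    proof -
      have "m\<^sup>2 \<le> u\<^sup>2" "m\<^sup>2 \<le> r\<^sup>2"
        using r0 power_mono[of m "\<bar>u\<bar>" 2] power_mono[of m r 2] by (auto simp: m_def)
      then have "m\<^sup>2 / r\<^sup>2 \<le> 1" using r0 by (simp add: divide_le_eq)
      then have "m\<^sup>2 / r\<^sup>2 * u\<^sup>2 \<le> 1 * u\<^sup>2" by (rule mult_right_mono) simp
      moreover have "m\<^sup>2 * (18 * b\<^sup>2) \<le> u\<^sup>2 * (18 * b\<^sup>2)" using \<open>m\<^sup>2 \<le> u\<^sup>2\<close> by (rule mult_right_mono) simp
      ultimately show ?thesis by (simp add: algebra_simps)
    qed
    then have "m\<^sup>2 / (1 + 18 * b\<^sup>2) \<le> u\<^sup>2 / (u\<^sup>2 / r\<^sup>2 + 18 * b\<^sup>2)"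
      using D by (simp add: divide_le_eq le_divide_eq mult.commute)
    then have "1 / (2 * b) * (m\<^sup>2 / (1 + 18 * b\<^sup>2)) \<le> 1 / (2 * b) * (u\<^sup>2 / (u\<^sup>2 / r\<^sup>2 + 18 * b\<^sup>2))"
      using b by (intro mult_left_mono) auto
    then show ?thesis by linarith
  qed
  finally show ?thesis by (simp add: m_def b_def)
qed

text \<open>The growth is only linear in \<open>min |u| r\<close>, so the quadratic decay of the
  partition factor wins. The conditions on \<open>r\<close> bring \<open>norm (w / r)\<close> and
  \<open>t \<tau>\<close> down to at most \<open>1 / 4\<close>, where the Taylor estimates
  apply.\<close>

lemma Re_marked_exponent_le:
  assumes t: "0 < t" and W: "1 \<le> W" "norm w \<le> W" and r: "4 * W \<le> r" "4 * real t * saddle_const \<le> r\<^sup>2"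
  shows "Re (marked_exponent t w r u) \<le>
     (7 * W\<^sup>2 / saddle_const + 2 * real t) + 2 * W * (2 / saddle_const + 1 / saddle_const\<^sup>2) * min \<bar>u\<bar> r"
proof -
  define b where "b = saddle_const"
  define v where "v = w / of_real r"
  define x where "x = exp v - 1"
  define \<tau> where "\<tau> = b / r\<^sup>2"
  define y where "y = - (u / r ^ 3)"
  define m where "m = min \<bar>u\<bar> r"
  define s where "s = of_nat t * saddle r u"
  have b: "0 < b" by (simp add: b_def)
  have r0: "0 < r" using r W by linarith
  have \<tau>: "0 < \<tau>" using b r0 by (simp add: \<tau>_def)
  have s: "s = Complex (real t * \<tau>) (real t * y)" by (simp add: s_def saddle_def complex_eq_iff \<tau>_def y_def b_def)
  have t\<tau>: "0 < real t * \<tau>" "real t * \<tau> \<le> 1 / 4"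
    using t \<tau> r r0 by (auto simp: \<tau>_def b_def divide_le_eq mult.commute mult.left_commute)
  have nv: "norm v \<le> W / r" using W r0 by (simp add: v_def norm_divide divide_right_mono)
  have "W / r \<le> 1 / 4" using r r0 by (simp add: divide_le_eq)
  with nv have v4: "norm v \<le> 1 / 4" by linarith
  have xv: "norm (x - v) \<le> 2 * norm v ^ 2" unfolding x_def by (rule exp_Taylor_near_0(1)[OF v4])
  have "2 * norm v ^ 2 \<le> norm v"
  proof -
    have "norm v * norm v \<le> 1 / 4 * norm v" by (rule mult_right_mono[OF v4]) simp
    then show ?thesis unfolding power2_eq_square using norm_ge_zero[of v] by linarith
  qed
  then have nx: "norm x \<le> 2 * norm v" using xv norm_triangle_ineq2[of x v] by linarith
  then have x2: "norm x \<le> 1 / 2" "norm x \<le> 2 * (W / r)" using v4 nv by linarith+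
  \<comment> \<open>\<open>E1\<close> is the cubic remainder, \<open>E2\<close> the quadratic term,
    \<open>E3\<close> the change of the linear term between the real point and the angle,
    \<open>E4\<close> the centred linear term at the real point. Only the bound for
    \<open>E3\<close> involves \<open>u\<close>.\<close>
  define E1 where "E1 = of_nat t * (marked_log x s - x / (exp s - 1) + x\<^sup>2 / (2 * (exp (2 * s) - 1)))"
  define E2 where "E2 = of_nat t * (x\<^sup>2 / (2 * (exp (2 * s) - 1)))"
  define E3 where "E3 = of_nat t * x * (1 / (exp s - 1) - 1 / (exp (of_real (real t * \<tau>)) - 1))"
  define E4 where "E4 = of_nat t * x * (1 / (exp (of_real (real t * \<tau>)) - 1)) - w * of_real r / of_real b"
  have eq: "marked_exponent t w r u = E1 - E2 + E3 + E4"
    unfolding marked_exponent_def E1_def E2_def E3_def E4_def b_def x_def v_def s_def by (simp add: algebra_simps)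
  have x_sq: "(norm x * r)\<^sup>2 \<le> 4 * W\<^sup>2"
  proof -
    have "norm x * r \<le> 2 * W" using x2(2) r0 by (simp add: field_simps)
    then have "(norm x * r)\<^sup>2 \<le> (2 * W)\<^sup>2" using r0 by (intro power_mono) auto
    then show ?thesis by (simp add: power_mult_distrib)
  qed
  have Re_s: "Re s = real t * \<tau>" by (simp add: s)
  have b1: "norm E1 \<le> 4 * W\<^sup>2 / b"
  proof -
    have "norm (marked_log x s - x / (exp s - 1) + x\<^sup>2 / (2 * (exp (2 * s) - 1))) \<le> 2 * norm x ^ 3 / (exp (Re s) - 1)"
      by (rule marked_log_estimate(1)) (use t\<tau> x2 Re_s in auto)
    also have "\<dots> \<le> 2 * norm x ^ 3 / (real t * \<tau>)"
    proof (rule divide_left_mono)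
      show le: "real t * \<tau> \<le> exp (Re s) - 1" unfolding Re_s using exp_ge_add_one_self[of "real t * \<tau>"] by linarith
      show "0 < (exp (Re s) - 1) * (real t * \<tau>)" by (rule mult_pos_pos) (use le t\<tau> in linarith)+
    qed simp
    finally have "norm E1 \<le> real t * (2 * norm x ^ 3 / (real t * \<tau>))"
      unfolding E1_def norm_mult norm_of_nat by (rule mult_left_mono) simp
    also have "\<dots> = 2 * norm x * (norm x * r)\<^sup>2 / b"
      using t b r0 by (simp add: \<tau>_def field_simps power2_eq_square power3_eq_cube)
    also have "\<dots> \<le> 2 * (1 / 2) * (4 * W\<^sup>2) / b"
      using x2 x_sq b by (intro divide_right_mono mult_mono) auto
    finally show ?thesis by simp
  qed
  have b2: "norm E2 \<le> W\<^sup>2 / b"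
  proof -
    have "norm (1 / (exp (2 * s) - 1)) \<le> 1 / Re (2 * s)"
      by (rule norm_bose_le) (use t\<tau> Re_s in simp)
    then have "norm (of_nat t * x\<^sup>2 / 2) * norm (1 / (exp (2 * s) - 1)) \<le> norm (of_nat t * x\<^sup>2 / 2) * (1 / Re (2 * s))"
      by (rule mult_left_mono) simp
    moreover have "E2 = of_nat t * x\<^sup>2 / 2 * (1 / (exp (2 * s) - 1))" by (simp add: E2_def)
    ultimately have "norm E2 \<le> norm (of_nat t * x\<^sup>2 / 2) * (1 / Re (2 * s))" by (simp only: norm_mult)
    also have "\<dots> = (norm x * r)\<^sup>2 / (4 * b)"
      using t b r0 by (simp add: Re_s \<tau>_def norm_mult norm_power norm_divide field_simps power2_eq_square)
    also have "\<dots> \<le> 4 * W\<^sup>2 / (4 * b)" using x_sq b by (intro divide_right_mono) auto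
    finally show ?thesis by simp
  qed
  have b3: "norm E3 \<le> 2 * W * (2 / b + 1 / b\<^sup>2) * m"
  proof -
    define D where "D = norm (1 / (exp s - 1) - 1 / (exp (of_real (real t * \<tau>)) - 1))"
    have "D \<le> norm (1 / (exp s - 1)) + norm (1 / (exp (complex_of_real (real t * \<tau>)) - 1))"
      unfolding D_def by (rule norm_triangle_ineq4)
    also have "\<dots> \<le> 1 / (real t * \<tau>) + 1 / (real t * \<tau>)"
      using norm_bose_le[of s] norm_bose_le[of "of_real (real t * \<tau>)"] t\<tau> Re_s by (intro add_mono) simp_all
    finally have D1: "real t * D \<le> 2 / \<tau>" using t \<tau> by (simp add: field_simps)
    have "D \<le> \<bar>real t * y\<bar> / (real t * \<tau>)\<^sup>2"
      unfolding D_def s by (rule norm_bose_diff_le) (use t\<tau> in simp)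
    then have "real t * D \<le> real t * (\<bar>real t * y\<bar> / (real t * \<tau>)\<^sup>2)" by (rule mult_left_mono) simp
    also have "\<dots> = \<bar>y\<bar> / \<tau>\<^sup>2" using t by (simp add: abs_mult power2_eq_square)
    finally have D2: "real t * D \<le> \<bar>y\<bar> / \<tau>\<^sup>2" .
    have "norm E3 = norm x * (real t * D)" by (simp add: E3_def D_def norm_mult)
    also have "\<dots> \<le> 2 * (W / r) * (real t * D)"
      using x2 by (intro mult_right_mono) (simp_all add: D_def)
    also have "\<dots> \<le> 2 * (W / r) * (r * (2 / b + 1 / b\<^sup>2) * m)"
    proof (rule mult_left_mono)
      \<comment> \<open>Near the real point the mean value bound \<open>D2\<close> is used, away
        from it the trivial bound \<open>D1\<close>; both have order
        \<open>r * min |u| r\<close>.\<close>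
      show "real t * D \<le> r * (2 / b + 1 / b\<^sup>2) * m"
      proof (cases "\<bar>u\<bar> \<le> r")
        case True
        then have m: "m = \<bar>u\<bar>" by (simp add: m_def)
        have "\<bar>y\<bar> / \<tau>\<^sup>2 = r * (1 / b\<^sup>2) * m"
          unfolding m using r0 b by (simp add: y_def \<tau>_def field_simps power2_eq_square power3_eq_cube)
        also have "\<dots> \<le> r * (2 / b + 1 / b\<^sup>2) * m"
          using r0 b m by (intro mult_right_mono mult_left_mono) auto
        finally show ?thesis using D2 by linarith
      next
        case False
        then have m: "m = r" by (simp add: m_def)
        have "2 / \<tau> = r * (2 / b) * m"
          unfolding m using r0 b by (simp add: \<tau>_def field_simps power2_eq_square)
        also have "\<dots> \<le> r * (2 / b + 1 / b\<^sup>2) * m"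
          using r0 b m by (intro mult_right_mono mult_left_mono) auto
        finally show ?thesis using D1 by linarith
      qed
      show "0 \<le> 2 * (W / r)" using W r0 by simp
    qed
    also have "\<dots> = 2 * W * (2 / b + 1 / b\<^sup>2) * m" using r0 by simp
    finally show ?thesis .
  qed
  have b4: "norm E4 \<le> 2 * W\<^sup>2 / b + 2 * real t"
  proof -
    define T where "T = complex_of_real (real t * \<tau>)"
    have T: "T = of_nat t * of_real b / of_real (r\<^sup>2)" by (simp add: T_def \<tau>_def)
    have "norm T = real t * \<tau>" unfolding T_def norm_of_real using t\<tau>(1) by simp
    then have reg: "norm (bose_reg T) \<le> 4" using t\<tau> by (intro norm_bose_reg_le) simp_all
    have "of_nat t * x * (1 / T) = x * of_real (r\<^sup>2) / of_real b"
      using t r0 b by (simp add: T)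
    moreover have "w * of_real r / of_real b = v * of_real (r\<^sup>2) / of_real b"
      using r0 by (simp add: v_def power2_eq_square)
    moreover have "1 / (exp T - 1) = bose_reg T + 1 / T" by (simp add: bose_reg_def)
    ultimately have "E4 = (x - v) * of_real (r\<^sup>2) / of_real b + of_nat t * x * bose_reg T"
      unfolding E4_def T_def[symmetric] by (simp add: distrib_left left_diff_distrib diff_divide_distrib)
    then have "norm E4 \<le> norm (x - v) * r\<^sup>2 / b + real t * norm x * norm (bose_reg T)"
      using norm_triangle_ineq[of "(x - v) * of_real (r\<^sup>2) / of_real b" "of_nat t * x * bose_reg T"] b
      by (simp add: norm_mult norm_divide norm_power)
    also have "\<dots> \<le> 2 * (W / r)\<^sup>2 * r\<^sup>2 / b + real t * (1 / 2) * 4"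
    proof (intro add_mono mult_mono divide_right_mono)
      have "2 * norm v ^ 2 \<le> 2 * (W / r)\<^sup>2" using nv by (intro mult_left_mono power_mono) auto
      then show "norm (x - v) \<le> 2 * (W / r)\<^sup>2" using xv by linarith
    qed (use x2 reg b in auto)
    also have "\<dots> = 2 * W\<^sup>2 / b + 2 * real t" using r0 by (simp add: power_divide)
    finally show ?thesis .
  qed
  have "Re (marked_exponent t w r u) \<le> norm (E1 - E2 + E3 + E4)"
    unfolding eq by (rule complex_Re_le_cmod)
  also have "\<dots> \<le> norm E1 + norm E2 + norm E3 + norm E4"
    by (intro norm_triangle_mono norm_triangle_ineq4 order_refl)
  \<comment> \<open>The constant 7 collects 4 from \<open>E1\<close>, 1 from \<open>E2\<close> and 2
    from \<open>E4\<close>.\<close>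
  also have "\<dots> \<le> 4 * W\<^sup>2 / b + W\<^sup>2 / b + 2 * W * (2 / b + 1 / b\<^sup>2) * m + (2 * W\<^sup>2 / b + 2 * real t)"
    by (intro add_mono b1 b2 b3 b4)
  also have "\<dots> = (7 * W\<^sup>2 / b + 2 * real t) + 2 * W * (2 / b + 1 / b\<^sup>2) * m"
    by (simp add: field_simps)
  finally show ?thesis by (simp only: b_def m_def)
qed

text \<open>On the circle \<open>|u| \<le> pi * r ^ 3\<close> the truncation \<open>min |u| r\<close> is at least of order \<open>|u|\<^bsup>1/3\<^esup>\<close>,
  which makes the Gaussian factor integrable in \<open>u\<close>.\<close>

lemma exp_quadratic_min_le:
  fixes K A k :: real
  assumes "0 < k" "0 \<le> A"
  shows "\<exists>B. \<forall>r u. 1 \<le> r \<longrightarrow> \<bar>u\<bar> \<le> pi * r ^ 3 \<longrightarrow> exp (K + A * min \<bar>u\<bar> r - k * (min \<bar>u\<bar> r)\<^sup>2) \<le> B / (1 + u\<^sup>2)"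
proof -
  \<comment> \<open>Completing the square absorbs the linear term into half of the quadratic one:
    \<open>A m <= A^2 / (2 k) + k m^2 / 2\<close>.\<close>
  define c where "c = exp (K + A\<^sup>2 / (2 * k))"
  have "exp (K + A * min \<bar>u\<bar> r - k * (min \<bar>u\<bar> r)\<^sup>2) \<le> c * (2 + 6912 / k ^ 3) / (1 + u\<^sup>2)"
    if r: "1 \<le> r" and u: "\<bar>u\<bar> \<le> pi * r ^ 3" for r u :: real
  proof -
    define m where "m = min \<bar>u\<bar> r"
    have m0: "0 \<le> m" using r by (simp add: m_def)
    have "0 \<le> (A - k * m)\<^sup>2 / (2 * k)" using assms by simp
    also have "\<dots> = A\<^sup>2 / (2 * k) - A * m + k * m\<^sup>2 / 2"
      using assms by (simp add: power2_eq_square field_simps)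
    finally have "K + A * m - k * m\<^sup>2 \<le> (K + A\<^sup>2 / (2 * k)) + (- (k * m\<^sup>2 / 2))" by (simp add: field_simps)
    then have 1: "exp (K + A * m - k * m\<^sup>2) \<le> c * exp (- (k * m\<^sup>2 / 2))"
      unfolding c_def exp_add[symmetric] by simp
    \<comment> \<open>The constant is \<open>27 * 8 * 32\<close>:
      \<open>exp (- h) <= 27 / h^3\<close> for \<open>h = k m^2 / 2\<close>, and
      \<open>1 + u^2 <= 32 m^6\<close>, whose power 6 comes from
      \<open>|u| <= 4 r^3\<close>.\<close>
    have "exp (- (k * m\<^sup>2 / 2)) * (1 + u\<^sup>2) \<le> 2 + 6912 / k ^ 3"
    proof (cases "\<bar>u\<bar> \<le> 1")
      case True
      then have "u\<^sup>2 \<le> 1" by (simp add: abs_square_le_1)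
      moreover have "exp (- (k * m\<^sup>2 / 2)) \<le> 1" using assms by simp
      ultimately have "exp (- (k * m\<^sup>2 / 2)) * (1 + u\<^sup>2) \<le> 1 * 2" by (intro mult_mono) auto
      also have "\<dots> \<le> 2 + 6912 / k ^ 3" using assms by simp
      finally show ?thesis .
    next
      case False
      then have m: "1 \<le> m" using r by (simp add: m_def)
      have "u\<^sup>2 \<le> 16 * m ^ 6"
      proof (cases "\<bar>u\<bar> \<le> r")
        case True
        then have "m = \<bar>u\<bar>" by (simp add: m_def)
        then have "u\<^sup>2 = m ^ 2" by simp
        also have "\<dots> \<le> m ^ 6" using m by (intro power_increasing) auto
        also have "\<dots> \<le> 16 * m ^ 6" using m by simp
        finally show ?thesis .
      next
        case False
        then have "m = r" by (simp add: m_def)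
        have "\<bar>u\<bar> \<le> 4 * r ^ 3" using u pi_less_4 r by (meson less_imp_le mult_right_mono order_trans zero_le_power zero_le_one)
        then have "\<bar>u\<bar> ^ 2 \<le> (4 * r ^ 3) ^ 2" by (intro power_mono) auto
        then show ?thesis using \<open>m = r\<close> by (simp add: power_mult_distrib power_mult[symmetric])
      qed
      then have u2: "1 + u\<^sup>2 \<le> 32 * m ^ 6" using one_le_power[OF m, of 6] by linarith
      define h where "h = k * m\<^sup>2 / 2"
      have h: "0 < h" using assms m by (simp add: h_def)
      have "(h / 3) ^ 3 \<le> exp (h / 3) ^ 3"
        using h exp_ge_add_one_self[of "h / 3"] by (intro power_mono) linarith+
      also have "\<dots> = exp h" by (simp flip: exp_of_nat_mult)
      finally have "exp (- h) \<le> 27 / h ^ 3"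
        using h by (simp add: exp_minus power_divide field_simps)
      then have "exp (- h) * (1 + u\<^sup>2) \<le> 27 / h ^ 3 * (32 * m ^ 6)"
        using u2 h by (intro mult_mono) auto
      also have "\<dots> = 6912 / k ^ 3"
        using assms m by (simp add: h_def power_divide power_mult_distrib power_mult[symmetric] field_simps)
      finally show ?thesis by (simp add: h_def)
    qed
    then have "c * (exp (- (k * m\<^sup>2 / 2)) * (1 + u\<^sup>2)) \<le> c * (2 + 6912 / k ^ 3)"
      by (rule mult_left_mono) (simp add: c_def)
    then have "c * exp (- (k * m\<^sup>2 / 2)) \<le> c * (2 + 6912 / k ^ 3) / (1 + u\<^sup>2)"
      by (subst pos_le_divide_eq) (auto simp: mult.assoc intro: add_pos_nonneg)
    with 1 show ?thesis by (simp add: m_def)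
  qed
  then show ?thesis by blast
qed

section \<open>Convergence of the saddle point integrals\<close>

lemma hook_gf_exp:
  assumes t: "0 < t" and s: "0 < Re s" and u: "norm u \<le> 1 / 2"
  shows "hook_gf t (1 + u) (exp (- s)) = exp (partition_log s + of_nat t * marked_log u (of_nat t * s))"
proof -
  have ts: "0 < Re (of_nat t * s)" using t s by simp
  have zt: "exp (- s) ^ t = exp (- (of_nat t * s))" by (simp flip: exp_of_nat_mult)
  define D where "D = distinct_gf 1 (exp (- (of_nat t * s))) ^ t"
  \<comment> \<open>As a power of an exponential \<open>D\<close> is nonzero, so
    \<open>hook_gf_eq\<close> can be solved for \<open>hook_gf\<close>.\<close>
  have D: "D \<noteq> 0" unfolding D_def distinct_gf_1_eq_exp(1)[OF ts] by simp
  have "hook_gf t (1 + u) (exp (- s)) * D = distinct_gf 1 (exp (- s)) * distinct_gf (1 + u) (exp (- (of_nat t * s))) ^ t"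
    using hook_gf_eq[OF t norm_exp_minus_less_1[OF s], of "1 + u"] by (simp add: zt D_def)
  also have "\<dots> = (exp (partition_log s) * exp (marked_log u (of_nat t * s)) ^ t) * D"
    unfolding distinct_gf_1_eq_exp(1)[OF s] marked_log_estimate(2)[OF ts u] by (simp add: power_mult_distrib D_def)
  finally have "hook_gf t (1 + u) (exp (- s)) = exp (partition_log s) * exp (marked_log u (of_nat t * s)) ^ t"
    using D by simp
  then show ?thesis by (simp add: exp_add exp_of_nat_mult)
qed

definition saddle_integrand :: "nat \<Rightarrow> complex \<Rightarrow> real \<Rightarrow> real \<Rightarrow> complex" where
  "saddle_integrand t w r u = indicator {-pi..pi} (u / r ^ 3) *\<^sub>R exp (partition_exponent r u + marked_exponent t w r u)"

text \<open>Substitution of \<open>x = u / r^3\<close> in the coefficient integral, where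
  \<open>r^4 = n\<close> turns \<open>n x\<close> into \<open>r u\<close>. The last factor depends
  on \<open>n\<close> and \<open>r\<close> only, so it cancels in quotients of two such
  integrals.\<close>

lemma saddle_integrand_integral:
  assumes t: "0 < t" and r: "0 < r" "r ^ 4 = real n" and w: "norm (exp (w / of_real r) - 1) \<le> 1 / 2"
  shows "integrable lborel (saddle_integrand t w r)"
    and "integral\<^sup>L lborel (saddle_integrand t w r) =
      hook_poly t (exp (w / of_real r)) n * exp (- (w * of_real r / of_real saddle_const)) *
      (2 * of_real pi * of_real (r ^ 3) * exp (- partition_log (of_real (saddle_const / r\<^sup>2))) * of_real (exp (- (saddle_const / r\<^sup>2))) ^ n)"
proof -
  define \<tau> where "\<tau> = saddle_const / r\<^sup>2"
  define T where "T = exp (w / of_real r)"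
  define A where "A = exp (- partition_log (of_real \<tau>)) * exp (- (w * of_real r / of_real saddle_const))"
  define f where "f = (\<lambda>x. indicator {-pi..pi} x *\<^sub>R (hook_gf t T (exp (- Complex \<tau> (-x))) * exp (- (\<i> * of_nat n * of_real x))))"
  have \<tau>: "0 < \<tau>" using r by (simp add: \<tau>_def)
  note I = hook_poly_integral[OF t \<tau>, of T n, folded f_def]
  have c: "1 / r ^ 3 \<noteq> 0" using r by simp
  have eq: "saddle_integrand t w r u = A * f (0 + 1 / r ^ 3 * u)" for u
  proof -
    have s: "saddle r u = Complex \<tau> (- (u / r ^ 3))" by (simp add: saddle_def \<tau>_def)
    have Re: "0 < Re (saddle r u)" using \<tau> by (simp add: s)
    have "hook_gf t T (exp (- saddle r u)) = exp (partition_log (saddle r u) + of_nat t * marked_log (T - 1) (of_nat t * saddle r u))"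
      using hook_gf_exp[OF t Re, of "T - 1"] w by (simp add: T_def)
    moreover have "\<i> * of_nat n * complex_of_real (u / r ^ 3) = \<i> * of_real (r * u)"
    proof -
      have "real n * (u / r ^ 3) = r * u" using r by (simp add: r(2)[symmetric] eval_nat_numeral)
      then have "of_nat n * complex_of_real (u / r ^ 3) = of_real (r * u)" by (metis of_real_mult of_real_of_nat_eq)
      then show ?thesis by (simp only: mult.assoc)
    qed
    ultimately have "A * (hook_gf t T (exp (- Complex \<tau> (- (u / r ^ 3)))) * exp (- (\<i> * of_nat n * of_real (u / r ^ 3)))) =
      exp (partition_exponent r u + marked_exponent t w r u)"
      unfolding s[symmetric] A_def partition_exponent_def marked_exponent_def \<tau>_def[symmetric] T_def[symmetric]
      by (simp add: exp_add[symmetric] algebra_simps del: of_real_mult of_real_divide)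
    then show ?thesis by (simp add: saddle_integrand_def f_def)
  qed
  show "integrable lborel (saddle_integrand t w r)"
    unfolding eq by (intro integrable_mult_right lborel_integrable_real_affine I(1) c)
  have "integral\<^sup>L lborel f = \<bar>1 / r ^ 3\<bar> *\<^sub>R (\<integral>u. f (0 + 1 / r ^ 3 * u) \<partial>lborel)"
    by (rule lborel_integral_real_affine[OF c])
  then have "(\<integral>u. f (0 + 1 / r ^ 3 * u) \<partial>lborel) = of_real (r ^ 3) * integral\<^sup>L lborel f"
    using r by (simp add: scaleR_conv_of_real)
  moreover have "integral\<^sup>L lborel (saddle_integrand t w r) = A * (\<integral>u. f (0 + 1 / r ^ 3 * u) \<partial>lborel)"
    unfolding eq by simp
  ultimately show "integral\<^sup>L lborel (saddle_integrand t w r) =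
      hook_poly t (exp (w / of_real r)) n * exp (- (w * of_real r / of_real saddle_const)) *
      (2 * of_real pi * of_real (r ^ 3) * exp (- partition_log (of_real (saddle_const / r\<^sup>2))) * of_real (exp (- (saddle_const / r\<^sup>2))) ^ n)"
    unfolding I(2) by (simp add: A_def T_def \<tau>_def)
qed

definition saddle_limit :: "complex \<Rightarrow> real \<Rightarrow> complex" where
  "saddle_limit w u = exp (- of_real (u\<^sup>2 / saddle_const) + (\<i> * w * of_real u / of_real (saddle_const\<^sup>2) + w\<^sup>2 / of_real (4 * saddle_const)))"

lemma integrable_inverse_1_plus_square': "integrable lborel (\<lambda>x::real. B / (1 + x\<^sup>2))"
  using integrable_mult_right[OF integrable_inverse_1_plus_square[unfolded set_integrable_def], of B]
  by (simp add: divide_inverse)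

lemma saddle_integral_tendsto:
  assumes t: "0 < t" and r: "filterlim r at_top sequentially" and w: "w \<longlonglongrightarrow> w0"
    and r4: "\<forall>\<^sub>F n in sequentially. r n ^ 4 = real n"
  shows "(\<lambda>n. integral\<^sup>L lborel (saddle_integrand t (w n) (r n))) \<longlonglongrightarrow> integral\<^sup>L lborel (saddle_limit w0)"
proof -
  \<comment> \<open>The extra 1 makes \<open>W\<close> a bound for all late \<open>w n\<close>, so
    that the majorant is independent of \<open>n\<close>.\<close>
  define W where "W = norm w0 + 1"
  define k where "k = 1 / (2 * saddle_const * (1 + 18 * saddle_const\<^sup>2))"
  define A where "A = 2 * W * (2 / saddle_const + 1 / saddle_const\<^sup>2)"
  define K where "K = 7 * W\<^sup>2 / saddle_const + 2 * real t"
  have W: "1 \<le> W" by (simp add: W_def)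
  have "0 < 1 + 18 * saddle_const\<^sup>2" by (intro add_pos_nonneg) auto
  then have k: "0 < k" by (simp add: k_def)
  have A: "0 \<le> A" unfolding A_def using W less_imp_le[OF saddle_const_pos] by (intro mult_nonneg_nonneg add_nonneg_nonneg) auto
  obtain B where B: "\<And>r u. 1 \<le> r \<Longrightarrow> \<bar>u\<bar> \<le> pi * r ^ 3 \<Longrightarrow> exp (K + A * min \<bar>u\<bar> r - k * (min \<bar>u\<bar> r)\<^sup>2) \<le> B / (1 + u\<^sup>2)"
    using exp_quadratic_min_le[OF k A] by blast
  have "0 < B"
  proof -
    have "0 < exp (K + A * min \<bar>0\<bar> 1 - k * (min \<bar>0\<bar> 1)\<^sup>2)" by simp
    also have "\<dots> \<le> B / (1 + 0\<^sup>2)" by (rule B) auto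
    finally show ?thesis by simp
  qed
  have w_ev: "\<forall>\<^sub>F n in sequentially. norm (w n) \<le> W"
    using tendstoD[OF tendsto_norm[OF w], of 1] by (auto elim!: eventually_mono simp: W_def dist_real_def)
  have small: "\<forall>\<^sub>F n in sequentially. norm (exp (w n / of_real (r n)) - 1) \<le> 1 / 2"
    using tendstoD[OF exp_minus_1_scaled_tendsto(3)[OF r w], of "1/2"] by (auto elim: eventually_mono)
  define R where "R = max 1 (max (4 * W) (max (2 * saddle_const) (4 * real t * saddle_const)))"
  have r_ev: "\<forall>\<^sub>F n in sequentially. R \<le> r n"
    using r unfolding filterlim_at_top by blast
  have "\<forall>\<^sub>F n in sequentially. integrable lborel (saddle_integrand t (w n) (r n)) \<and>
     (\<forall>u. norm (saddle_integrand t (w n) (r n) u) \<le> B / (1 + u\<^sup>2))"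
    using w_ev r_ev small r4
  proof eventually_elim
    case (elim n)
    have rn: "1 \<le> r n" "4 * W \<le> r n" "2 * saddle_const \<le> r n" "4 * real t * saddle_const \<le> r n"
      using elim(2) by (auto simp: R_def)
    have "r n * 1 \<le> r n * r n" using rn by (intro mult_left_mono) auto
    then have "r n \<le> (r n)\<^sup>2" by (simp add: power2_eq_square)
    then have rn2: "2 * saddle_const \<le> (r n)\<^sup>2" "4 * real t * saddle_const \<le> (r n)\<^sup>2"
      using rn by linarith+
    have "norm (saddle_integrand t (w n) (r n) u) \<le> B / (1 + u\<^sup>2)" for u
    proof (cases "\<bar>u\<bar> \<le> pi * r n ^ 3")
      case True
      have "norm (saddle_integrand t (w n) (r n) u) \<le> exp (Re (partition_exponent (r n) u) + Re (marked_exponent t (w n) (r n) u))"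
        by (auto simp: saddle_integrand_def indicator_def)
      also have "\<dots> \<le> exp (K + A * min \<bar>u\<bar> (r n) - k * (min \<bar>u\<bar> (r n))\<^sup>2)"
        using Re_partition_exponent_le[OF rn(1) rn2(1) True] Re_marked_exponent_le[OF t W elim(1) rn(2) rn2(2), of u]
        by (simp add: k_def A_def K_def)
      also have "\<dots> \<le> B / (1 + u\<^sup>2)" by (rule B[OF rn(1) True])
      finally show ?thesis .
    next
      case False
      then have "u / r n ^ 3 \<notin> {-pi..pi}" using rn(1)
        by (auto simp: abs_le_iff divide_le_eq le_divide_eq)
      then show ?thesis using \<open>0 < B\<close> by (simp add: saddle_integrand_def add_nonneg_nonneg)
    qed
    moreover have "integrable lborel (saddle_integrand t (w n) (r n))"
      using rn(1) by (intro saddle_integrand_integral(1)[OF t _ elim(4) elim(3)]) simp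
    ultimately show ?case by blast
  qed
  \<comment> \<open>Dominated convergence asks for the majorant at every index, hence the shift by
    \<open>N\<close>, which is undone at the end.\<close>
  then obtain N where N: "\<And>n. N \<le> n \<Longrightarrow> integrable lborel (saddle_integrand t (w n) (r n))"
      "\<And>n u. N \<le> n \<Longrightarrow> norm (saddle_integrand t (w n) (r n) u) \<le> B / (1 + u\<^sup>2)"
    unfolding eventually_sequentially by blast
  have pt: "(\<lambda>n. saddle_integrand t (w n) (r n) u) \<longlonglongrightarrow> saddle_limit w0 u" for u
  proof -
    have "(\<lambda>n. exp (partition_exponent (r n) u + marked_exponent t (w n) (r n) u)) \<longlonglongrightarrow> saddle_limit w0 u"
      unfolding saddle_limit_def
      by (intro tendsto_exp tendsto_add partition_exponent_tendsto[OF r] marked_exponent_tendsto[OF t r w])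
    \<comment> \<open>For fixed \<open>u\<close> the cut-off at the ends of the circle is eventually
      inactive.\<close>
    moreover have "\<forall>\<^sub>F n in sequentially. max 1 \<bar>u\<bar> \<le> r n" using r unfolding filterlim_at_top by blast
    then have "\<forall>\<^sub>F n in sequentially. exp (partition_exponent (r n) u + marked_exponent t (w n) (r n) u) = saddle_integrand t (w n) (r n) u"
    proof eventually_elim
      case (elim n)
      then have rn: "1 \<le> r n" "\<bar>u\<bar> \<le> r n" by auto
      have "r n * 1 \<le> r n * (r n)\<^sup>2" using rn by (intro mult_left_mono one_le_power) auto
      also have "r n * (r n)\<^sup>2 = r n ^ 3" by (simp add: power3_eq_cube power2_eq_square)
      finally have "\<bar>u\<bar> \<le> r n ^ 3" using rn(2) by simp
      then have "\<bar>u / r n ^ 3\<bar> \<le> 1" using rn by (simp add: divide_le_eq)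
      then have "- 1 \<le> u / r n ^ 3" "u / r n ^ 3 \<le> 1" by linarith+
      then have "u / r n ^ 3 \<in> {-pi..pi}" using pi_gt3 unfolding atLeastAtMost_iff by linarith
      then show ?case by (simp add: saddle_integrand_def)
    qed
    ultimately show ?thesis by (rule Lim_transform_eventually)
  qed
  have "(\<lambda>n. integral\<^sup>L lborel (saddle_integrand t (w (n + N)) (r (n + N)))) \<longlonglongrightarrow> integral\<^sup>L lborel (saddle_limit w0)"
  proof (rule integral_dominated_convergence)
    show "saddle_limit w0 \<in> borel_measurable lborel"
    proof -
      have "continuous_on UNIV (saddle_limit w0)"
        unfolding saddle_limit_def[abs_def] using less_imp_neq[OF saddle_const_pos]
        by (intro continuous_intros) auto
      then show ?thesis by (simp add: borel_measurable_continuous_onI)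
    qed
    show "integrable lborel (\<lambda>x::real. B / (1 + x\<^sup>2))" by (rule integrable_inverse_1_plus_square')
    show "saddle_integrand t (w (n + N)) (r (n + N)) \<in> borel_measurable lborel" for n
      by (rule borel_measurable_integrable[OF N(1)]) simp
    show "AE x in lborel. (\<lambda>n. saddle_integrand t (w (n + N)) (r (n + N)) x) \<longlonglongrightarrow> saddle_limit w0 x"
      by (intro AE_I2 LIMSEQ_ignore_initial_segment pt)
    show "AE x in lborel. norm (saddle_integrand t (w (n + N)) (r (n + N)) x) \<le> B / (1 + x\<^sup>2)" for n
      by (intro AE_I2 N(2)) simp
  qed
  then show ?thesis by (rule LIMSEQ_offset)
qed

section \<open>Evaluation of the limiting Gaussian integral\<close>

lemma gaussian_integral_imaginary:
  fixes a y :: real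
  assumes "0 < a"
  shows "(\<integral>u. exp (- of_real (u\<^sup>2 / a) + \<i> * of_real (y * u)) \<partial>lborel) = of_real (sqrt (pi * a)) * exp (- of_real (a * y\<^sup>2 / 4))"
proof -
  \<comment> \<open>Rescaling by \<open>c\<close> turns the weight into a multiple of the standard
    normal density, whose characteristic function is known.\<close>
  define c where "c = sqrt (a / 2)"
  have c: "0 < c" "c\<^sup>2 = a / 2" using assms by (simp_all add: c_def)
  have "(\<integral>u. exp (- of_real (u\<^sup>2 / a) + \<i> * of_real (y * u)) \<partial>lborel) =
    c *\<^sub>R (\<integral>z. exp (- of_real ((0 + c * z)\<^sup>2 / a) + \<i> * of_real (y * (0 + c * z))) \<partial>lborel)"
    using lborel_integral_real_affine[of c "\<lambda>u. exp (- of_real (u\<^sup>2 / a) + \<i> * of_real (y * u))" 0] c by simp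
  also have "(\<lambda>z. exp (- of_real ((0 + c * z)\<^sup>2 / a) + \<i> * of_real (y * (0 + c * z)))) =
    (\<lambda>z. of_real (sqrt (2 * pi)) * (std_normal_density z *\<^sub>R iexp ((y * c) * z)))"
  proof
    fix z
    have q: "(0 + c * z)\<^sup>2 / a = z\<^sup>2 / 2"
      unfolding add_0 power_mult_distrib c(2) using assms by simp
    have "exp (- of_real ((0 + c * z)\<^sup>2 / a) + \<i> * of_real (y * (0 + c * z))) = of_real (exp (- z\<^sup>2 / 2)) * iexp ((y * c) * z)"
      unfolding q exp_add exp_of_real[symmetric] by (simp add: mult_ac)
    also have "exp (- z\<^sup>2 / 2) = sqrt (2 * pi) * std_normal_density z"
      by (simp add: normal_density_def)
    finally show "exp (- of_real ((0 + c * z)\<^sup>2 / a) + \<i> * of_real (y * (0 + c * z))) = of_real (sqrt (2 * pi)) * (std_normal_density z *\<^sub>R iexp ((y * c) * z))"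
      by (simp add: scaleR_conv_of_real mult_ac)
  qed
  also have "(\<integral>z. of_real (sqrt (2 * pi)) * (std_normal_density z *\<^sub>R iexp ((y * c) * z)) \<partial>lborel) = of_real (sqrt (2 * pi)) * char std_normal_distribution (y * c)"
  proof -
    have "char std_normal_distribution (y * c) = (\<integral>z. std_normal_density z *\<^sub>R iexp ((y * c) * z) \<partial>lborel)"
      unfolding char_def by (subst integral_density) (auto simp: normal_density_nonneg)
    then show ?thesis by (simp only: integral_mult_right_zero)
  qed
  also have "char std_normal_distribution (y * c) = of_real (exp (- ((y * c)\<^sup>2) / 2))"
    by (simp add: char_std_normal_distribution)
  also have "- ((y * c)\<^sup>2) / 2 = - (a * y\<^sup>2 / 4)" by (simp add: power_mult_distrib c)
  finally have "(\<integral>u. exp (- of_real (u\<^sup>2 / a) + \<i> * of_real (y * u)) \<partial>lborel) = of_real (c * sqrt (2 * pi)) * of_real (exp (- (a * y\<^sup>2 / 4)))"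
    by (simp add: scaleR_conv_of_real)
  also have "c * sqrt (2 * pi) = sqrt (pi * a)"
    by (simp add: c_def real_sqrt_mult[symmetric])
  finally show ?thesis by (simp add: exp_of_real[symmetric])
qed

text \<open>Translating the real line by \<open>a * Re c / 2\<close> completes the square for the
  real part of \<open>c\<close>; the imaginary part stays as a frequency and is covered by
  \<open>gaussian_integral_imaginary\<close>.\<close>

lemma gaussian_integral_complex:
  fixes a :: real and c :: complex
  assumes "0 < a"
  shows "(\<integral>u. exp (- of_real (u\<^sup>2 / a) + c * of_real u) \<partial>lborel) = of_real (sqrt (pi * a)) * exp (of_real a * c\<^sup>2 / 4)"
proof -
  define x y where "x = Re c" and "y = Im c"
  have c: "c = of_real x + \<i> * of_real y" by (simp add: x_def y_def complex_eq_iff)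
  define d where "d = a * x / 2"
  have "(\<integral>u. exp (- of_real (u\<^sup>2 / a) + c * of_real u) \<partial>lborel) = (\<integral>u. exp (- of_real ((d + 1 * u)\<^sup>2 / a) + c * of_real (d + 1 * u)) \<partial>lborel)"
    using lborel_integral_real_affine[of 1 "\<lambda>u. exp (- of_real (u\<^sup>2 / a) + c * of_real u)" d] by simp
  also have "(\<lambda>u. exp (- of_real ((d + 1 * u)\<^sup>2 / a) + c * of_real (d + 1 * u))) =
    (\<lambda>u. exp (of_real (a * x\<^sup>2 / 4) + \<i> * of_real (y * d)) * exp (- of_real (u\<^sup>2 / a) + \<i> * of_real (y * u)))"
  proof
    fix u
    have "- ((d + 1 * u)\<^sup>2 / a) + x * (d + 1 * u) = a * x\<^sup>2 / 4 - u\<^sup>2 / a"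
      using assms by (simp add: d_def power2_eq_square field_simps)
    then have "- complex_of_real ((d + 1 * u)\<^sup>2 / a) + of_real x * of_real (d + 1 * u) = of_real (a * x\<^sup>2 / 4) - of_real (u\<^sup>2 / a)"
      by (metis of_real_add of_real_diff of_real_minus of_real_mult)
    moreover have "c * of_real (d + 1 * u) = of_real x * of_real (d + 1 * u) + \<i> * of_real (y * d) + \<i> * of_real (y * u)"
      by (simp add: c algebra_simps)
    ultimately have "- complex_of_real ((d + 1 * u)\<^sup>2 / a) + c * of_real (d + 1 * u) =
      of_real (a * x\<^sup>2 / 4) - of_real (u\<^sup>2 / a) + \<i> * of_real (y * d) + \<i> * of_real (y * u)"
      by (metis (no_types) add.assoc)
    then have "- complex_of_real ((d + 1 * u)\<^sup>2 / a) + c * of_real (d + 1 * u) =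
      (of_real (a * x\<^sup>2 / 4) + \<i> * of_real (y * d)) + (- of_real (u\<^sup>2 / a) + \<i> * of_real (y * u))"
      by (simp only: diff_conv_add_uminus add_ac)
    then show "exp (- of_real ((d + 1 * u)\<^sup>2 / a) + c * of_real (d + 1 * u)) =
      exp (of_real (a * x\<^sup>2 / 4) + \<i> * of_real (y * d)) * exp (- of_real (u\<^sup>2 / a) + \<i> * of_real (y * u))"
      by (simp only: exp_add)
  qed
  also have "(\<integral>u. exp (of_real (a * x\<^sup>2 / 4) + \<i> * of_real (y * d)) * exp (- of_real (u\<^sup>2 / a) + \<i> * of_real (y * u)) \<partial>lborel)
     = exp (of_real (a * x\<^sup>2 / 4) + \<i> * of_real (y * d)) * (of_real (sqrt (pi * a)) * exp (- of_real (a * y\<^sup>2 / 4)))"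
    by (simp only: integral_mult_right_zero gaussian_integral_imaginary[OF assms])
  also have "\<dots> = of_real (sqrt (pi * a)) * exp (of_real (a * x\<^sup>2 / 4) + \<i> * of_real (y * d) - of_real (a * y\<^sup>2 / 4))"
    by (simp only: diff_conv_add_uminus exp_add mult_ac)
  also have "of_real (a * x\<^sup>2 / 4) + \<i> * of_real (y * d) - of_real (a * y\<^sup>2 / 4) = of_real a * c\<^sup>2 / 4"
    by (simp add: c d_def power2_eq_square algebra_simps)
  finally show ?thesis .
qed

definition hook_variance_const :: real where
  "hook_variance_const = (1 - 1 / saddle_const\<^sup>2) / (2 * saddle_const)"

lemma saddle_limit_integral:
  "integral\<^sup>L lborel (saddle_limit w) = of_real (sqrt (pi * saddle_const)) * exp (of_real hook_variance_const * w\<^sup>2 / 2)"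
proof -
  define b where "b = complex_of_real saddle_const"
  have b: "b \<noteq> 0" using saddle_const_pos by (simp add: b_def del: saddle_const_pos)
  have "integral\<^sup>L lborel (saddle_limit w) =
    (\<integral>u. exp (w\<^sup>2 / of_real (4 * saddle_const)) * exp (- of_real (u\<^sup>2 / saddle_const) + (\<i> * w / of_real (saddle_const\<^sup>2)) * of_real u) \<partial>lborel)"
    unfolding saddle_limit_def[abs_def] exp_add[symmetric]
    by (intro Bochner_Integration.integral_cong refl arg_cong[of _ _ exp]) simp
  also have "\<dots> = exp (w\<^sup>2 / of_real (4 * saddle_const)) * (of_real (sqrt (pi * saddle_const)) * exp (of_real saddle_const * (\<i> * w / of_real (saddle_const\<^sup>2))\<^sup>2 / 4))"
    by (simp only: integral_mult_right_zero gaussian_integral_complex[OF saddle_const_pos])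
  also have "\<dots> = of_real (sqrt (pi * saddle_const)) * exp (w\<^sup>2 / of_real (4 * saddle_const) + of_real saddle_const * (\<i> * w / of_real (saddle_const\<^sup>2))\<^sup>2 / 4)"
    by (simp add: exp_add)
  also have "w\<^sup>2 / of_real (4 * saddle_const) + of_real saddle_const * (\<i> * w / of_real (saddle_const\<^sup>2))\<^sup>2 / 4 = of_real hook_variance_const * w\<^sup>2 / 2"
  proof -
    have "w\<^sup>2 / (4 * b) + b * (\<i> * w / b\<^sup>2)\<^sup>2 / 4 = (1 - 1 / b\<^sup>2) / (2 * b) * w\<^sup>2 / 2"
      using b by (simp add: field_simps power2_eq_square)
    then show ?thesis by (simp add: b_def hook_variance_const_def)
  qed
  finally show ?thesis .
qed

lemma hook_poly_1: "hook_poly t 1 n = of_nat (card (partitions n))"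
  by (simp add: hook_poly_def)

text \<open>The integral for \<open>w n\<close> is divided by the one for \<open>w = 0\<close>, in
  which \<open>hook_poly t 1 n\<close> is p(n). The common prefactor cancels, and in the limit so
  does \<open>sqrt (pi * saddle_const)\<close>.\<close>

theorem hook_mgf_tendsto:
  assumes t: "0 < t" and w: "w \<longlonglongrightarrow> w0"
  defines "r \<equiv> (\<lambda>n. real n powr (1 / 4))"
  shows "(\<lambda>n. hook_poly t (exp (w n / of_real (r n))) n / of_nat (card (partitions n)) * exp (- (w n * of_real (r n) / of_real saddle_const)))
    \<longlonglongrightarrow> exp (of_real hook_variance_const * w0\<^sup>2 / 2)"
proof -
  have r: "filterlim r at_top sequentially" unfolding r_def by real_asymp
  have pos: "\<forall>\<^sub>F n in sequentially. 0 < r n"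
    using eventually_gt_at_top[of 0] by eventually_elim (simp add: r_def)
  have r4: "\<forall>\<^sub>F n in sequentially. r n ^ 4 = real n"
    using eventually_gt_at_top[of 0] by eventually_elim (simp add: r_def powr_power)
  have lim: "(\<lambda>n. integral\<^sup>L lborel (saddle_integrand t (w n) (r n))) \<longlonglongrightarrow> integral\<^sup>L lborel (saddle_limit w0)"
    by (rule saddle_integral_tendsto[OF t r w r4])
  have lim0: "(\<lambda>n. integral\<^sup>L lborel (saddle_integrand t 0 (r n))) \<longlonglongrightarrow> integral\<^sup>L lborel (saddle_limit 0)"
    by (rule saddle_integral_tendsto[OF t r tendsto_const r4])
  have nz: "integral\<^sup>L lborel (saddle_limit 0) \<noteq> 0"
    unfolding saddle_limit_integral using saddle_const_pos by (simp del: saddle_const_pos)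
  have small: "\<forall>\<^sub>F n in sequentially. norm (exp (w n / of_real (r n)) - 1) \<le> 1 / 2"
    using tendstoD[OF exp_minus_1_scaled_tendsto(3)[OF r w], of "1/2"] by (auto elim: eventually_mono)
  have "\<forall>\<^sub>F n in sequentially. integral\<^sup>L lborel (saddle_integrand t (w n) (r n)) / integral\<^sup>L lborel (saddle_integrand t 0 (r n))
    = hook_poly t (exp (w n / of_real (r n))) n / of_nat (card (partitions n)) * exp (- (w n * of_real (r n) / of_real saddle_const))"
    using small pos r4
  proof eventually_elim
    case (elim n)
    show ?case
      using saddle_integrand_integral(2)[OF t elim(2,3,1)] saddle_integrand_integral(2)[OF t elim(2,3), of 0] elim(2)
      by (simp add: hook_poly_1)
  qed
  moreover have "(\<lambda>n. integral\<^sup>L lborel (saddle_integrand t (w n) (r n)) / integral\<^sup>L lborel (saddle_integrand t 0 (r n)))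
     \<longlonglongrightarrow> integral\<^sup>L lborel (saddle_limit w0) / integral\<^sup>L lborel (saddle_limit 0)"
    by (rule tendsto_divide[OF lim lim0 nz])
  moreover have "integral\<^sup>L lborel (saddle_limit w0) / integral\<^sup>L lborel (saddle_limit 0) = exp (of_real hook_variance_const * w0\<^sup>2 / 2)"
    using nz unfolding saddle_limit_integral by simp
  ultimately show ?thesis by (simp only: tendsto_cong)
qed

section \<open>Moments and convergence in distribution\<close>

definition partition_avg :: "nat \<Rightarrow> (nat list \<Rightarrow> 'a :: real_vector) \<Rightarrow> 'a" where
  "partition_avg n f = (\<Sum>l\<in>partitions n. f l) /\<^sub>R real (card (partitions n))"

lemma card_partitions_pos: "0 < card (partitions n)"
  using finite_partitions partitions_nonempty by (simp add: card_gt_0_iff)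

lemma expectation_random_partition:
  fixes f :: "nat list \<Rightarrow> 'a :: {banach, second_countable_topology}"
  shows "measure_pmf.expectation (random_partition n) f = partition_avg n f"
proof -
  have "measure_pmf.expectation (random_partition n) f = (\<Sum>l\<in>partitions n. pmf (random_partition n) l *\<^sub>R f l)"
    by (rule integral_measure_pmf[OF finite_partitions])
       (simp add: random_partition_def set_pmf_of_set[OF partitions_nonempty finite_partitions])
  also have "\<dots> = partition_avg n f"
    unfolding partition_avg_def scaleR_sum_right
    by (rule sum.cong) (simp_all add: random_partition_def pmf_of_set[OF partitions_nonempty finite_partitions] divide_inverse)
  finally show ?thesis .
qed

lemma partition_avg_add: "partition_avg n (\<lambda>l. f l + g l) = partition_avg n f + partition_avg n g"
  by (simp add: partition_avg_def sum.distrib scaleR_add_right)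

lemma partition_avg_diff: "partition_avg n (\<lambda>l. f l - g l) = partition_avg n f - partition_avg n g"
  by (simp add: partition_avg_def sum_subtractf scaleR_diff_right)

lemma partition_avg_cmult: "partition_avg n (\<lambda>l. c * f l) = c * partition_avg n (f :: _ \<Rightarrow> 'a :: real_algebra)"
  by (simp add: partition_avg_def sum_distrib_left[symmetric])

lemma partition_avg_const: "partition_avg n (\<lambda>_. c) = c"
  using card_partitions_pos[of n] by (simp add: partition_avg_def scaleR_conv_of_real flip: scaleR_scaleR sum_constant_scaleR) (simp add: sum_constant_scaleR)

lemma partition_avg_mono:
  fixes f :: "nat list \<Rightarrow> real"
  assumes "\<And>l. l \<in> partitions n \<Longrightarrow> f l \<le> g l"
  shows "partition_avg n f \<le> partition_avg n g"
  unfolding partition_avg_def by (intro scaleR_left_mono sum_mono assms) auto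

lemma abs_partition_avg_le: "\<bar>partition_avg n f\<bar> \<le> partition_avg n (\<lambda>l. \<bar>f l :: real\<bar>)"
  by (simp add: partition_avg_def abs_mult mult_left_mono sum_abs)

lemma partition_avg_of_real: "partition_avg n (\<lambda>l. of_real (f l) :: complex) = of_real (partition_avg n f)"
  by (simp add: partition_avg_def scaleR_conv_of_real)

text \<open>Explicit substitutes \<open>sqrt (6 n) / pi\<close> for the mean and n^(1/4) for the
  scale are used, so that the limit theorem applies before the true moments are known.\<close>

definition centred_hooks :: "nat \<Rightarrow> nat \<Rightarrow> nat list \<Rightarrow> real" where
  "centred_hooks t n l = (real (num_hooks t l) - (real n powr (1 / 4))\<^sup>2 / saddle_const) / real n powr (1 / 4)"

lemma centred_cmgf_tendsto:
  fixes w :: "nat \<Rightarrow> complex"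
  assumes t: "0 < t" and w: "w \<longlonglongrightarrow> w0"
  shows "(\<lambda>n. partition_avg n (\<lambda>l. exp (w n * of_real (centred_hooks t n l)))) \<longlonglongrightarrow> exp (of_real hook_variance_const * w0\<^sup>2 / 2)"
proof -
  define r where "r = (\<lambda>n. real n powr (1 / 4))"
  have "\<forall>\<^sub>F n in sequentially. hook_poly t (exp (w n / of_real (r n))) n / of_nat (card (partitions n)) * exp (- (w n * of_real (r n) / of_real saddle_const))
     = partition_avg n (\<lambda>l. exp (w n * of_real (centred_hooks t n l)))"
    using eventually_gt_at_top[of 0]
  proof eventually_elim
    case (elim n)
    have rn: "0 < r n" using elim by (simp add: r_def)
    have "exp (w n / of_real (r n)) ^ k * exp (- (w n * of_real (r n) / of_real saddle_const)) =
      exp (w n * of_real ((real k - (r n)\<^sup>2 / saddle_const) / r n))" for k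
      unfolding exp_of_nat_mult[symmetric] exp_add[symmetric]
      using rn less_imp_neq[OF saddle_const_pos] by (simp add: field_simps power2_eq_square)
    then have "hook_poly t (exp (w n / of_real (r n))) n * exp (- (w n * of_real (r n) / of_real saddle_const))
      = (\<Sum>l\<in>partitions n. exp (w n * of_real (centred_hooks t n l)))"
      unfolding hook_poly_def sum_distrib_right by (simp add: centred_hooks_def r_def)
    then show ?case by (simp add: partition_avg_def scaleR_conv_of_real divide_inverse mult_ac)
  qed
  with hook_mgf_tendsto[OF t w] show ?thesis by (simp only: r_def tendsto_cong)
qed

lemma centred_mgf_tendsto:
  assumes t: "0 < t"
  shows "(\<lambda>n. partition_avg n (\<lambda>l. exp (a * centred_hooks t n l))) \<longlonglongrightarrow> exp (hook_variance_const * a\<^sup>2 / 2)"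
proof -
  have "(\<lambda>n. complex_of_real (partition_avg n (\<lambda>l. exp (a * centred_hooks t n l)))) \<longlonglongrightarrow> complex_of_real (exp (hook_variance_const * a\<^sup>2 / 2))"
    using centred_cmgf_tendsto[OF t tendsto_const[of "complex_of_real a"]]
    by (simp add: partition_avg_of_real[symmetric] exp_of_real[symmetric])
  then show ?thesis by (simp only: tendsto_of_real_iff)
qed

section \<open>From the moment generating function to the first two moments\<close>

lemma tendsto_by_approximation:
  fixes m :: "nat \<Rightarrow> real"
  assumes f: "\<forall>\<^sub>F a in F. (f a \<longlonglongrightarrow> L a)" and e: "\<forall>\<^sub>F a in F. \<forall>\<^sub>F n in sequentially. \<bar>m n - f a n\<bar> \<le> e a"
    and L: "(L \<longlongrightarrow> l) F" and e0: "(e \<longlongrightarrow> 0) F" and F: "F \<noteq> bot"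
  shows "m \<longlonglongrightarrow> l"
proof (rule tendstoI)
  fix d :: real assume d: "0 < d"
  have "\<forall>\<^sub>F a in F. dist (L a) l < d / 3" "\<forall>\<^sub>F a in F. dist (e a) 0 < d / 3"
    using d by (intro tendstoD[OF L] tendstoD[OF e0]; simp)+
  with f e have "\<forall>\<^sub>F a in F. (f a \<longlonglongrightarrow> L a) \<and> (\<forall>\<^sub>F n in sequentially. \<bar>m n - f a n\<bar> \<le> e a) \<and> dist (L a) l < d / 3 \<and> dist (e a) 0 < d / 3"
    by eventually_elim blast
  then obtain a where a: "f a \<longlonglongrightarrow> L a" "\<forall>\<^sub>F n in sequentially. \<bar>m n - f a n\<bar> \<le> e a" "dist (L a) l < d / 3" "dist (e a) 0 < d / 3"
    using eventually_happens'[OF F] by blast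
  have "\<forall>\<^sub>F n in sequentially. dist (f a n) (L a) < d / 3" using d by (intro tendstoD[OF a(1)]) simp
  with a(2) show "\<forall>\<^sub>F n in sequentially. dist (m n) l < d"
  proof eventually_elim
    case (elim n)
    then show ?case using a(3,4) unfolding dist_real_def by linarith
  qed
qed

text \<open>The majorant \<open>exp (2 x) + exp (- 2 x)\<close> has bounded averages, because the
  moment generating function converges at 2 and -2. One factor \<open>exp |x|\<close> covers the
  exponential in the Taylor remainder and another the power of \<open>x\<close>; 256 is
  \<open>4^4\<close>, from \<open>x^4 <= 4^4 exp |x|\<close>.\<close>

lemma cosh_sinh_Taylor_bounds:
  fixes a x :: real
  assumes "0 < a" "a \<le> 1"
  shows "\<bar>exp (a * x) + exp (- a * x) - 2 - a\<^sup>2 * x\<^sup>2\<bar> \<le> 256 * a ^ 4 * (exp (2 * x) + exp (- 2 * x))"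
    and "\<bar>exp (a * x) - exp (- a * x) - 2 * a * x\<bar> \<le> 256 * a ^ 3 * (exp (2 * x) + exp (- 2 * x))"
proof -
  define y where "y = a * x"
  have pow: "\<bar>x\<bar> ^ k \<le> 256 * exp \<bar>x\<bar>" if "k \<le> 4" for k
  proof -
    have "(4 + \<bar>x\<bar>) ^ 4 / 256 = ((4 + \<bar>x\<bar>) / 4) ^ 4" unfolding power_divide by simp
    also have "\<dots> = (1 + \<bar>x\<bar> / 4) ^ 4" by (simp add: add_divide_distrib)
    also have "\<dots> \<le> exp (\<bar>x\<bar> / 4) ^ 4"
      using exp_ge_add_one_self[of "\<bar>x\<bar> / 4"] by (intro power_mono) auto
    also have "\<dots> = exp \<bar>x\<bar>" by (simp flip: exp_of_nat_mult)
    finally have e: "(4 + \<bar>x\<bar>) ^ 4 / 256 \<le> exp \<bar>x\<bar>" .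
    have "\<bar>x\<bar> ^ k \<le> (4 + \<bar>x\<bar>) ^ k" by (intro power_mono) auto
    also have "\<dots> \<le> (4 + \<bar>x\<bar>) ^ 4" using that by (intro power_increasing) auto
    finally show ?thesis using e by simp
  qed
  have ya: "\<bar>y\<bar> \<le> \<bar>x\<bar>" using assms by (simp add: y_def abs_mult mult_left_le_one_le)
  have ee: "exp \<bar>x\<bar> * exp \<bar>x\<bar> \<le> exp (2 * x) + exp (- 2 * x)"
    by (cases "0 \<le> x") (simp_all flip: exp_add)
  have main: "exp \<bar>y\<bar> * \<bar>y\<bar> ^ k \<le> 256 * a ^ k * (exp (2 * x) + exp (- 2 * x))" if "k \<le> 4" for k
  proof -
    have "exp \<bar>y\<bar> * \<bar>y\<bar> ^ k = a ^ k * (exp \<bar>y\<bar> * \<bar>x\<bar> ^ k)"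
      using assms by (simp add: y_def abs_mult power_mult_distrib)
    also have "\<dots> \<le> a ^ k * (exp \<bar>x\<bar> * (256 * exp \<bar>x\<bar>))"
      using assms ya pow[OF that] by (intro mult_left_mono mult_mono) auto
    also have "\<dots> = 256 * a ^ k * (exp \<bar>x\<bar> * exp \<bar>x\<bar>)" by simp
    also have "\<dots> \<le> 256 * a ^ k * (exp (2 * x) + exp (- 2 * x))"
      using ee assms by (intro mult_left_mono) auto
    finally show ?thesis .
  qed
  have T3: "\<bar>exp z - (1 + z + z ^ 2 / 2 + z ^ 3 / 6)\<bar> \<le> exp \<bar>z\<bar> * \<bar>z\<bar> ^ 4 / 6" for z :: real
    using Taylor_exp_field[of z 3] by (simp add: eval_nat_numeral fact_numeral)
  have T2: "\<bar>exp z - (1 + z + z ^ 2 / 2)\<bar> \<le> exp \<bar>z\<bar> * \<bar>z\<bar> ^ 3 / 2" for z :: real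
    using Taylor_exp_field[of z 2] by (simp add: eval_nat_numeral fact_numeral)
  have "exp y + exp (- y) - 2 - y\<^sup>2 = (exp y - (1 + y + y ^ 2 / 2 + y ^ 3 / 6)) + (exp (- y) - (1 + (- y) + (- y) ^ 2 / 2 + (- y) ^ 3 / 6))"
    by simp
  then have "\<bar>exp y + exp (- y) - 2 - y\<^sup>2\<bar> \<le> exp \<bar>y\<bar> * \<bar>y\<bar> ^ 4 / 6 + exp \<bar>y\<bar> * \<bar>y\<bar> ^ 4 / 6"
    using T3[of y] T3[of "- y"] by (simp only: abs_minus_cancel) linarith
  also have "\<dots> \<le> exp \<bar>y\<bar> * \<bar>y\<bar> ^ 4" by (simp add: mult_nonneg_nonneg)
  also have "\<dots> \<le> 256 * a ^ 4 * (exp (2 * x) + exp (- 2 * x))" by (rule main) simp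
  finally show "\<bar>exp (a * x) + exp (- a * x) - 2 - a\<^sup>2 * x\<^sup>2\<bar> \<le> 256 * a ^ 4 * (exp (2 * x) + exp (- 2 * x))"
    by (simp add: y_def power_mult_distrib)
  have "exp y - exp (- y) - 2 * y = (exp y - (1 + y + y ^ 2 / 2)) - (exp (- y) - (1 + (- y) + (- y) ^ 2 / 2))"
    by simp
  then have "\<bar>exp y - exp (- y) - 2 * y\<bar> \<le> exp \<bar>y\<bar> * \<bar>y\<bar> ^ 3 / 2 + exp \<bar>y\<bar> * \<bar>y\<bar> ^ 3 / 2"
    using T2[of y] T2[of "- y"] by (simp only: abs_minus_cancel) linarith
  also have "\<dots> = exp \<bar>y\<bar> * \<bar>y\<bar> ^ 3" by simp
  also have "\<dots> \<le> 256 * a ^ 3 * (exp (2 * x) + exp (- 2 * x))" by (rule main) simp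
  finally show "\<bar>exp (a * x) - exp (- a * x) - 2 * a * x\<bar> \<le> 256 * a ^ 3 * (exp (2 * x) + exp (- 2 * x))"
    by (simp add: y_def mult.assoc)
qed

text \<open>Both moments are limits of symmetric difference quotients of the moment generating
  function at 0. The error of each quotient is \<open>O(a^2)\<close> uniformly in large
  \<open>n\<close>, so \<open>n\<close> may tend to infinity before \<open>a\<close> tends to
  0.\<close>

lemma centred_moments_tendsto:
  assumes t: "0 < t"
  shows "(\<lambda>n. partition_avg n (centred_hooks t n)) \<longlonglongrightarrow> 0"
    and "(\<lambda>n. partition_avg n (\<lambda>l. (centred_hooks t n l)\<^sup>2)) \<longlonglongrightarrow> hook_variance_const"
proof -
  define M where "M = (\<lambda>a n. partition_avg n (\<lambda>l. exp (a * centred_hooks t n l)))"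
  define V where "V = hook_variance_const"
  \<comment> \<open>\<open>G\<close> exceeds the limit of \<open>M 2 n + M (- 2) n\<close> by 1 and
    so bounds this sum for all large \<open>n\<close>.\<close>
  define G where "G = 2 * exp (V * 2\<^sup>2 / 2) + 1"
  have M: "M a \<longlonglongrightarrow> exp (V * a\<^sup>2 / 2)" for a
    using centred_mgf_tendsto[OF t, of a] by (simp add: M_def V_def)
  have "(\<lambda>n. M 2 n + M (- 2) n) \<longlonglongrightarrow> exp (V * 2\<^sup>2 / 2) + exp (V * (- 2)\<^sup>2 / 2)" by (intro tendsto_add M)
  then have "\<forall>\<^sub>F n in sequentially. dist (M 2 n + M (- 2) n) (exp (V * 2\<^sup>2 / 2) + exp (V * (- 2)\<^sup>2 / 2)) < 1"
    by (rule tendstoD) simp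
  then have G: "\<forall>\<^sub>F n in sequentially. M 2 n + M (- 2) n \<le> G"
    by eventually_elim (simp add: G_def dist_real_def)
  have small: "\<forall>\<^sub>F a in at_right (0::real). 0 < a \<and> a \<le> 1"
    by (rule eventually_at_rightI[of 0 1]) auto
  have avg: "partition_avg n (\<lambda>l. K * (exp (2 * centred_hooks t n l) + exp (- 2 * centred_hooks t n l))) = K * (M 2 n + M (- 2) n)" for K n
    by (simp add: partition_avg_cmult partition_avg_add M_def)
  show "(\<lambda>n. partition_avg n (\<lambda>l. (centred_hooks t n l)\<^sup>2)) \<longlonglongrightarrow> V"
  proof (rule tendsto_by_approximation[where F = "at_right 0"])
    show "\<forall>\<^sub>F a in at_right 0. (\<lambda>n. (M a n + M (- a) n - 2) / a\<^sup>2) \<longlonglongrightarrow> (exp (V * a\<^sup>2 / 2) + exp (V * (- a)\<^sup>2 / 2) - 2) / a\<^sup>2"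
      using small by eventually_elim (intro tendsto_intros M, simp)
    show "\<forall>\<^sub>F a in at_right 0. \<forall>\<^sub>F n in sequentially.
       \<bar>partition_avg n (\<lambda>l. (centred_hooks t n l)\<^sup>2) - (M a n + M (- a) n - 2) / a\<^sup>2\<bar> \<le> 256 * G * a\<^sup>2"
      using small
    proof eventually_elim
      case (elim a)
      show ?case using G
      proof eventually_elim
        case (elim n)
        have "\<bar>M a n + M (- a) n - 2 - a\<^sup>2 * partition_avg n (\<lambda>l. (centred_hooks t n l)\<^sup>2)\<bar>
          = \<bar>partition_avg n (\<lambda>l. exp (a * centred_hooks t n l) + exp (- a * centred_hooks t n l) - 2 - a\<^sup>2 * (centred_hooks t n l)\<^sup>2)\<bar>"
          by (simp add: M_def partition_avg_add partition_avg_diff partition_avg_cmult partition_avg_const)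
        also have "\<dots> \<le> partition_avg n (\<lambda>l. \<bar>exp (a * centred_hooks t n l) + exp (- a * centred_hooks t n l) - 2 - a\<^sup>2 * (centred_hooks t n l)\<^sup>2\<bar>)"
          by (rule abs_partition_avg_le)
        also have "\<dots> \<le> partition_avg n (\<lambda>l. 256 * a ^ 4 * (exp (2 * centred_hooks t n l) + exp (- 2 * centred_hooks t n l)))"
          using \<open>0 < a \<and> a \<le> 1\<close> by (intro partition_avg_mono cosh_sinh_Taylor_bounds(1)) auto
        also have "\<dots> \<le> 256 * a ^ 4 * G" unfolding avg using elim by (intro mult_left_mono) auto
        finally have le: "\<bar>M a n + M (- a) n - 2 - a\<^sup>2 * partition_avg n (\<lambda>l. (centred_hooks t n l)\<^sup>2)\<bar> \<le> 256 * a ^ 4 * G" .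
        have a: "0 < a\<^sup>2" using \<open>0 < a \<and> a \<le> 1\<close> by simp
        have "partition_avg n (\<lambda>l. (centred_hooks t n l)\<^sup>2) - (M a n + M (- a) n - 2) / a\<^sup>2
          = - (M a n + M (- a) n - 2 - a\<^sup>2 * partition_avg n (\<lambda>l. (centred_hooks t n l)\<^sup>2)) / a\<^sup>2"
          using a by (simp add: field_simps)
        then have "\<bar>partition_avg n (\<lambda>l. (centred_hooks t n l)\<^sup>2) - (M a n + M (- a) n - 2) / a\<^sup>2\<bar>
          = \<bar>M a n + M (- a) n - 2 - a\<^sup>2 * partition_avg n (\<lambda>l. (centred_hooks t n l)\<^sup>2)\<bar> / a\<^sup>2"
          by (simp only: abs_divide abs_minus_cancel) simp
        also have "\<dots> \<le> 256 * a ^ 4 * G / a\<^sup>2" using le a by (intro divide_right_mono) auto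
        also have "\<dots> = 256 * G * a\<^sup>2" using a by (simp add: eval_nat_numeral)
        finally show ?case .
      qed
    qed
    show "((\<lambda>a. (exp (V * a\<^sup>2 / 2) + exp (V * (- a)\<^sup>2 / 2) - 2) / a\<^sup>2) \<longlongrightarrow> V) (at_right 0)" by real_asymp
    show "((\<lambda>a. 256 * G * a\<^sup>2) \<longlongrightarrow> 0) (at_right 0)" by real_asymp
  qed simp
  show "(\<lambda>n. partition_avg n (centred_hooks t n)) \<longlonglongrightarrow> 0"
  proof (rule tendsto_by_approximation[where F = "at_right 0"])
    show "\<forall>\<^sub>F a in at_right 0. (\<lambda>n. (M a n - M (- a) n) / (2 * a)) \<longlonglongrightarrow> (exp (V * a\<^sup>2 / 2) - exp (V * (- a)\<^sup>2 / 2)) / (2 * a)"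
      using small by eventually_elim (intro tendsto_intros M, simp)
    show "\<forall>\<^sub>F a in at_right 0. \<forall>\<^sub>F n in sequentially.
       \<bar>partition_avg n (centred_hooks t n) - (M a n - M (- a) n) / (2 * a)\<bar> \<le> 128 * G * a\<^sup>2"
      using small
    proof eventually_elim
      case (elim a)
      show ?case using G
      proof eventually_elim
        case (elim n)
        have "\<bar>M a n - M (- a) n - 2 * a * partition_avg n (centred_hooks t n)\<bar>
          = \<bar>partition_avg n (\<lambda>l. exp (a * centred_hooks t n l) - exp (- a * centred_hooks t n l) - 2 * a * centred_hooks t n l)\<bar>"
          by (simp add: M_def partition_avg_diff partition_avg_cmult)
        also have "\<dots> \<le> partition_avg n (\<lambda>l. \<bar>exp (a * centred_hooks t n l) - exp (- a * centred_hooks t n l) - 2 * a * centred_hooks t n l\<bar>)"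
          by (rule abs_partition_avg_le)
        also have "\<dots> \<le> partition_avg n (\<lambda>l. 256 * a ^ 3 * (exp (2 * centred_hooks t n l) + exp (- 2 * centred_hooks t n l)))"
          using \<open>0 < a \<and> a \<le> 1\<close> by (intro partition_avg_mono cosh_sinh_Taylor_bounds(2)) auto
        also have "\<dots> \<le> 256 * a ^ 3 * G" unfolding avg using elim \<open>0 < a \<and> a \<le> 1\<close> by (intro mult_left_mono) auto
        finally have le: "\<bar>M a n - M (- a) n - 2 * a * partition_avg n (centred_hooks t n)\<bar> \<le> 256 * a ^ 3 * G" .
        have a: "0 < a" using \<open>0 < a \<and> a \<le> 1\<close> by simp
        have "partition_avg n (centred_hooks t n) - (M a n - M (- a) n) / (2 * a)
          = - (M a n - M (- a) n - 2 * a * partition_avg n (centred_hooks t n)) / (2 * a)"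
          using a by (simp add: field_simps)
        then have "\<bar>partition_avg n (centred_hooks t n) - (M a n - M (- a) n) / (2 * a)\<bar>
          = \<bar>M a n - M (- a) n - 2 * a * partition_avg n (centred_hooks t n)\<bar> / (2 * a)"
          using a by (simp add: abs_divide abs_minus_cancel)
        also have "\<dots> \<le> 256 * a ^ 3 * G / (2 * a)" using le a by (intro divide_right_mono) auto
        also have "\<dots> = 128 * G * a\<^sup>2" using a by (simp add: eval_nat_numeral)
        finally show ?case .
      qed
    qed
    show "((\<lambda>a. (exp (V * a\<^sup>2 / 2) - exp (V * (- a)\<^sup>2 / 2)) / (2 * a)) \<longlongrightarrow> 0) (at_right 0)" by simp
    show "((\<lambda>a. 128 * G * a\<^sup>2) \<longlongrightarrow> 0) (at_right 0)" by real_asymp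
  qed simp
qed

text \<open>Positivity amounts to \<open>pi^2 > 6\<close>, which \<open>pi > 3\<close>
  gives.\<close>

lemma hook_variance_const_pos: "0 < hook_variance_const"
proof -
  have "3 * 3 < pi * pi" using pi_gt3 by (intro mult_strict_mono) auto
  then have "1 < saddle_const\<^sup>2" unfolding saddle_const_square by (simp add: power2_eq_square)
  then have "1 / saddle_const\<^sup>2 < 1" by (subst divide_less_eq_1_pos) linarith+
  then have "0 < 1 - 1 / saddle_const\<^sup>2" by simp
  then show ?thesis unfolding hook_variance_const_def by (intro divide_pos_pos) auto
qed

lemma hook_variance_const_eq: "hook_variance_const = (pi\<^sup>2 - 6) * sqrt 6 / (2 * pi ^ 3)"
proof -
  have s: "sqrt 6 * sqrt 6 = (6 :: real)" by simp
  have "hook_variance_const = (1 - 6 / pi\<^sup>2) * sqrt 6 / (2 * pi)"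
    unfolding hook_variance_const_def saddle_const_square by (simp add: saddle_const_def)
  also have "\<dots> = (pi\<^sup>2 - 6) * sqrt 6 / (2 * pi ^ 3)"
    by (simp add: field_simps eval_nat_numeral)
  finally show ?thesis .
qed

section \<open>Mean, variance and limit law of the hook count itself\<close>

definition centred_mean :: "nat \<Rightarrow> nat \<Rightarrow> real" where
  "centred_mean t n = partition_avg n (centred_hooks t n)"

definition centred_variance :: "nat \<Rightarrow> nat \<Rightarrow> real" where
  "centred_variance t n = partition_avg n (\<lambda>l. (centred_hooks t n l)\<^sup>2) - (centred_mean t n)\<^sup>2"

lemma centred_variance_tendsto: "0 < t \<Longrightarrow> centred_variance t \<longlonglongrightarrow> hook_variance_const"
  unfolding centred_variance_def[abs_def] centred_mean_def
  using tendsto_diff[OF centred_moments_tendsto(2) tendsto_power[OF centred_moments_tendsto(1), of _ 2]] by simp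

text \<open>The count is an affine function of \<open>centred_hooks\<close> with positive slope
  n^(1/4), and standardising removes the affine change.\<close>

lemma hook_mean_eq:
  assumes "0 < n"
  shows "hook_mean t n = sqrt (real n) / saddle_const + real n powr (1 / 4) * centred_mean t n"
    and "hook_variance t n = sqrt (real n) * centred_variance t n"
    and "(real (num_hooks t l) - hook_mean t n) / sqrt (hook_variance t n) = (centred_hooks t n l - centred_mean t n) / sqrt (centred_variance t n)"
proof -
  define r where "r = real n powr (1 / 4)"
  have r: "0 < r" "r\<^sup>2 = sqrt (real n)"
    using assms by (simp_all add: r_def powr_power powr_half_sqrt)
  have Y: "real (num_hooks t l) = sqrt (real n) / saddle_const + r * centred_hooks t n l" for l
    using r(1) by (simp add: centred_hooks_def r_def[symmetric] r(2))
  have m: "hook_mean t n = sqrt (real n) / saddle_const + r * centred_mean t n"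
    unfolding hook_mean_def expectation_random_partition Y
    by (simp add: partition_avg_add partition_avg_const partition_avg_cmult centred_mean_def)
  then show "hook_mean t n = sqrt (real n) / saddle_const + real n powr (1 / 4) * centred_mean t n"
    by (simp add: r_def)
  have d: "real (num_hooks t l) - hook_mean t n = r * (centred_hooks t n l - centred_mean t n)" for l
    unfolding Y m by (simp add: algebra_simps)
  have "hook_variance t n = partition_avg n (\<lambda>l. (real (num_hooks t l) - hook_mean t n)\<^sup>2)"
    unfolding hook_variance_def hook_mean_def[symmetric] by (rule expectation_random_partition)
  also have "\<dots> = partition_avg n (\<lambda>l. r\<^sup>2 * ((centred_hooks t n l)\<^sup>2 - 2 * centred_mean t n * centred_hooks t n l + (centred_mean t n)\<^sup>2))"
    unfolding d by (simp add: power2_eq_square algebra_simps)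
  also have "\<dots> = r\<^sup>2 * (partition_avg n (\<lambda>l. (centred_hooks t n l)\<^sup>2) - 2 * centred_mean t n * partition_avg n (centred_hooks t n) + (centred_mean t n)\<^sup>2)"
    by (simp only: partition_avg_cmult partition_avg_add partition_avg_diff partition_avg_const)
  also have "\<dots> = r\<^sup>2 * centred_variance t n"
    by (simp add: centred_variance_def centred_mean_def power2_eq_square)
  finally show v: "hook_variance t n = sqrt (real n) * centred_variance t n" by (simp add: r(2))
  have "sqrt (hook_variance t n) = r * sqrt (centred_variance t n)"
    using r unfolding v r(2)[symmetric] by (simp add: real_sqrt_mult)
  then show "(real (num_hooks t l) - hook_mean t n) / sqrt (hook_variance t n) = (centred_hooks t n l - centred_mean t n) / sqrt (centred_variance t n)"
    unfolding d using r(1) by simp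
qed

text \<open>The true mean differs from \<open>sqrt (6 n) / pi\<close> by n^(1/4) times a null
  sequence, which is negligible against \<open>sqrt n\<close>.\<close>

lemma hook_mean_asymp:
  assumes t: "0 < t"
  shows "(\<lambda>n. hook_mean t n) \<sim>[sequentially] (\<lambda>n. sqrt (6 * real n) / pi - real t / 2)"
proof (rule asymp_equivI')
  define g where "g = (\<lambda>n::nat. sqrt (6 * real n) / pi - real t / 2)"
  have 1: "(\<lambda>n. sqrt (real n) / saddle_const / g n) \<longlonglongrightarrow> 1"
  proof -
    have "(\<lambda>n. sqrt (real n) / (pi / c) / (c * sqrt (real n) / pi - real t / 2)) \<longlonglongrightarrow> 1" if "0 < c" for c
      using that by real_asymp
    from this[of "sqrt 6"] show ?thesis by (simp add: g_def saddle_const_def real_sqrt_mult)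
  qed
  have 2: "(\<lambda>n. real n powr (1 / 4) / g n) \<longlonglongrightarrow> 0"
    unfolding g_def by real_asymp
  have "(\<lambda>n. sqrt (real n) / saddle_const / g n + real n powr (1 / 4) / g n * centred_mean t n) \<longlonglongrightarrow> 1 + 0 * 0"
    unfolding centred_mean_def by (intro tendsto_add tendsto_mult 1 2 centred_moments_tendsto(1) t)
  moreover have "\<forall>\<^sub>F n in sequentially. sqrt (real n) / saddle_const / g n + real n powr (1 / 4) / g n * centred_mean t n = hook_mean t n / g n"
    using eventually_gt_at_top[of 0] by eventually_elim (simp add: hook_mean_eq add_divide_distrib)
  ultimately show "(\<lambda>n. hook_mean t n / (sqrt (6 * real n) / pi - real t / 2)) \<longlonglongrightarrow> 1"
    by (simp add: g_def tendsto_cong)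
qed

lemma hook_variance_asymp:
  assumes t: "0 < t"
  shows "(\<lambda>n. hook_variance t n) \<sim>[sequentially] (\<lambda>n. (pi\<^sup>2 - 6) * sqrt (6 * real n) / (2 * pi ^ 3))"
proof (rule asymp_equivI')
  have "(\<lambda>n. centred_variance t n / hook_variance_const) \<longlonglongrightarrow> hook_variance_const / hook_variance_const"
    using hook_variance_const_pos by (intro tendsto_divide centred_variance_tendsto t) auto
  moreover have "\<forall>\<^sub>F n in sequentially. centred_variance t n / hook_variance_const = hook_variance t n / ((pi\<^sup>2 - 6) * sqrt (6 * real n) / (2 * pi ^ 3))"
    using eventually_gt_at_top[of 0]
  proof eventually_elim
    case (elim n)
    have "(pi\<^sup>2 - 6) * sqrt (6 * real n) / (2 * pi ^ 3) = sqrt (real n) * hook_variance_const"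
      unfolding hook_variance_const_eq by (simp add: real_sqrt_mult)
    then show ?case using elim by (simp add: hook_mean_eq(2))
  qed
  ultimately show "(\<lambda>n. hook_variance t n / ((pi\<^sup>2 - 6) * sqrt (6 * real n) / (2 * pi ^ 3))) \<longlonglongrightarrow> 1"
    using hook_variance_const_pos by (simp add: tendsto_cong)
qed

lemma asymptotically_normal_hooks:
  assumes t: "0 < t"
  shows "asymptotically_normal (\<lambda>n. measure_pmf (random_partition n)) (\<lambda>n lam. real (num_hooks t lam))"
  unfolding asymptotically_normal_def
proof (rule levy_continuity)
  define X where "X = (\<lambda>n lam. (real (num_hooks t lam) - hook_mean t n) / sqrt (hook_variance t n))"
  have X_eq: "(\<lambda>n. distr (measure_pmf (random_partition n)) borel
      (\<lambda>w. (real (num_hooks t w) - measure_pmf.expectation (random_partition n) (\<lambda>lam. real (num_hooks t lam))) /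
            sqrt (measure_pmf.variance (random_partition n) (\<lambda>lam. real (num_hooks t lam))))) =
      (\<lambda>n. distr (measure_pmf (random_partition n)) borel (X n))"
    unfolding X_def hook_mean_def hook_variance_def ..
  show "real_distribution (distr (measure_pmf (random_partition n)) borel
      (\<lambda>w. (real (num_hooks t w) - measure_pmf.expectation (random_partition n) (\<lambda>lam. real (num_hooks t lam))) /
            sqrt (measure_pmf.variance (random_partition n) (\<lambda>lam. real (num_hooks t lam)))))" for n
    by (rule prob_space.real_distribution_distr[OF prob_space_measure_pmf]) simp
  show "real_distribution std_normal_distribution" by (rule real_dist_normal_dist)
  fix s :: real
  define V where "V = hook_variance_const"
  define d where "d = (\<lambda>n. sqrt (centred_variance t n))"
  \<comment> \<open>Dividing by the true standard deviation makes the argument depend on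
    \<open>n\<close>; it converges because \<open>d n\<close> tends to
    \<open>sqrt V > 0\<close>.\<close>
  define w where "w = (\<lambda>n. \<i> * of_real (s / d n))"
  have V: "0 < V" by (simp add: V_def hook_variance_const_pos)
  have d: "d \<longlonglongrightarrow> sqrt V" unfolding d_def V_def by (intro tendsto_real_sqrt centred_variance_tendsto t)
  have w: "w \<longlonglongrightarrow> \<i> * of_real (s / sqrt V)" unfolding w_def using V by (intro tendsto_intros d) auto
  \<comment> \<open>Recentring at the true mean multiplies the characteristic function by this
    factor, which tends to 1.\<close>
  have "(\<lambda>n. exp (- (w n * of_real (centred_mean t n)))) \<longlonglongrightarrow> exp (- (\<i> * of_real (s / sqrt V) * of_real 0))"
    using centred_moments_tendsto(1)[OF t] by (intro tendsto_intros w) (simp add: centred_mean_def)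
  from tendsto_mult[OF this centred_cmgf_tendsto[OF t w]]
  have lim: "(\<lambda>n. exp (- (w n * of_real (centred_mean t n))) * partition_avg n (\<lambda>l. exp (w n * of_real (centred_hooks t n l))))
    \<longlonglongrightarrow> exp (of_real V * (\<i> * of_real (s / sqrt V))\<^sup>2 / 2)"
    by (simp add: V_def)
  have lim_eq: "exp (of_real V * (\<i> * of_real (s / sqrt V))\<^sup>2 / 2) = char std_normal_distribution s"
  proof -
    have "V * (s / sqrt V)\<^sup>2 = s\<^sup>2" using V by (simp add: power_divide)
    then have "of_real V * (\<i> * of_real (s / sqrt V))\<^sup>2 = - complex_of_real (s\<^sup>2)"
      by (metis (no_types, lifting) mult.commute mult_minus1_right of_real_mult of_real_power power2_i power_mult_distrib mult.left_commute)
    then show ?thesis by (simp add: char_std_normal_distribution exp_of_real[symmetric])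
  qed
  have "\<forall>\<^sub>F n in sequentially. exp (- (w n * of_real (centred_mean t n))) * partition_avg n (\<lambda>l. exp (w n * of_real (centred_hooks t n l)))
    = char (distr (measure_pmf (random_partition n)) borel (X n)) s"
    using eventually_gt_at_top[of 0]
  proof eventually_elim
    case (elim n)
    have "char (distr (measure_pmf (random_partition n)) borel (X n)) s = measure_pmf.expectation (random_partition n) (\<lambda>l. iexp (s * X n l))"
      unfolding char_def by (rule integral_distr) simp_all
    also have "\<dots> = partition_avg n (\<lambda>l. iexp (s * X n l))" by (rule expectation_random_partition)
    also have "(\<lambda>l. iexp (s * X n l)) = (\<lambda>l. exp (- (w n * of_real (centred_mean t n))) * exp (w n * of_real (centred_hooks t n l)))"
      unfolding exp_add[symmetric] X_def hook_mean_eq(3)[OF elim]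
      by (auto simp: w_def d_def fun_eq_iff divide_inverse algebra_simps)
    finally show ?case by (simp only: partition_avg_cmult)
  qed
  with lim have "(\<lambda>n. char (distr (measure_pmf (random_partition n)) borel (X n)) s) \<longlonglongrightarrow> char std_normal_distribution s"
    unfolding lim_eq by (simp only: tendsto_cong)
  then show "(\<lambda>n. char (distr (measure_pmf (random_partition n)) borel
      (\<lambda>w. (real (num_hooks t w) - measure_pmf.expectation (random_partition n) (\<lambda>lam. real (num_hooks t lam))) /
            sqrt (measure_pmf.variance (random_partition n) (\<lambda>lam. real (num_hooks t lam))))) s) \<longlonglongrightarrow> char std_normal_distribution s"
    unfolding X_def hook_mean_def hook_variance_def .
qed

section \<open>Passage to distribution functions\<close>

lemma cdf_std_normal:
  "isCont (cdf std_normal_distribution) x"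
  "cdf std_normal_distribution x = 1 / sqrt (2 * pi) * (LBINT y:{..x}. exp (- y\<^sup>2 / 2))"
proof -
  interpret N: real_distribution std_normal_distribution by (rule real_dist_normal_dist)
  have m: "measure std_normal_distribution A = (\<integral>y. std_normal_density y * indicator A y \<partial>lborel)" if "A \<in> sets borel" for A
  proof -
    have "measure std_normal_distribution A = (\<integral>y. indicator A y \<partial>std_normal_distribution)" by simp
    also have "\<dots> = (\<integral>y. std_normal_density y *\<^sub>R indicator A y \<partial>lborel)"
      using that by (intro integral_density) (auto simp: normal_density_nonneg)
    finally show ?thesis by simp
  qed
  \<comment> \<open>A point is a Lebesgue null set, so the limit law has no atoms.\<close>
  have "AE y in lborel. std_normal_density y * indicator {x} y = (0::real)"
    using AE_lborel_singleton[of x] by eventually_elim simp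
  then have "measure std_normal_distribution {x} = 0"
    by (subst m) (auto intro: integral_eq_zero_AE)
  then show "isCont (cdf std_normal_distribution) x" by (simp add: N.isCont_cdf)
  have "cdf std_normal_distribution x = (\<integral>y. std_normal_density y * indicator {..x} y \<partial>lborel)"
    unfolding cdf_def by (rule m) simp
  also have "\<dots> = (\<integral>y. 1 / sqrt (2 * pi) * (indicator {..x} y *\<^sub>R exp (- y\<^sup>2 / 2)) \<partial>lborel)"
    by (intro Bochner_Integration.integral_cong) (auto simp: normal_density_def)
  finally show "cdf std_normal_distribution x = 1 / sqrt (2 * pi) * (LBINT y:{..x}. exp (- y\<^sup>2 / 2))"
    by (simp only: set_lebesgue_integral_def integral_mult_right_zero)
qed

lemma hook_distribution_eq_cdf:
  assumes "0 < hook_variance t n"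
  shows "hook_distribution t (hook_mean t n + hook_sd t n * x) n =
    cdf (distr (measure_pmf (random_partition n)) borel (\<lambda>lam. (real (num_hooks t lam) - hook_mean t n) / sqrt (hook_variance t n))) x"
proof -
  have sd: "0 < sqrt (hook_variance t n)" using assms by simp
  have "cdf (distr (measure_pmf (random_partition n)) borel (\<lambda>lam. (real (num_hooks t lam) - hook_mean t n) / sqrt (hook_variance t n))) x
    = measure (measure_pmf (random_partition n)) {lam. (real (num_hooks t lam) - hook_mean t n) / sqrt (hook_variance t n) \<le> x}"
    unfolding cdf_def by (subst measure_distr) (auto simp: vimage_def)
  also have "{lam. (real (num_hooks t lam) - hook_mean t n) / sqrt (hook_variance t n) \<le> x} = {lam. real (num_hooks t lam) \<le> hook_mean t n + hook_sd t n * x}"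
    using sd by (auto simp: hook_sd_def divide_le_eq mult.commute)
  also have "measure (measure_pmf (random_partition n)) \<dots> = hook_distribution t (hook_mean t n + hook_sd t n * x) n"
    unfolding random_partition_def hook_distribution_def measure_pmf_of_set[OF partitions_nonempty finite_partitions]
    by (simp add: Int_def)
  finally show ?thesis ..
qed

theorem theorem1p1:
  fixes t :: nat
  assumes "0 < t"
  shows "(asymptotically_normal (\<lambda>n. measure_pmf (random_partition n))
            (\<lambda>n lam. real (num_hooks t lam))
          \<and> (\<lambda>n. hook_mean t n) \<sim>[sequentially] (\<lambda>n. sqrt (6 * real n) / pi - real t / 2)
          \<and> (\<lambda>n. hook_variance t n) \<sim>[sequentially]
              (\<lambda>n. (pi\<^sup>2 - 6) * sqrt (6 * real n) / (2 * pi ^ 3)))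
       \<and> (\<forall>x::real. (\<lambda>n. hook_distribution t (hook_mean t n + hook_sd t n * x) n)
              \<longlonglongrightarrow> 1 / sqrt (2 * pi) * (LBINT y:{..x}. exp (- y\<^sup>2 / 2)))"
proof (intro conjI allI)
  show an: "asymptotically_normal (\<lambda>n. measure_pmf (random_partition n)) (\<lambda>n lam. real (num_hooks t lam))"
    by (rule asymptotically_normal_hooks[OF assms])
  show "(\<lambda>n. hook_mean t n) \<sim>[sequentially] (\<lambda>n. sqrt (6 * real n) / pi - real t / 2)"
    by (rule hook_mean_asymp[OF assms])
  show "(\<lambda>n. hook_variance t n) \<sim>[sequentially] (\<lambda>n. (pi\<^sup>2 - 6) * sqrt (6 * real n) / (2 * pi ^ 3))"
    by (rule hook_variance_asymp[OF assms])
  fix x :: real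
  \<comment> \<open>Weak convergence gives convergence of distribution functions at continuity
    points of the limit, and every \<open>x\<close> is one.\<close>
  have "(\<lambda>n. cdf (distr (measure_pmf (random_partition n)) borel (\<lambda>lam. (real (num_hooks t lam) - hook_mean t n) / sqrt (hook_variance t n))) x)
    \<longlonglongrightarrow> cdf std_normal_distribution x"
    using an cdf_std_normal(1)[of x]
    unfolding asymptotically_normal_def weak_conv_m_def weak_conv_def hook_mean_def hook_variance_def by blast
  \<comment> \<open>Eventual positivity of the variance lets the bound \<open>mean + sd * x\<close>
    be rewritten as a bound on the standardised count.\<close>
  moreover have "\<forall>\<^sub>F n in sequentially. 0 < centred_variance t n"
    using order_tendstoD(1)[OF centred_variance_tendsto[OF assms] hook_variance_const_pos] .
  then have "\<forall>\<^sub>F n in sequentially. cdf (distr (measure_pmf (random_partition n)) borel (\<lambda>lam. (real (num_hooks t lam) - hook_mean t n) / sqrt (hook_variance t n))) x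
     = hook_distribution t (hook_mean t n + hook_sd t n * x) n"
    using eventually_gt_at_top[of 0]
    by eventually_elim (intro hook_distribution_eq_cdf[symmetric], simp add: hook_mean_eq(2))
  ultimately show "(\<lambda>n. hook_distribution t (hook_mean t n + hook_sd t n * x) n)
              \<longlonglongrightarrow> 1 / sqrt (2 * pi) * (LBINT y:{..x}. exp (- y\<^sup>2 / 2))"
    unfolding cdf_std_normal(2)[symmetric] by (rule Lim_transform_eventually)
qed

end
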